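(* Let $d\geq 2$, and let $E,Z\subset\mathbb{R}^d$, $T\subset\mathbb{R}_{>0}$ and $G\subset O(d)$ be non-empty Borel sets with $\dim_{\mathcal H}G>\frac{(d-1)(d-2)}{2}$. Let $GTE=\{rg(x): g\in G, r\in T, x\in E\}$ and $GTE+Z=\{y+z: y\in GTE, z\in Z\}$. Then: (i) $\dim_{\mathcal F}(GTE)\geq \dim_{\mathcal H}E+\dim_{\mathcal H}G+\dim_{\mathcal H}T-\frac{d^2-d+2}{2}$, and $\dim_{\mathcal S}(GTE+Z)\geq \dim_{\mathcal H}E+\dim_{\mathcal H}G+\dim_{\mathcal H}Z+\dim_{\mathcal H}T-\frac{d^2-d+2}{2}$. (ii) If $\dim_{\mathcal H}E+\dim_{\mathcal H}G+\dim_{\mathcal H}Z+\dim_{\mathcal H}T>\frac{d^2+d+2}{2}$, then $\mathcal{L}^d(GTE+Z)>0$. (iii) For $0<u<d$, if $\dim_{\mathcal H}E+\dim_{\mathcal H}G+\dim_{\mathcal H}Z+\dim_{\mathcal H}T>\frac{d^2-d+2}{2}+u$, then $\dim_{\mathcal H}(GTE+Z)\geq u$.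
   Context: $O(d)$ is the orthogonal group of $\mathbb{R}^d$ with its usual metric (e.g. from the operator norm), $\mathcal{L}^d$ is Lebesgue measure on $\mathbb{R}^d$, and $\dim_{\mathcal H}$ is Hausdorff dimension. For $A\subset\mathbb{R}^d$, $\mathcal{M}(A)$ is the set of non-zero Radon measures on $\mathbb{R}^d$ with compact support contained in $A$. The Fourier transform is $\widehat{\mu}(\xi)=\int e^{-2\pi i\xi\cdot x}\,d\mu(x)$. The Fourier dimension of $A$ is $\dim_{\mathcal F}A=\sup\{s\leq d:\ \exists \mu\in\mathcal{M}(A),\ \exists C>0 \text{ with } |\widehat{\mu}(x)|\leq C(1+|x|)^{-s/2}\text{ for all }x\in\mathbb{R}^d\}$. The Sobolev dimension of $\mu\in\mathcal{M}(\mathbb{R}^d)$ is $\dim_{\mathcal S}\mu=\sup\{s\in\mathbb{R}: \int|\widehat{\mu}(x)|^2(1+|x|)^{s-d}\,dx<\infty\}$, and the Sobolev dimension of a set $A$ is $\dim_{\mathcal S}A=\sup\{\dim_{\mathcal S}\mu:\ \mu\in\mathcal{M}(A)\text{ a probability measure}\}$. *)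

theory Defs
  imports "HOL-Analysis.Analysis"
begin

section \<open>Hausdorff dimension\<close>

text \<open>
  The \<open>s\<close>-th power of the diameter, with the usual conventions that the empty set contributes
  nothing and that \<open>0\<^sup>0 = 1\<close> for non-empty sets (whereas \<open>0 powr 0 = 0\<close>).
\<close>

definition diam_pow :: "real \<Rightarrow> 'a::metric_space set \<Rightarrow> ennreal" where
  "diam_pow s U =
     (if U = {} then 0 else if s = 0 then 1 else ennreal (diameter U powr s))"

text \<open>
  Boundedness of the covering sets is required explicitly because \<^const>\<open>diameter\<close> is only
  meaningful for bounded sets. Finite covers are included, since \<open>U i\<close> may be empty.
\<close>

definition hausdorff_premeasure :: "real \<Rightarrow> real \<Rightarrow> 'a::metric_space set \<Rightarrow> ennreal" where
  "hausdorff_premeasure \<delta> s A =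
     Inf {(\<Sum>i. diam_pow s (U i)) | U :: nat \<Rightarrow> 'a set.
            A \<subseteq> (\<Union>i. U i) \<and> (\<forall>i. bounded (U i) \<and> diameter (U i) \<le> \<delta>)}"

definition hausdorff_measure :: "real \<Rightarrow> 'a::metric_space set \<Rightarrow> ennreal" where
  "hausdorff_measure s A = (SUP \<delta>\<in>{0<..}. hausdorff_premeasure \<delta> s A)"

definition hausdorff_dim :: "'a::metric_space set \<Rightarrow> ereal" where
  "hausdorff_dim A = Inf (ereal ` {s. 0 \<le> s \<and> hausdorff_measure s A = 0})"

section \<open>Radon measures and their Fourier transforms\<close>

text \<open>
  A Radon measure on a Euclidean space is a Borel measure that is finite on compact sets; inner
  and outer regularity are then automatic.
\<close>

definition radon_measure :: "'a::euclidean_space measure \<Rightarrow> bool" where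
  "radon_measure \<mu> \<longleftrightarrow> sets \<mu> = sets borel \<and> (\<forall>K. compact K \<longrightarrow> emeasure \<mu> K < \<infinity>)"

definition measure_support :: "'a::topological_space measure \<Rightarrow> 'a set" where
  "measure_support \<mu> = {x. \<forall>U. open U \<longrightarrow> x \<in> U \<longrightarrow> emeasure \<mu> U > 0}"

definition radon_measures_on :: "'a::euclidean_space set \<Rightarrow> 'a measure set" where
  "radon_measures_on A =
     {\<mu>. radon_measure \<mu> \<and> emeasure \<mu> UNIV \<noteq> 0 \<and>
         compact (measure_support \<mu>) \<and> measure_support \<mu> \<subseteq> A}"

definition fourier_transform :: "'a::euclidean_space measure \<Rightarrow> 'a \<Rightarrow> complex" where
  "fourier_transform \<mu> \<xi> = (\<integral>x. exp (- 2 * of_real pi * \<i> * of_real (\<xi> \<bullet> x)) \<partial>\<mu>)"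

section \<open>Fourier and Sobolev dimension\<close>

definition fourier_dim :: "'a::euclidean_space set \<Rightarrow> ereal" where
  "fourier_dim A =
     Sup (ereal ` {s. s \<le> real DIM('a) \<and>
       (\<exists>\<mu>\<in>radon_measures_on A. \<exists>C>0. \<forall>x.
          cmod (fourier_transform \<mu> x) \<le> C * (1 + norm x) powr (- s / 2))})"

definition sobolev_dim_measure :: "'a::euclidean_space measure \<Rightarrow> ereal" where
  "sobolev_dim_measure \<mu> =
     Sup (ereal ` {s. (\<integral>\<^sup>+x. ennreal ((cmod (fourier_transform \<mu> x))\<^sup>2 *
                          (1 + norm x) powr (s - real DIM('a))) \<partial>lborel) < \<infinity>})"

definition sobolev_dim :: "'a::euclidean_space set \<Rightarrow> ereal" where
  "sobolev_dim A =
     Sup (sobolev_dim_measure ` {\<mu> \<in> radon_measures_on A. emeasure \<mu> UNIV = 1})"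

section \<open>The orthogonal group and the sets under consideration\<close>

text \<open>
  \<open>O(d)\<close> sits inside the space of bounded linear maps, whose metric is that of the operator
  norm. It is closed there, so its Borel subsets are the Borel sets of the ambient space that
  are contained in it.
\<close>

definition orthogonal_group :: "('a::euclidean_space \<Rightarrow>\<^sub>L 'a) set" where
  "orthogonal_group = {g. orthogonal_transformation (blinfun_apply g)}"

definition rotated_dilates ::
    "('a::euclidean_space \<Rightarrow>\<^sub>L 'a) set \<Rightarrow> real set \<Rightarrow> 'a set \<Rightarrow> 'a set" where
  "rotated_dilates G T E = {r *\<^sub>R blinfun_apply g x | g r x. g \<in> G \<and> r \<in> T \<and> x \<in> E}"

definition sumset :: "'a::plus set \<Rightarrow> 'a set \<Rightarrow> 'a set" where
  "sumset A B = {y + z | y z. y \<in> A \<and> z \<in> B}"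

end

theory Submission
  imports Defs "HOL-Probability.Probability" "HOL-Real_Asymp.Real_Asymp"
begin

text \<open>
  Take Frostman measures on \<open>E\<close>, \<open>G\<close>, \<open>T\<close> and \<open>Z\<close> with exponents close to the dimensions \<open>e\<close>, \<open>g\<close>,
  \<open>t\<close> and \<open>z\<close>, and let \<open>\<mu>\<close> be the image of the first three under \<open>(x, g, r) \<mapsto> r g(x)\<close>. By the
  Cauchy--Schwarz inequality, \<open>|\<mu>^(\<xi>)|\<^sup>2\<close> is at most the average of \<open>|\<alpha>^|\<^sup>2\<close>, where \<open>\<alpha>\<close> is the
  measure on \<open>E\<close>, over the points \<open>r g\<^sup>T(\<xi>)\<close>. These points are well distributed: the matrices
  sending \<open>\<xi>\<close> close to a given point form a neighbourhood of a coset of \<open>O(d - 1)\<close>, which has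
  dimension \<open>(d - 1)(d - 2)/2\<close>, so at scale one each ball has mass about
  \<open>|\<xi>| powr ((d - 1)(d - 2)/2 - g - t)\<close>. As \<open>\<alpha>\<close> has compact support, \<open>|\<alpha>^|\<^sup>2\<close> is essentially constant
  at scale one, and its integral over the ball of radius \<open>R\<close> is about \<open>R powr (d - e)\<close>. Multiplying
  the two bounds gives the Fourier decay of \<open>\<mu>\<close>. Convolving with the measure on \<open>Z\<close> adds \<open>z\<close> to
  the exponent in the mean square sense; this bounds the average measure of small balls, which
  gives the statements on Lebesgue measure and on Hausdorff dimension.

  Frostman's lemma is needed for Borel sets; Choquet's capacitability theorem, applied to the
  content of sets of words that code dyadic cubes, reduces it to compact sets.
\<close>

section \<open>Analytic sets and capacitability\<close>

text \<open>Fourier decay and ball conditions are exchanged through one exact identity: by Fubini,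
  the integral of |mu^|^2 against a Gaussian of width 1/k is the double integral of a Gaussian of
  width k, divided by k^d. All energies therefore carry Gaussian weights; powers and indicators of
  balls are compared with Gaussians over shells or dyadic scales. The constant (d^2 - d + 2)/2 is d
  + (d - 1)(d - 2)/2: the d from the energy of the measure on E, and the dimension of the stabiliser
  O(d - 1). The lower bound on dim G keeps the exponent of the orbit estimate nonnegative, so that
  it extends to large radii. Two definitions shape the rest. \<open>fourier_dim\<close> admits only
  exponents up to d, so the claimed bound must itself be shown to be at most d; this takes the upper
  bounds dim O(d) \<le> d(d - 1)/2, dim E \<le> d and dim T \<le> 1, obtained by bounding the
  exponents of Frostman measures. And \<open>emeasure\<close> is 0 on non-measurable sets, so GTE +
  Z, a continuous image of a Borel set, has to be shown Lebesgue measurable; this is a second use of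
  capacitability.\<close>

definition analytic_set :: "'a::topological_space set \<Rightarrow> bool" where
  "analytic_set A \<longleftrightarrow> (\<exists>C :: ('a \<times> (nat \<Rightarrow> nat)) set. closed C \<and> A = fst ` C)"

lemma closed_discrete [simp]: "closed (S :: 'a::discrete_topology set)"
  unfolding closed_def by (rule discrete_topology_class.open_discrete)

lemma analytic_set_closed: "closed A \<Longrightarrow> analytic_set A"
  unfolding analytic_set_def by (intro exI[of _ "A \<times> UNIV"]) (auto intro: closed_Times)

text \<open>The first entry of the parameter names the index \<open>n\<close>; the shifted rest
  witnesses membership in \<open>A n\<close>.\<close>

lemma analytic_set_UN:
  fixes A :: "nat \<Rightarrow> 'a::topological_space set"
  assumes "\<And>n. analytic_set (A n)"
  shows "analytic_set (\<Union>n. A n)"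
proof -
  obtain C where C: "\<And>n. closed (C n)" "\<And>n. A n = fst ` (C n :: ('a \<times> (nat \<Rightarrow> nat)) set)"
    using assms unfolding analytic_set_def by metis
  define h where "h = (\<lambda>p :: 'a \<times> (nat \<Rightarrow> nat). (fst p, \<lambda>k. snd p (Suc k)))"
  \<comment> \<open>A union over \<open>n\<close> of closed sets need not be closed. Stated as "if
    the first entry is \<open>n\<close>, then the tail lies in \<open>C n\<close>", the condition is
    an intersection of closed sets, because the first entry is a continuous function into a discrete
    space.\<close>
  define D where "D = (\<Inter>n. ((\<lambda>p. snd p 0) -` (-{n})) \<union> h -` (C n))"
  have cont: "continuous_on UNIV (\<lambda>p :: 'a \<times> (nat \<Rightarrow> nat). snd p k)" for k
    by (rule continuous_on_product_then_coordinatewise[OF continuous_on_snd[OF continuous_on_id]])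
  have h: "continuous_on UNIV h"
    unfolding h_def
    by (intro continuous_on_Pair continuous_on_fst continuous_on_id
        continuous_on_coordinatewise_then_product cont)
  have "closed D"
    unfolding D_def
    by (intro closed_INT ballI closed_Un closed_vimage h cont C) simp
  moreover have "(\<Union>n. A n) = fst ` D"
  proof (intro equalityI subsetI)
    fix x assume "x \<in> (\<Union>n. A n)"
    then obtain n s where ns: "(x, s) \<in> C n" using C(2) by force
    have "(x, \<lambda>k. case k of 0 \<Rightarrow> n | Suc j \<Rightarrow> s j) \<in> D"
      using ns by (auto simp: D_def h_def)
    then show "x \<in> fst ` D" by force
  next
    fix x assume "x \<in> fst ` D"
    then obtain s where "(x, s) \<in> D" by force
    then have "(x, \<lambda>k. s (Suc k)) \<in> C (s 0)" by (auto simp: D_def h_def)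
    then show "x \<in> (\<Union>n. A n)" using C(2) by force
  qed
  ultimately show ?thesis unfolding analytic_set_def by blast
qed

text \<open>A single sequence stores, through the pairing function, one parameter for each
  \<open>A n\<close>.\<close>

lemma analytic_set_INT:
  fixes A :: "nat \<Rightarrow> 'a::topological_space set"
  assumes "\<And>n. analytic_set (A n)"
  shows "analytic_set (\<Inter>n. A n)"
proof -
  obtain C where C: "\<And>n. closed (C n)" "\<And>n. A n = fst ` (C n :: ('a \<times> (nat \<Rightarrow> nat)) set)"
    using assms unfolding analytic_set_def by metis
  define h where "h n = (\<lambda>p :: 'a \<times> (nat \<Rightarrow> nat). (fst p, \<lambda>k. snd p (prod_encode (n, k))))" for n
  define D where "D = (\<Inter>n. h n -` (C n))"
  have cont: "continuous_on UNIV (\<lambda>p :: 'a \<times> (nat \<Rightarrow> nat). snd p k)" for k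
    by (rule continuous_on_product_then_coordinatewise[OF continuous_on_snd[OF continuous_on_id]])
  have h: "continuous_on UNIV (h n)" for n
    unfolding h_def
    by (intro continuous_on_Pair continuous_on_fst continuous_on_id
        continuous_on_coordinatewise_then_product cont)
  have "closed D"
    unfolding D_def
    by (intro closed_INT ballI closed_vimage h C)
  moreover have "(\<Inter>n. A n) = fst ` D"
  proof (intro equalityI subsetI)
    fix x assume "x \<in> (\<Inter>n. A n)"
    then have "\<forall>n. \<exists>s. (x, s) \<in> C n" using C(2) by force
    then obtain s where s: "\<And>n. (x, s n) \<in> C n" by metis
    have "(x, \<lambda>m. case prod_decode m of (n, k) \<Rightarrow> s n k) \<in> D"
      using s by (auto simp: D_def h_def)
    then show "x \<in> fst ` D" by force
  next
    fix x assume "x \<in> fst ` D"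
    then obtain s where "(x, s) \<in> D" by force
    then have "(x, \<lambda>k. s (prod_encode (n, k))) \<in> C n" for n by (auto simp: D_def h_def)
    then show "x \<in> (\<Inter>n. A n)" using C(2) by force
  qed
  ultimately show ?thesis unfolding analytic_set_def by blast
qed

lemma analytic_set_open:
  fixes U :: "'a::metric_space set"
  assumes "open U"
  shows "analytic_set U"
proof (cases "U = UNIV")
  \<comment> \<open>\<open>infdist\<close> to the empty complement is 0 by convention, so the
    exhaustion below would be empty for the whole space.\<close>
  case True
  then show ?thesis by (simp add: analytic_set_closed)
next
  case False
  define F where "F n = {x. 1 / real (Suc n) \<le> infdist x (- U)}" for n
  have "closed (F n)" for n
    unfolding F_def by (intro closed_Collect_le continuous_intros)
  then have "analytic_set (\<Union>n. F n)"
    by (intro analytic_set_UN analytic_set_closed)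
  moreover have "(\<Union>n. F n) = U"
  proof (intro equalityI subsetI)
    fix x assume "x \<in> (\<Union>n. F n)"
    then obtain n where n: "1 / real (Suc n) \<le> infdist x (- U)" by (auto simp: F_def)
    then have "infdist x (- U) > 0" by (rule less_le_trans[rotated]) simp
    then show "x \<in> U" by (metis ComplI infdist_zero less_irrefl)
  next
    fix x assume "x \<in> U"
    then have "infdist x (- U) > 0"
      using in_closed_iff_infdist_zero[of "- U" x] assms False infdist_nonneg[of x "- U"]
      by (auto simp: less_le)
    then obtain n where "1 / real (Suc n) < infdist x (- U)"
      using nat_approx_posE by blast
    then show "x \<in> (\<Union>n. F n)" by (auto simp: F_def intro: less_imp_le)
  qed
  ultimately show ?thesis by simp
qed

text \<open>Analytic sets are not closed under complements, so the induction carries a set and its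
  complement together; complementation then only swaps the two.\<close>

lemma analytic_set_borel:
  fixes A :: "'a::metric_space set"
  assumes "A \<in> sets borel"
  shows "analytic_set A"
proof -
  have "A \<in> sigma_sets UNIV {S. open S}" using assms by (simp add: sets_borel)
  then have "analytic_set A \<and> analytic_set (- A)"
  proof (induction rule: sigma_sets.induct)
    case (Basic a)
    then show ?case by (auto intro: analytic_set_open analytic_set_closed)
  next
    case Empty
    then show ?case by (auto intro: analytic_set_closed)
  next
    case (Compl a)
    then show ?case by (simp add: Compl_eq_Diff_UNIV[symmetric])
  next
    case (Union a)
    then show ?case by (simp add: analytic_set_UN analytic_set_INT)
  qed
  then show ?thesis ..
qed

lemma analytic_set_vimage_Int:
  assumes "analytic_set A" "continuous_on UNIV h" "closed F"
  shows "analytic_set (h -` A \<inter> F)"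
proof -
  obtain C where C: "closed C" "A = fst ` (C :: ('a \<times> (nat \<Rightarrow> nat)) set)"
    using assms(1) unfolding analytic_set_def by metis
  let ?D = "(\<lambda>p. (h (fst p), snd p)) -` C \<inter> (F \<times> UNIV)"
  have "continuous_on UNIV (\<lambda>p :: 'b \<times> (nat \<Rightarrow> nat). h (fst p))"
    by (rule continuous_on_compose2[OF assms(2)]) (auto intro: continuous_on_fst)
  then have "closed ?D"
    by (intro closed_Int closed_vimage C closed_Times assms continuous_on_Pair continuous_on_snd)
      auto
  moreover have "h -` A \<inter> F = fst ` ?D" unfolding C(2) by force
  ultimately show ?thesis unfolding analytic_set_def by blast
qed

lemma compact_bounded_sequences: "compact {s :: nat \<Rightarrow> nat. \<forall>i. s i \<le> b i}"
proof -
  have "compactin (product_topology (\<lambda>_. euclidean) UNIV) (PiE UNIV (\<lambda>i. {..b i}))"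
    by (subst compactin_PiE) (simp add: finite_imp_compact)
  then have "compact (PiE UNIV (\<lambda>i. {..b i}))"
    by (simp add: euclidean_product_topology)
  moreover have "PiE UNIV (\<lambda>i. {..b i}) = {s. \<forall>i. s i \<le> b i}" by (auto simp: PiE_def)
  ultimately show ?thesis by simp
qed

text \<open>
  Choquet's argument: bounding the coordinates of the Baire space parameter one at a time loses
  nothing in the limit, and in the end only a compact set of parameters is left.
\<close>

lemma capacitability:
  fixes \<phi> :: "'a::first_countable_topology set \<Rightarrow> ennreal"
  assumes mono: "\<And>A B. A \<subseteq> B \<Longrightarrow> \<phi> A \<le> \<phi> B"
    and cont: "\<And>A :: nat \<Rightarrow> 'a set. incseq A \<Longrightarrow> A 0 \<subseteq> B0 \<Longrightarrow> (\<Union>n. A n) \<subseteq> B0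
          \<Longrightarrow> \<phi> (\<Union>n. A n) \<le> (SUP n. \<phi> (A n))"
    and A: "analytic_set A" "A \<subseteq> B0" "compact B0" and c: "c < \<phi> A"
  obtains K where "compact K" "K \<subseteq> A" "\<And>U. open U \<Longrightarrow> K \<subseteq> U \<Longrightarrow> c \<le> \<phi> U"
proof -
  obtain C where C: "closed C" "A = fst ` (C :: ('a \<times> (nat \<Rightarrow> nat)) set)"
    using A(1) unfolding analytic_set_def by metis
  \<comment> \<open>Only the first \<open>k\<close> coordinates of the parameter are bounded so
    far.\<close>
  define D where "D f k = C \<inter> {p. \<forall>i<k. snd p i \<le> f i}" for f :: "nat \<Rightarrow> nat" and k :: nat
  have D_sub: "fst ` D f k \<subseteq> B0" for f k using A C by (auto simp: D_def)
  have D_cong: "D f k = D g k" if "\<forall>i<k. f i = g i" for f g k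
    using that by (auto simp: D_def)
  have "\<exists>F. \<forall>k. c < \<phi> (fst ` D (F k) k) \<and> (\<forall>i<k. F (Suc k) i = F k i)"
  proof (rule dependent_nat_choice)
    show "\<exists>f. c < \<phi> (fst ` D f 0)" using c C by (auto simp: D_def)
  next
    \<comment> \<open>Letting the bound on coordinate \<open>k\<close> grow exhausts the current
      set, so continuity from below yields a finite bound that still keeps the value above
      \<open>c\<close>.\<close>
    fix f k assume *: "c < \<phi> (fst ` D f k)"
    have eq: "fst ` D f k = (\<Union>n. fst ` D (f(k := n)) (Suc k))"
      by (force simp: D_def less_Suc_eq)
    have "incseq (\<lambda>n. fst ` D (f(k := n)) (Suc k))"
      by (auto simp: incseq_def D_def less_Suc_eq intro!: image_mono)
    then have "\<phi> (fst ` D f k) \<le> (SUP n. \<phi> (fst ` D (f(k := n)) (Suc k)))"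
      unfolding eq by (rule cont) (use D_sub in auto)
    with * have "c < (SUP n. \<phi> (fst ` D (f(k := n)) (Suc k)))" by simp
    then obtain n where "c < \<phi> (fst ` D (f(k := n)) (Suc k))" by (auto simp: less_SUP_iff)
    then show "\<exists>g. c < \<phi> (fst ` D g (Suc k)) \<and> (\<forall>i<k. g i = f i)"
      by (intro exI[of _ "f(k := n)"]) auto
  qed
  then obtain F where F: "\<And>k. c < \<phi> (fst ` D (F k) k)" "\<And>k i. i < k \<Longrightarrow> F (Suc k) i = F k i"
    by blast
  define b where "b i = F (Suc i) i" for i
  have Fb: "F k i = b i" if "i < k" for k i
    using that by (induction k) (auto simp: b_def less_Suc_eq F)
  have phi: "c < \<phi> (fst ` D b k)" for k
    using F(1)[of k] D_cong[of k "F k" b] Fb by auto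
  define S where "S = C \<inter> (B0 \<times> {s. \<forall>i. s i \<le> b i})"
  have "compact S"
    unfolding S_def by (intro closed_Int_compact C compact_Times A compact_bounded_sequences)
  show ?thesis
  proof
    show "compact (fst ` S)"
      by (intro compact_continuous_image \<open>compact S\<close> continuous_on_fst continuous_on_id)
    show "fst ` S \<subseteq> A" using C by (auto simp: S_def)
    fix U assume U: "open U" "fst ` S \<subseteq> U"
    have "\<exists>k. fst ` D b k \<subseteq> U"
    proof (rule ccontr)
      assume "\<not> ?thesis"
      then have "\<forall>k. \<exists>p. p \<in> D b k \<and> fst p \<notin> U" by blast
      then obtain p where p: "\<And>k. p k \<in> D b k" "\<And>k. fst (p k) \<notin> U" by metis
      \<comment> \<open>The \<open>k\<close>-th point obeys the bounds \<open>b\<close> only in its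
        first \<open>k\<close> coordinates. For a fixed coordinate finitely many points are exempt,
        so a larger bound \<open>b'\<close> covers all of them and gives a compact set in which a
        subsequence converges.\<close>
      define b' where "b' i = Max (insert (b i) ((\<lambda>m. snd (p m) i) ` {..i}))" for i
      have le: "snd (p k) i \<le> b' i" for k i
      proof (cases "k \<le> i")
        case True
        then show ?thesis unfolding b'_def by (intro Max_ge) auto
      next
        case False
        then have "snd (p k) i \<le> b i" using p(1)[of k] by (auto simp: D_def)
        also have "b i \<le> b' i" unfolding b'_def by (intro Max_ge) auto
        finally show ?thesis .
      qed
      have "compact (B0 \<times> {s. \<forall>i. s i \<le> b' i})"
        by (intro compact_Times A compact_bounded_sequences)
      then have "seq_compact (B0 \<times> {s. \<forall>i. s i \<le> b' i})"
        by (rule compact_imp_seq_compact)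
      moreover have "p k \<in> B0 \<times> {s. \<forall>i. s i \<le> b' i}" for k
        using p(1)[of k] le[of k] A C by (auto simp: D_def mem_Times_iff)
      ultimately obtain l r where lr: "strict_mono r" "(p \<circ> r) \<longlonglongrightarrow> l"
          "l \<in> B0 \<times> {s. \<forall>i. s i \<le> b' i}"
        using seq_compactE[of "B0 \<times> {s. \<forall>i. s i \<le> b' i}" p] by blast
      have "l \<in> C"
        by (rule closed_sequentially[OF C(1) _ lr(2)]) (use p(1) in \<open>auto simp: D_def\<close>)
      have "snd l i \<le> b i" for i
      proof -
        have "continuous_on UNIV (\<lambda>q :: 'a \<times> (nat \<Rightarrow> nat). snd q i)"
          by (rule continuous_on_product_then_coordinatewise[OF continuous_on_snd[OF continuous_on_id]])
        then have "(\<lambda>k. snd (p (r k)) i) \<longlonglongrightarrow> snd l i"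
          using continuous_on_tendsto_compose[OF _ lr(2), of UNIV "\<lambda>q. snd q i"] by (simp add: o_def)
        moreover have "snd (p (r k)) i \<le> b i" if "k \<ge> Suc i" for k
        proof -
          have "i < r k" using that seq_suble[OF lr(1), of k] by simp
          then show ?thesis using p(1)[of "r k"] by (auto simp: D_def)
        qed
        ultimately show ?thesis by (intro LIMSEQ_le_const2) auto
      qed
      with \<open>l \<in> C\<close> lr(3) have "l \<in> S" by (auto simp: S_def mem_Times_iff)
      then have "fst l \<in> U" using U by auto
      moreover have "(\<lambda>k. fst (p (r k))) \<longlonglongrightarrow> fst l"
        using tendsto_fst[OF lr(2)] by (simp add: o_def)
      ultimately have "eventually (\<lambda>k. fst (p (r k)) \<in> U) sequentially"
        using U(1) topological_tendstoD by blast
      then show False using p(2) by (auto simp: eventually_sequentially)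
    qed
    then obtain k where "fst ` D b k \<subseteq> U" ..
    then show "c \<le> \<phi> U" using phi[of k] mono by (meson less_le_trans less_imp_le)
  qed
qed

section \<open>Contents on spaces of sequences\<close>

definition prefix_word :: "(nat \<Rightarrow> 'b) \<Rightarrow> nat \<Rightarrow> 'b list" where
  "prefix_word \<sigma> k = map \<sigma> [0..<k]"

definition cylinder :: "'b list \<Rightarrow> (nat \<Rightarrow> 'b) set" where
  "cylinder w = {\<sigma>. prefix_word \<sigma> (length w) = w}"

definition sequences_below :: "nat \<Rightarrow> (nat \<Rightarrow> nat) set" where
  "sequences_below N = {\<sigma>. \<forall>i. \<sigma> i < N}"

text \<open>The weights are kept as a measure on the set of words, so that weights of infinite
  covers are added by measure theory.\<close>

definition word_weight :: "real \<Rightarrow> nat list measure" where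
  "word_weight q = point_measure UNIV (\<lambda>w. ennreal (q ^ length w))"

text \<open>For \<open>q = (1/2) powr s\<close> this is the dyadic \<open>s\<close>-dimensional
  Hausdorff content, with no restriction on the level of the cylinders.\<close>

definition cylinder_content :: "real \<Rightarrow> (nat \<Rightarrow> nat) set \<Rightarrow> ennreal" where
  "cylinder_content q S = (INF V\<in>{V. S \<subseteq> (\<Union>w\<in>V. cylinder w)}. emeasure (word_weight q) V)"

lemma length_prefix_word [simp]: "length (prefix_word \<sigma> k) = k"
  by (simp add: prefix_word_def)

lemma take_prefix_word: "j \<le> k \<Longrightarrow> take j (prefix_word \<sigma> k) = prefix_word \<sigma> j"
  by (simp add: prefix_word_def take_map)

lemma prefix_word_Suc: "prefix_word \<sigma> (Suc k) = prefix_word \<sigma> k @ [\<sigma> k]"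
  by (simp add: prefix_word_def)

lemma prefix_word_in_lists: "\<sigma> \<in> sequences_below N \<Longrightarrow> prefix_word \<sigma> k \<in> lists {..<N}"
  by (auto simp: prefix_word_def sequences_below_def)

lemma in_cylinder_prefix_word [simp]: "\<sigma> \<in> cylinder (prefix_word \<sigma> k)"
  by (simp add: cylinder_def)

lemma cylinder_Nil [simp]: "cylinder [] = UNIV"
  by (simp add: cylinder_def prefix_word_def)

lemma cylinder_snocD:
  assumes "\<sigma> \<in> cylinder (w @ [a])"
  shows "\<sigma> \<in> cylinder w" "\<sigma> (length w) = a"
  using assms by (auto simp: cylinder_def prefix_word_Suc)

lemma cylinder_snocI: "\<sigma> \<in> cylinder w \<Longrightarrow> \<sigma> \<in> cylinder (w @ [\<sigma> (length w)])"
  by (auto simp: cylinder_def prefix_word_Suc)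

lemma open_cylinder: "open (cylinder w :: (nat \<Rightarrow> nat) set)"
proof -
  have "cylinder w = (\<Inter>i\<in>{..<length w}. (\<lambda>\<sigma>. \<sigma> i) -` {w ! i})"
    unfolding cylinder_def prefix_word_def list_eq_iff_nth_eq[of "map _ _"] by auto
  also have "open \<dots>"
    by (intro open_INT ballI open_vimage discrete_topology_class.open_discrete
        continuous_on_product_then_coordinatewise[OF continuous_on_id]) simp
  finally show ?thesis .
qed

lemma sets_word_weight [simp]: "sets (word_weight q) = UNIV"
  by (simp add: word_weight_def sets_point_measure)

lemma emeasure_word_weight_singleton: "emeasure (word_weight q) {w} = ennreal (q ^ length w)"
  by (simp add: word_weight_def emeasure_point_measure_finite2)

lemma cylinder_content_le:
  "S \<subseteq> (\<Union>w\<in>V. cylinder w) \<Longrightarrow> cylinder_content q S \<le> emeasure (word_weight q) V"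
  unfolding cylinder_content_def by (intro INF_lower) auto

lemma cylinder_content_less:
  assumes "cylinder_content q S < c"
  obtains V where "S \<subseteq> (\<Union>w\<in>V. cylinder w)" "emeasure (word_weight q) V < c"
  using assms unfolding cylinder_content_def by (auto simp: INF_less_iff)

lemma cylinder_content_mono: "S \<subseteq> S' \<Longrightarrow> cylinder_content q S \<le> cylinder_content q S'"
  unfolding cylinder_content_def by (intro INF_superset_mono) auto

lemma cylinder_content_empty [simp]: "cylinder_content q {} = 0"
  using cylinder_content_le[of "{}" "{}" q] by simp

lemma cylinder_content_Int_cylinder:
  "cylinder_content q (S \<inter> cylinder w) \<le> ennreal (q ^ length w)"
  using cylinder_content_le[of "S \<inter> cylinder w" "{w}" q]
  by (simp add: emeasure_word_weight_singleton)

lemma cylinder_content_le_1: "cylinder_content q S \<le> 1"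
  using cylinder_content_Int_cylinder[of q S "[]"] by simp

lemma cylinder_content_approx:
  assumes "0 < e"
  obtains V where "S \<subseteq> (\<Union>w\<in>V. cylinder w)"
    "emeasure (word_weight q) V \<le> cylinder_content q S + ennreal e"
proof -
  have "cylinder_content q S < cylinder_content q S + ennreal e"
    using cylinder_content_le_1[of q S] assms
    by (cases "cylinder_content q S") (auto simp: ennreal_plus[symmetric] ennreal_less_iff top_unique simp del: ennreal_plus)
  then show ?thesis by (rule cylinder_content_less) (auto intro: that less_imp_le)
qed

lemma suminf_geometric_half: "0 \<le> e \<Longrightarrow> (\<Sum>i. ennreal (e * (1/2) ^ Suc i)) = ennreal e"
proof -
  assume "0 \<le> e"
  have "(\<lambda>i. e * (1/2) ^ Suc i) sums (e * 1)"
    by (intro sums_mult power_half_series)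
  then show ?thesis
    using \<open>0 \<le> e\<close> by (intro suminf_ennreal_eq) auto
qed

lemma cylinder_content_countably_subadditive:
  "cylinder_content q (\<Union>i::nat. S i) \<le> (\<Sum>i. cylinder_content q (S i))"
proof (rule ennreal_le_epsilon)
  fix e :: real assume e: "0 < e"
  have "\<forall>i. \<exists>V. S i \<subseteq> (\<Union>w\<in>V. cylinder w) \<and>
      emeasure (word_weight q) V \<le> cylinder_content q (S i) + ennreal (e * (1/2) ^ Suc i)"
  proof
    fix n
    have "0 < e * (1/2) ^ Suc n" using e by simp
    then show "\<exists>V. S n \<subseteq> (\<Union>w\<in>V. cylinder w) \<and>
        emeasure (word_weight q) V \<le> cylinder_content q (S n) + ennreal (e * (1/2) ^ Suc n)"
      by (rule cylinder_content_approx[of _ "S n" q]) blast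
  qed
  then obtain V where V: "\<And>i. S i \<subseteq> (\<Union>w\<in>V i. cylinder w)"
      "\<And>i. emeasure (word_weight q) (V i) \<le> cylinder_content q (S i) + ennreal (e * (1/2) ^ Suc i)"
    by metis
  have "cylinder_content q (\<Union>i. S i) \<le> emeasure (word_weight q) (\<Union>i. V i)"
    using V(1) by (intro cylinder_content_le) (simp add: UN_UN_flatten UN_mono)
  also have "\<dots> \<le> (\<Sum>i. emeasure (word_weight q) (V i))"
    by (rule emeasure_subadditive_countably) simp
  also have "\<dots> \<le> (\<Sum>i. cylinder_content q (S i) + ennreal (e * (1/2) ^ Suc i))"
    by (intro suminf_le V) auto
  also have "\<dots> = (\<Sum>i. cylinder_content q (S i)) + (\<Sum>i. ennreal (e * (1/2) ^ Suc i))"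
    by (rule suminf_add[symmetric]) auto
  also have "\<dots> = (\<Sum>i. cylinder_content q (S i)) + ennreal e"
    using e by (subst suminf_geometric_half) auto
  finally show "cylinder_content q (\<Union>i. S i) \<le> (\<Sum>i. cylinder_content q (S i)) + ennreal e" .
qed

text \<open>This is countable subadditivity with the sum over \<open>V\<close> written as a point
  measure; words are enumerated by \<open>to_nat\<close>.\<close>

lemma cylinder_content_UN_words:
  fixes V :: "nat list set"
  shows "cylinder_content q (\<Union>v\<in>V. S v)
      \<le> emeasure (point_measure UNIV (\<lambda>v. cylinder_content q (S v))) V"
proof -
  let ?M = "point_measure UNIV (\<lambda>v. cylinder_content q (S v))"
  let ?V = "\<lambda>i. V \<inter> {v. to_nat v = i}"
  have "(\<Union>v\<in>V. S v) = (\<Union>i. \<Union>v\<in>?V i. S v)" by auto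
  also have "cylinder_content q \<dots> \<le> (\<Sum>i. cylinder_content q (\<Union>v\<in>?V i. S v))"
    by (rule cylinder_content_countably_subadditive)
  also have "\<dots> \<le> (\<Sum>i. emeasure ?M (?V i))"
  proof (intro suminf_le allI)
    fix i
    have "?V i = {} \<or> (\<exists>v. ?V i = {v})" by auto
    then show "cylinder_content q (\<Union>v\<in>?V i. S v) \<le> emeasure ?M (?V i)"
    proof (elim disjE exE)
      assume eq: "?V i = {}"
      show ?thesis unfolding eq by simp
    next
      fix v assume eq: "?V i = {v}"
      show ?thesis unfolding eq by (simp add: emeasure_point_measure_finite2)
    qed
  qed auto
  also have "\<dots> = emeasure ?M (\<Union>i. ?V i)"
    by (rule suminf_emeasure) (auto simp: sets_point_measure disjoint_family_on_def)
  also have "(\<Union>i. ?V i) = V" by auto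
  finally show ?thesis .
qed

lemma cylinder_content_children:
  assumes "S \<subseteq> sequences_below N"
  shows "cylinder_content q (S \<inter> cylinder w)
      \<le> (\<Sum>a<N. cylinder_content q (S \<inter> cylinder (w @ [a])))"
proof -
  let ?V = "(\<lambda>a. w @ [a]) ` {..<N}"
  have "S \<inter> cylinder w \<subseteq> (\<Union>v\<in>?V. S \<inter> cylinder v)"
    using assms cylinder_snocI by (fastforce simp: sequences_below_def)
  then have "cylinder_content q (S \<inter> cylinder w) \<le> cylinder_content q (\<Union>v\<in>?V. S \<inter> cylinder v)"
    by (rule cylinder_content_mono)
  also have "\<dots> \<le> emeasure (point_measure UNIV (\<lambda>v. cylinder_content q (S \<inter> cylinder v))) ?V"
    by (rule cylinder_content_UN_words)
  also have "\<dots> = (\<Sum>a<N. cylinder_content q (S \<inter> cylinder (w @ [a])))"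
    by (subst emeasure_point_measure_finite2) (auto simp: sum.reindex inj_on_def)
  finally show ?thesis .
qed

text \<open>A nearly optimal cover that costs less than the cylinder of \<open>w\<close> contains
  neither \<open>w\<close> nor a prefix of it. It therefore splits into disjoint covers of the
  children.\<close>

lemma cylinder_content_children_le:
  assumes q: "0 < q" "q \<le> 1" and less: "cylinder_content q (S \<inter> cylinder w) < ennreal (q ^ length w)"
  shows "(\<Sum>a<N. cylinder_content q (S \<inter> cylinder (w @ [a]))) \<le> cylinder_content q (S \<inter> cylinder w)"
proof (rule dense_ge)
  fix y assume "cylinder_content q (S \<inter> cylinder w) < y"
  with less have "cylinder_content q (S \<inter> cylinder w) < min y (ennreal (q ^ length w))" by simp
  then obtain V where V: "S \<inter> cylinder w \<subseteq> (\<Union>w\<in>V. cylinder w)"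
      "emeasure (word_weight q) V < min y (ennreal (q ^ length w))"
    by (rule cylinder_content_less)
  \<comment> \<open>Since \<open>q \<le> 1\<close>, a prefix of \<open>w\<close> weighs at least as
    much as \<open>w\<close>, hence more than the whole cover.\<close>
  have notin: "take j w \<notin> V" if "j \<le> length w" for j
  proof
    assume "take j w \<in> V"
    then have "emeasure (word_weight q) {take j w} \<le> emeasure (word_weight q) V"
      by (intro emeasure_mono) auto
    also have "\<dots> < ennreal (q ^ length w)" using V by simp
    finally have "q ^ j < q ^ length w"
      using q that by (simp add: emeasure_word_weight_singleton ennreal_less_iff min_absorb2)
    with power_decreasing[OF that, of q] q show False by simp
  qed
  define W where "W a = {v\<in>V. take (Suc (length w)) v = w @ [a]}" for a
  have "(\<Sum>a<N. cylinder_content q (S \<inter> cylinder (w @ [a]))) \<le> (\<Sum>a<N. emeasure (word_weight q) (W a))"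
  proof (intro sum_mono cylinder_content_le subsetI)
    fix a \<sigma> assume \<sigma>: "\<sigma> \<in> S \<inter> cylinder (w @ [a])"
    then have "\<sigma> \<in> S \<inter> cylinder w" using cylinder_snocD(1)[of \<sigma> w a] by simp
    with V(1) have "\<sigma> \<in> (\<Union>w\<in>V. cylinder w)" by (rule subsetD)
    then obtain v where v: "v \<in> V" "\<sigma> \<in> cylinder v" by (rule UN_E)
    have w: "prefix_word \<sigma> (Suc (length w)) = w @ [a]" using \<sigma> by (simp add: cylinder_def)
    have "\<not> length v \<le> length w"
    proof
      assume le: "length v \<le> length w"
      have "take (length v) w = take (length v) (prefix_word \<sigma> (Suc (length w)))"
        unfolding w using le by simp
      also have "\<dots> = v" using v(2) le by (subst take_prefix_word) (auto simp: cylinder_def)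
      finally show False using notin[OF le] v(1) by simp
    qed
    then have "take (Suc (length w)) v = w @ [a]"
      using v(2) take_prefix_word[of "Suc (length w)" "length v" \<sigma>] w by (auto simp: cylinder_def)
    then show "\<sigma> \<in> (\<Union>v\<in>W a. cylinder v)" using v by (auto simp: W_def)
  qed
  also have "\<dots> = emeasure (word_weight q) (\<Union>a<N. W a)"
    by (rule sum_emeasure) (auto simp: disjoint_family_on_def W_def)
  also have "\<dots> \<le> emeasure (word_weight q) V"
    by (intro emeasure_mono) (auto simp: W_def)
  also have "\<dots> \<le> y" using V(2) by (simp add: less_imp_le)
  finally show "(\<Sum>a<N. cylinder_content q (S \<inter> cylinder (w @ [a]))) \<le> y" .
qed

text \<open>
  Near-optimal covers of the \<open>A n\<close> lose, cylinder by cylinder, almost nothing against the limit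
  content \<open>m\<close>. Hence all of them may be used at once, provided that everything inside a cylinder
  where \<open>m\<close> equals the full weight is replaced by that cylinder: on what remains, \<open>m\<close> is
  superadditive.
\<close>

lemma cylinder_content_incseq:
  assumes q: "0 < q" "q \<le> 1" and A: "incseq A" "\<And>n. A n \<subseteq> sequences_below N"
  shows "cylinder_content q (\<Union>n. A n) \<le> (SUP n. cylinder_content q (A n))"
proof (rule ennreal_le_epsilon)
  fix e :: real assume e: "0 < e"
  define m where "m w = (SUP n. cylinder_content q (A n \<inter> cylinder w))" for w
  have m_le: "m w \<le> ennreal (q ^ length w)" for w
    unfolding m_def by (intro SUP_least cylinder_content_Int_cylinder)
  have m_upper: "cylinder_content q (A n \<inter> cylinder w) \<le> m w" for n w
    unfolding m_def by (intro SUP_upper) auto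
  \<comment> \<open>On these words replacing everything below by the word itself costs nothing; on
    all others \<open>m\<close> is superadditive (\<open>children\<close>).\<close>
  define Sat where "Sat = {w. m w = ennreal (q ^ length w)}"
  define pm where "pm = point_measure UNIV m"
  have sets_pm [simp]: "sets pm = UNIV" by (simp add: pm_def sets_point_measure)
  have pm_sing: "emeasure pm {w} = m w" for w
    by (simp add: pm_def emeasure_point_measure_finite2)
  have children: "(\<Sum>a<N. m (w @ [a])) \<le> m w" if "w \<notin> Sat" for w
  proof -
    have "cylinder_content q (A n \<inter> cylinder w) < ennreal (q ^ length w)" for n
      using m_le[of w] m_upper[of n w] that by (auto simp: Sat_def)
    then have "(\<Sum>a<N. cylinder_content q (A n \<inter> cylinder (w @ [a]))) \<le> m w" for n
      using cylinder_content_children_le[OF q] m_upper by (meson order_trans)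
    moreover have "(\<Sum>a<N. m (w @ [a])) = (SUP n. \<Sum>a<N. cylinder_content q (A n \<inter> cylinder (w @ [a])))"
      unfolding m_def using A(1)
      by (intro ennreal_SUP_sum[symmetric]) (auto simp: incseq_def intro!: cylinder_content_mono)
    ultimately show ?thesis by (simp add: SUP_le_iff)
  qed
  have "\<forall>n. \<exists>V. A n \<subseteq> (\<Union>w\<in>V. cylinder w) \<and>
      emeasure (word_weight q) V \<le> cylinder_content q (A n) + ennreal (e * (1/2) ^ Suc n)"
  proof
    fix n
    have "0 < e * (1/2) ^ Suc n" using e by simp
    then show "\<exists>V. A n \<subseteq> (\<Union>w\<in>V. cylinder w) \<and>
        emeasure (word_weight q) V \<le> cylinder_content q (A n) + ennreal (e * (1/2) ^ Suc n)"
      by (rule cylinder_content_approx[of _ "A n" q]) blast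
  qed
  then obtain V where V: "\<And>n. A n \<subseteq> (\<Union>w\<in>V n. cylinder w)"
      "\<And>n. emeasure (word_weight q) (V n) \<le> cylinder_content q (A n) + ennreal (e * (1/2) ^ Suc n)"
    by metis
  \<comment> \<open>The whole cover \<open>V n\<close> is within the error of the sum of
    \<open>m\<close> over it, and on \<open>V n - W\<close> the weight is at least the sum of
    \<open>m\<close>. Subtracting this part, which is legitimate because its weight is finite,
    localises the estimate to \<open>W\<close>.\<close>
  have near: "emeasure (word_weight q) W \<le> emeasure pm W + ennreal (e * (1/2) ^ Suc n)"
    if "W \<subseteq> V n" for W n
  proof -
    let ?e = "ennreal (e * (1/2) ^ Suc n)" and ?R = "emeasure (word_weight q) (V n - W)"
    have *: "X = Y \<Longrightarrow> emeasure (word_weight q) X = emeasure (word_weight q) Y" for X Y by simp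
    have mono_pm: "emeasure pm X \<le> emeasure (word_weight q) X" for X
      unfolding pm_def word_weight_def point_measure_def using m_le
      by (auto simp: emeasure_density intro!: nn_integral_mono mult_right_mono)
    have "emeasure (word_weight q) (V n) \<le> 1 + ?e"
      using V(2)[of n] cylinder_content_le_1[of q "A n"] by (meson add_right_mono order_trans)
    then have fin: "emeasure (word_weight q) (V n) < \<infinity>"
      by (rule le_less_trans) simp
    have "?R \<le> emeasure (word_weight q) (V n)" by (intro emeasure_mono) auto
    then have finR: "?R < \<infinity>" using fin by (rule le_less_trans)
    have "emeasure (word_weight q) W + ?R = emeasure (word_weight q) (V n)"
      using that by (subst plus_emeasure) (auto intro!: *)
    also have "\<dots> \<le> cylinder_content q (A n) + ?e" by (rule V)
    also have "cylinder_content q (A n) \<le> cylinder_content q (\<Union>v\<in>V n. A n \<inter> cylinder v)"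
      using V(1)[of n] by (intro cylinder_content_mono) auto
    also have "\<dots> \<le> emeasure (point_measure UNIV (\<lambda>v. cylinder_content q (A n \<inter> cylinder v))) (V n)"
      by (rule cylinder_content_UN_words)
    also have "\<dots> \<le> emeasure pm (V n)"
      unfolding pm_def point_measure_def using m_upper
      by (auto simp: emeasure_density intro!: nn_integral_mono mult_right_mono)
    also have "emeasure pm (V n) = emeasure pm W + emeasure pm (V n - W)"
      using that by (subst plus_emeasure) (auto intro!: arg_cong[where f = "emeasure pm"])
    also have "emeasure pm (V n - W) \<le> ?R" by (rule mono_pm)
    finally have "emeasure (word_weight q) W + ?R \<le> (emeasure pm W + ?e) + ?R"
      by (simp add: ac_simps)
    then have "?R + emeasure (word_weight q) W \<le> ?R + (emeasure pm W + ?e)"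
      by (simp only: add.commute)
    then show ?thesis using finR unfolding ennreal_add_left_cancel_le by (metis less_irrefl)
  qed
  define \<V> where "\<V> = (Sat \<union> (\<Union>n. V n)) \<inter> lists {..<N}"
  \<comment> \<open>Keeping the words without a proper prefix in \<open>\<V>\<close> makes the
    cylinders disjoint without changing what they cover.\<close>
  define W where "W = {w\<in>\<V>. \<forall>j<length w. take j w \<notin> \<V>}"
  have cover: "(\<Union>n. A n) \<subseteq> (\<Union>w\<in>W. cylinder w)"
  proof
    fix \<sigma> assume "\<sigma> \<in> (\<Union>n. A n)"
    then obtain n where n: "\<sigma> \<in> A n" by auto
    then obtain v where v: "v \<in> V n" "\<sigma> \<in> cylinder v" using V(1) by blast
    have "\<sigma> \<in> sequences_below N" using n A(2) by blast
    then have "prefix_word \<sigma> (length v) \<in> lists {..<N}" by (rule prefix_word_in_lists)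
    moreover have "prefix_word \<sigma> (length v) \<in> V n" using v by (simp add: cylinder_def)
    ultimately have "prefix_word \<sigma> (length v) \<in> \<V>" unfolding \<V>_def by blast
    define k where "k = (LEAST k. prefix_word \<sigma> k \<in> \<V>)"
    have "prefix_word \<sigma> k \<in> \<V>" unfolding k_def by (rule LeastI) fact
    moreover have "prefix_word \<sigma> j \<notin> \<V>" if "j < k" for j
      using not_less_Least that unfolding k_def by blast
    ultimately have "prefix_word \<sigma> k \<in> W" by (auto simp: W_def take_prefix_word)
    then show "\<sigma> \<in> (\<Union>w\<in>W. cylinder w)" by (intro UN_I) auto
  qed
  define B where "B u k = {w\<in>W. length w \<le> length u + k \<and> take (length u) w = u}" for u k
  \<comment> \<open>Induction on the depth \<open>k\<close>. A word in \<open>\<V>\<close> stops the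
    descent; a word outside it is not saturated, so the values of \<open>m\<close> at its children
    add up to at most its own.\<close>
  have tree: "emeasure pm (B u k) \<le> m u" if "\<forall>j<length u. take j u \<notin> \<V>" "u \<in> lists {..<N}" for u k
    using that
  proof (induction k arbitrary: u)
    case 0
    have "B u 0 \<subseteq> {u}" by (auto simp: B_def)
    then have "emeasure pm (B u 0) \<le> emeasure pm {u}" by (intro emeasure_mono) auto
    then show ?case by (simp add: pm_sing)
  next
    case (Suc k)
    show ?case
    proof (cases "u \<in> \<V>")
      case True
      have "B u (Suc k) \<subseteq> {u}"
      proof
        fix w assume w: "w \<in> B u (Suc k)"
        then have "\<not> length u < length w" using True by (auto simp: B_def W_def)
        with w show "w \<in> {u}" by (auto simp: B_def)
      qed
      then have "emeasure pm (B u (Suc k)) \<le> emeasure pm {u}" by (intro emeasure_mono) auto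
      then show ?thesis by (simp add: pm_sing)
    next
      case False
      have "B u (Suc k) \<subseteq> (\<Union>a<N. B (u @ [a]) k)"
      proof
        fix w assume w: "w \<in> B u (Suc k)"
        then have "w \<noteq> u" using False by (auto simp: B_def W_def)
        moreover have tk: "take (length u) w = u" using w by (simp add: B_def)
        ultimately have len: "length u < length w"
          by (metis linorder_not_less take_all)
        then have "take (Suc (length u)) w = u @ [w ! length u]"
          using tk by (simp add: take_Suc_conv_app_nth)
        moreover have "w ! length u < N"
          using w len by (auto simp: B_def W_def \<V>_def in_lists_conv_set dest: nth_mem)
        ultimately show "w \<in> (\<Union>a<N. B (u @ [a]) k)" using w by (auto simp: B_def)
      qed
      then have "emeasure pm (B u (Suc k)) \<le> emeasure pm (\<Union>a<N. B (u @ [a]) k)"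
        by (intro emeasure_mono) auto
      also have "\<dots> \<le> (\<Sum>a<N. emeasure pm (B (u @ [a]) k))"
        by (rule emeasure_subadditive_finite) auto
      also have "\<dots> \<le> (\<Sum>a<N. m (u @ [a]))"
      proof (intro sum_mono Suc.IH)
        fix a assume "a \<in> {..<N}"
        show "\<forall>j<length (u @ [a]). take j (u @ [a]) \<notin> \<V>"
          using Suc.prems False by (auto simp: less_Suc_eq)
        show "u @ [a] \<in> lists {..<N}" using Suc.prems \<open>a \<in> {..<N}\<close> by auto
      qed
      also have "\<dots> \<le> m u"
        using False Suc.prems by (intro children) (auto simp: \<V>_def)
      finally show ?thesis .
    qed
  qed
  have "emeasure pm W = emeasure pm (\<Union>k. B [] k)"
    by (intro arg_cong[where f = "emeasure pm"]) (auto simp: B_def)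
  also have "\<dots> = (SUP k. emeasure pm (B [] k))"
    by (rule SUP_emeasure_incseq[symmetric]) (auto simp: incseq_def B_def)
  also have "\<dots> \<le> m []" by (intro SUP_least tree) auto
  finally have pmW: "emeasure pm W \<le> m []" .
  \<comment> \<open>Every unsaturated word of \<open>W\<close> is charged to the first cover
    containing it, so each error term is spent once.\<close>
  define U where "U = disjointed (\<lambda>n. V n \<inter> (W - Sat))"
  have UU: "(\<Union>n. U n) = W - Sat"
    unfolding U_def UN_disjointed_eq by (auto simp: W_def \<V>_def)
  have U_V: "U n \<subseteq> V n" for n unfolding U_def using disjointed_subset[of "\<lambda>n. V n \<inter> (W - Sat)" n] by blast
  have U_disj: "disjoint_family U" unfolding U_def by (rule disjoint_family_disjointed)
  have "emeasure (word_weight q) (W - Sat) = (\<Sum>n. emeasure (word_weight q) (U n))"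
    unfolding UU[symmetric] by (rule suminf_emeasure[symmetric]) (auto intro: U_disj)
  also have "\<dots> \<le> (\<Sum>n. emeasure pm (U n) + ennreal (e * (1/2) ^ Suc n))"
    by (intro suminf_le near U_V) auto
  also have "\<dots> = (\<Sum>n. emeasure pm (U n)) + (\<Sum>n. ennreal (e * (1/2) ^ Suc n))"
    by (rule suminf_add[symmetric]) auto
  also have "(\<Sum>n. emeasure pm (U n)) = emeasure pm (W - Sat)"
    unfolding UU[symmetric] by (rule suminf_emeasure) (auto intro: U_disj)
  also have "(\<Sum>n. ennreal (e * (1/2) ^ Suc n)) = ennreal e"
    using e by (intro suminf_geometric_half) auto
  finally have 1: "emeasure (word_weight q) (W - Sat) \<le> emeasure pm (W - Sat) + ennreal e" .
  have 2: "emeasure (word_weight q) (W \<inter> Sat) = emeasure pm (W \<inter> Sat)"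
    unfolding pm_def word_weight_def point_measure_def
    by (auto simp: emeasure_density Sat_def indicator_def intro!: nn_integral_cong)
  have "cylinder_content q (\<Union>n. A n) \<le> emeasure (word_weight q) W"
    by (rule cylinder_content_le[OF cover])
  also have "\<dots> = emeasure (word_weight q) (W \<inter> Sat) + emeasure (word_weight q) (W - Sat)"
    by (subst plus_emeasure) (auto intro!: arg_cong[where f = "emeasure (word_weight q)"])
  also have "\<dots> \<le> emeasure pm (W \<inter> Sat) + (emeasure pm (W - Sat) + ennreal e)"
    unfolding 2 by (intro add_left_mono 1)
  also have "\<dots> = (emeasure pm (W \<inter> Sat) + emeasure pm (W - Sat)) + ennreal e"
    by (simp add: ac_simps)
  also have "emeasure pm (W \<inter> Sat) + emeasure pm (W - Sat) = emeasure pm W"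
    by (subst plus_emeasure) (auto intro!: arg_cong[where f = "emeasure pm"])
  also have "\<dots> \<le> m []" by (rule pmW)
  finally show "cylinder_content q (\<Union>n. A n) \<le> (SUP n. cylinder_content q (A n)) + ennreal e"
    by (simp add: m_def)
qed

lemma compact_sequences_below: "compact (sequences_below N)"
proof (cases "N = 0")
  case True
  then show ?thesis by (simp add: sequences_below_def)
next
  case False
  then have "\<sigma> i < N \<longleftrightarrow> \<sigma> i \<le> N - 1" for \<sigma> :: "nat \<Rightarrow> nat" and i by auto
  then have "sequences_below N = {\<sigma>. \<forall>i. \<sigma> i \<le> N - 1}" by (simp add: sequences_below_def)
  then show ?thesis using compact_bounded_sequences[of "\<lambda>_. N - 1"] by simp
qed

text \<open>Cylinders are open, so the lower bound for open neighbourhoods of \<open>K\<close>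
  applies to every cover of \<open>K\<close>, and thus to the content of \<open>K\<close>
  itself.\<close>

lemma cylinder_content_compact_subset:
  assumes q: "0 < q" "q \<le> 1" and A: "analytic_set A" "A \<subseteq> sequences_below N"
    and pos: "0 < cylinder_content q A"
  obtains K where "compact K" "K \<subseteq> A" "0 < cylinder_content q K"
proof -
  obtain c where c: "0 < c" "c < cylinder_content q A" using dense[OF pos] by auto
  obtain K where K: "compact K" "K \<subseteq> A" "\<And>U. open U \<Longrightarrow> K \<subseteq> U \<Longrightarrow> c \<le> cylinder_content q U"
  proof (rule capacitability[of "cylinder_content q" "sequences_below N" A c])
    show "cylinder_content q S \<le> cylinder_content q S'" if "S \<subseteq> S'" for S S'
      using that by (rule cylinder_content_mono)
    show "cylinder_content q (\<Union>n. A n) \<le> (SUP n. cylinder_content q (A n))"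
      if "incseq A" "(\<Union>n. A n) \<subseteq> sequences_below N" for A :: "nat \<Rightarrow> (nat \<Rightarrow> nat) set"
      by (rule cylinder_content_incseq[OF q, of _ N]) (use that in auto)
  qed (use A c compact_sequences_below that in auto)
  have "c \<le> cylinder_content q K"
    unfolding cylinder_content_def[of q K]
  proof (rule INF_greatest)
    fix V assume "V \<in> {V. K \<subseteq> (\<Union>w\<in>V. cylinder w)}"
    then have "c \<le> cylinder_content q (\<Union>w\<in>V. cylinder w)"
      by (intro K open_UN ballI open_cylinder) auto
    also have "\<dots> \<le> emeasure (word_weight q) V" by (rule cylinder_content_le) auto
    finally show "c \<le> emeasure (word_weight q) V" .
  qed
  with c(1) have "0 < cylinder_content q K" by (rule less_le_trans)
  with K(1,2) show ?thesis by (rule that)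
qed

section \<open>From contents to measures on sequence spaces\<close>

lemma tendsto_coordinatewise:
  fixes f :: "'c \<Rightarrow> nat \<Rightarrow> 'b::topological_space"
  assumes "\<And>i. ((\<lambda>x. f x i) \<longlongrightarrow> l i) F"
  shows "(f \<longlongrightarrow> l) F"
proof -
  have "limitin (product_topology (\<lambda>_. euclidean) UNIV) f l F"
    using assms by (subst limitin_componentwise) auto
  then show ?thesis by (simp add: euclidean_product_topology)
qed

lemma compact_imp_closed_product:
  fixes K :: "('c \<Rightarrow> 'b::t2_space) set"
  assumes "compact K"
  shows "closed K"
proof -
  have "Hausdorff_space (euclidean :: 'b topology)"
    unfolding Hausdorff_space_def disjnt_def by (metis hausdorff open_openin)
  then have "Hausdorff_space (euclidean :: ('c \<Rightarrow> 'b) topology)"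
    unfolding euclidean_product_topology[symmetric] Hausdorff_space_product_topology
    by simp
  then show ?thesis using assms compactin_imp_closedin[of euclidean K] by simp
qed

locale word_splitting =
  fixes h :: "nat list \<Rightarrow> real" and N :: nat
  assumes h_nonneg: "0 \<le> h w" and h_children: "h w \<le> (\<Sum>a<N. h (w @ [a]))"
begin

text \<open>
  The mass of a word is distributed among its children in proportion to \<open>h\<close>; as \<open>h\<close> is
  subadditive, it stays below \<open>h\<close>.
\<close>

definition mass :: "nat list \<Rightarrow> real" where
  "mass w = h [] * (\<Prod>i<length w. h (take (Suc i) w) / (\<Sum>b<N. h (take i w @ [b])))"

text \<open>The intervals of the children of a word tile the interval of the word from left to
  right. Lebesgue measure on the interval of \<open>[]\<close> then realises the prescribed
  masses.\<close>

definition left_end :: "nat list \<Rightarrow> real" where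
  "left_end w = (\<Sum>i<length w. \<Sum>b<w ! i. mass (take i w @ [b]))"

definition word_interval :: "nat list \<Rightarrow> real set" where
  "word_interval w = {left_end w..<left_end w + mass w}"

text \<open>The descent picks the child whose interval contains \<open>t\<close>; it is meaningful
  only for \<open>t\<close> in \<open>word_interval []\<close>, elsewhere the choice is
  arbitrary.\<close>

primrec address :: "real \<Rightarrow> nat \<Rightarrow> nat list" where
  "address t 0 = []"
| "address t (Suc k) =
     address t k @ [SOME a. a < N \<and> t \<in> word_interval (address t k @ [a])]"

definition digits :: "real \<Rightarrow> nat \<Rightarrow> nat" where
  "digits t i = address t (Suc i) ! i"

lemma mass_snoc: "mass (w @ [a]) = mass w * (h (w @ [a]) / (\<Sum>b<N. h (w @ [b])))"
  unfolding mass_def by (simp add: mult.assoc)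

lemma mass_nonneg: "0 \<le> mass w"
  unfolding mass_def by (intro mult_nonneg_nonneg prod_nonneg divide_nonneg_nonneg sum_nonneg ballI h_nonneg)

text \<open>The mass of a word is at most \<open>h\<close> of it, hence at most the sum of
  \<open>h\<close> over its children; so every child receives at most its own
  \<open>h\<close>.\<close>

lemma mass_le: "mass w \<le> h w"
proof (induction w rule: rev_induct)
  case Nil
  then show ?case by (simp add: mass_def)
next
  case (snoc a w)
  let ?H = "\<Sum>b<N. h (w @ [b])"
  have H: "0 \<le> ?H" by (intro sum_nonneg h_nonneg)
  have "mass w \<le> ?H" using snoc h_children[of w] by simp
  have "mass w * (h (w @ [a]) / ?H) \<le> ?H * (h (w @ [a]) / ?H)"
    by (intro mult_right_mono \<open>mass w \<le> ?H\<close> divide_nonneg_nonneg h_nonneg H)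
  also have "\<dots> \<le> h (w @ [a])" using h_nonneg by simp
  finally show ?case by (simp add: mass_snoc)
qed

lemma mass_children: "(\<Sum>a<N. mass (w @ [a])) = mass w"
proof (cases "(\<Sum>b<N. h (w @ [b])) = 0")
  \<comment> \<open>Here the quotients in \<open>mass\<close> are 0 by the convention for division
    by zero; no mass is lost, since subadditivity of \<open>h\<close> forces the mass of
    \<open>w\<close> to vanish too.\<close>
  case True
  then have "mass w = 0" using h_children[of w] mass_le[of w] mass_nonneg[of w] by simp
  then show ?thesis by (simp add: mass_snoc)
next
  case False
  then show ?thesis
    by (simp add: mass_snoc sum_distrib_left[symmetric] sum_divide_distrib[symmetric])
qed

lemma left_end_snoc: "left_end (w @ [a]) = left_end w + (\<Sum>b<a. mass (w @ [b]))"
proof -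
  have "left_end (w @ [a]) = (\<Sum>i<length w. \<Sum>b<(w @ [a]) ! i. mass (take i (w @ [a]) @ [b]))
      + (\<Sum>b<a. mass (w @ [b]))"
    by (simp add: left_end_def)
  also have "(\<Sum>i<length w. \<Sum>b<(w @ [a]) ! i. mass (take i (w @ [a]) @ [b])) = left_end w"
    unfolding left_end_def by (intro sum.cong) (auto simp: nth_append)
  finally show ?thesis .
qed

lemma word_interval_snoc:
  "word_interval (w @ [a])
    = {left_end w + (\<Sum>b<a. mass (w @ [b]))..<left_end w + (\<Sum>b<Suc a. mass (w @ [b]))}"
  by (simp add: word_interval_def left_end_snoc add.assoc)

lemma word_interval_snoc_subset:
  assumes "a < N"
  shows "word_interval (w @ [a]) \<subseteq> word_interval w"
proof -
  have "(\<Sum>b<Suc a. mass (w @ [b])) \<le> (\<Sum>b<N. mass (w @ [b]))"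
    using assms by (intro sum_mono2) (auto simp: mass_nonneg)
  moreover have "0 \<le> (\<Sum>b<a. mass (w @ [b]))" by (intro sum_nonneg mass_nonneg)
  ultimately show ?thesis
    unfolding word_interval_snoc by (auto simp: word_interval_def mass_children)
qed

lemma word_interval_child_unique:
  assumes "t \<in> word_interval (w @ [a])" "t \<in> word_interval (w @ [b])"
  shows "a = b"
proof -
  have "\<not> a < b" if "t \<in> word_interval (w @ [a])" "t \<in> word_interval (w @ [b])" for a b
  proof
    assume "a < b"
    then have "(\<Sum>c<Suc a. mass (w @ [c])) \<le> (\<Sum>c<b. mass (w @ [c]))"
      by (intro sum_mono2) (auto simp: mass_nonneg)
    with that show False unfolding word_interval_snoc by simp
  qed
  then show ?thesis using assms by (meson linorder_neqE_nat)
qed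

lemma word_interval_child_exists:
  assumes "t \<in> word_interval w"
  shows "\<exists>a<N. t \<in> word_interval (w @ [a])"
proof -
  let ?P = "\<lambda>a. t < left_end w + (\<Sum>b<a. mass (w @ [b]))"
  have "?P N" using assms by (simp add: word_interval_def mass_children)
  moreover have "\<not> ?P 0" using assms by (simp add: word_interval_def)
  ultimately have "\<exists>a<N. (\<forall>i\<le>a. \<not> ?P i) \<and> ?P (Suc a)" by (rule ex_least_nat_less)
  then obtain a where a: "a < N" "\<not> ?P a" "?P (Suc a)" by blast
  then have "t \<in> word_interval (w @ [a])" unfolding word_interval_snoc by simp
  with a show ?thesis by blast
qed

lemma length_address [simp]: "length (address t k) = k"
  by (induction k) auto

lemma address_props:
  assumes "t \<in> word_interval []"
  shows "t \<in> word_interval (address t k) \<and> address t k \<in> lists {..<N}"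
proof (induction k)
  case 0
  then show ?case using assms by simp
next
  case (Suc k)
  have "\<exists>a. a < N \<and> t \<in> word_interval (address t k @ [a])"
    using Suc word_interval_child_exists by blast
  from someI_ex[OF this] show ?case using Suc by simp
qed

lemma address_eq:
  assumes "t \<in> word_interval w" "w \<in> lists {..<N}"
  shows "t \<in> word_interval [] \<and> address t (length w) = w"
  using assms
proof (induction w rule: rev_induct)
  case Nil
  then show ?case by simp
next
  case (snoc a w)
  have a: "a < N" using snoc.prems by simp
  then have "t \<in> word_interval w" using word_interval_snoc_subset snoc.prems by blast
  then have IH: "t \<in> word_interval []" "address t (length w) = w" using snoc by auto
  have "t \<in> word_interval (address t (Suc (length w)))" using address_props IH(1) by blast
  then have "t \<in> word_interval (w @ [SOME a. a < N \<and> t \<in> word_interval (w @ [a])])"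
    using IH(2) by simp
  then have "(SOME a. a < N \<and> t \<in> word_interval (w @ [a])) = a"
    using snoc.prems(1) by (rule word_interval_child_unique)
  then show ?case using IH by simp
qed

lemma prefix_word_digits: "prefix_word (digits t) k = address t k"
proof (induction k)
  case 0
  then show ?case by (simp add: prefix_word_def)
next
  case (Suc k)
  have "address t (Suc k) = address t k @ [address t (Suc k) ! k]"
    by (simp add: nth_append)
  then show ?case using Suc by (simp add: prefix_word_Suc digits_def del: address.simps)
qed

lemma sets_word_interval [measurable]: "word_interval w \<in> sets borel"
  by (simp add: word_interval_def)

lemma emeasure_word_interval: "emeasure lborel (word_interval w) = ennreal (mass w)"
  using mass_nonneg[of w] by (simp add: word_interval_def)

lemma countable_words: "countable {w :: nat list. P w}"
  by simp

lemma address_measurable: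
  "(\<lambda>t. address t k) \<in> measurable (restrict_space lborel (word_interval [])) (count_space UNIV)"
proof (rule measurableI)
  fix W :: "nat list set"
  let ?I = "word_interval []"
  have "(\<lambda>t. address t k) -` W \<inter> ?I
      = (\<Union>w\<in>{w\<in>W. w \<in> lists {..<N} \<and> length w = k}. word_interval w)"
  proof (intro equalityI subsetI)
    fix t assume t: "t \<in> (\<lambda>t. address t k) -` W \<inter> ?I"
    then show "t \<in> (\<Union>w\<in>{w\<in>W. w \<in> lists {..<N} \<and> length w = k}. word_interval w)"
      using address_props[of t k] by (intro UN_I[of "address t k"]) auto
  next
    fix t assume "t \<in> (\<Union>w\<in>{w\<in>W. w \<in> lists {..<N} \<and> length w = k}. word_interval w)"
    then obtain w where "w \<in> W" "w \<in> lists {..<N}" "length w = k" "t \<in> word_interval w" by blast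
    then show "t \<in> (\<lambda>t. address t k) -` W \<inter> ?I" using address_eq[of t w] by auto
  qed
  also have "\<dots> \<in> sets lborel"
    by (intro sets.countable_UN'' countable_words) (auto simp: sets_word_interval)
  finally show "(\<lambda>t. address t k) -` W \<inter> space (restrict_space lborel ?I)
      \<in> sets (restrict_space lborel ?I)"
    by (subst sets_restrict_space_iff) (simp_all add: space_restrict_space)
qed auto

end

text \<open>The contents of the parts of \<open>K\<close> are subadditive along the tree and at most
  \<open>q ^ k\<close> at level \<open>k\<close>, so splitting gives a measure with these bounds on
  cylinders. Its image charges a set with at most \<open>q ^ k\<close> for every cylinder of level
  \<open>k\<close> whose image meets the set.\<close>

lemma cylinder_content_frostman:
  fixes \<pi> :: "(nat \<Rightarrow> nat) \<Rightarrow> 'a::metric_space"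
  assumes q: "0 < q" and K: "compact K" "K \<subseteq> sequences_below N" "0 < cylinder_content q K"
    and \<pi>: "continuous_on UNIV \<pi>"
  obtains \<mu> :: "'a measure" where "sets \<mu> = sets borel" "emeasure \<mu> (- \<pi> ` K) = 0"
    "emeasure \<mu> UNIV \<noteq> 0" "emeasure \<mu> UNIV \<noteq> \<infinity>"
    "\<And>B k. B \<in> sets borel \<Longrightarrow> emeasure \<mu> B \<le> ennreal (q ^ k *
       real (card {w. w \<in> lists {..<N} \<and> length w = k \<and> (\<exists>\<sigma>\<in>cylinder w \<inter> sequences_below N. \<pi> \<sigma> \<in> B)}))"
proof -
  define h where "h w = enn2real (cylinder_content q (K \<inter> cylinder w))" for w
  have fin: "cylinder_content q S < \<top>" for S
    using cylinder_content_le_1[of q S] by (rule le_less_trans) simp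
  have h: "cylinder_content q (K \<inter> cylinder w) = ennreal (h w)" for w
    using fin by (simp add: h_def)
  interpret word_splitting h N
  proof
    show nonneg: "0 \<le> h w" for w by (simp add: h_def)
    have "ennreal (h w) \<le> ennreal (\<Sum>a<N. h (w @ [a]))" for w
      using cylinder_content_children[OF K(2), of q w] nonneg by (simp add: h sum_ennreal)
    then show "h w \<le> (\<Sum>a<N. h (w @ [a]))" for w
      using nonneg by (simp add: ennreal_le_iff sum_nonneg)
  qed
  let ?I = "word_interval []"
  let ?M = "restrict_space lborel ?I"
  have mass_Nil: "mass [] = h []" by (simp add: mass_def)
  have "0 < ennreal (h [])" using h[of "[]"] K(3) by simp
  then have h_Nil: "0 < h []" by simp
  have digits_cyl: "digits t \<in> cylinder (address t k)" for t k
    using prefix_word_digits[of t k] by (simp add: cylinder_def)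
  have digits_seq: "digits t \<in> sequences_below N" if "t \<in> ?I" for t
  proof -
    have "digits t i < N" for i
      using address_props[OF that, of "Suc i"] length_address[of t "Suc i"]
      by (metis digits_def in_listsD lessI lessThan_iff nth_mem)
    then show ?thesis by (simp add: sequences_below_def)
  qed
  \<comment> \<open>Finite truncations depend on countably many addresses only; they are measurable
    and converge to \<open>digits t\<close>, which gives measurability of the limit.\<close>
  have digits_lim: "(\<lambda>k i. if i < k then address t k ! i else 0) \<longlonglongrightarrow> digits t" for t
  proof (rule tendsto_coordinatewise)
    fix i
    have "(if i < k then address t k ! i else 0) = digits t i" if "k \<ge> Suc i" for k
      using that prefix_word_digits[of t k, symmetric] by (simp add: prefix_word_def)
    then have "eventually (\<lambda>k. (if i < k then address t k ! i else 0) = digits t i) sequentially"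
      by (rule eventually_sequentiallyI)
    then show "(\<lambda>k. if i < k then address t k ! i else 0) \<longlonglongrightarrow> digits t i"
      by (rule tendsto_eventually)
  qed
  have meas: "(\<lambda>t. \<pi> (digits t)) \<in> borel_measurable ?M"
  proof (rule borel_measurable_LIMSEQ_metric)
    fix k
    show "(\<lambda>t. \<pi> (\<lambda>i. if i < k then address t k ! i else 0)) \<in> borel_measurable ?M"
      using measurable_compose[OF address_measurable[of k], of "\<lambda>w. \<pi> (\<lambda>i. if i < k then w ! i else 0)"]
      by simp
  next
    fix t
    show "(\<lambda>k. \<pi> (\<lambda>i. if i < k then address t k ! i else 0)) \<longlonglongrightarrow> \<pi> (digits t)"
      by (rule continuous_on_tendsto_compose[OF \<pi> digits_lim]) auto
  qed
  \<comment> \<open>An interval containing \<open>t\<close> is nonempty, so its word has positive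
    mass and positive content, and its cylinder meets \<open>K\<close>. Points of \<open>K\<close>
    thus agree with \<open>digits t\<close> on ever longer prefixes, and \<open>K\<close> is
    closed.\<close>
  have digits_K: "digits t \<in> K" if t: "t \<in> ?I" for t
  proof (rule ccontr)
    assume notin: "digits t \<notin> K"
    have "\<exists>\<sigma>. \<sigma> \<in> K \<and> prefix_word \<sigma> k = address t k" for k
    proof -
      have "0 < mass (address t k)"
        using address_props[OF t, of k] by (auto simp: word_interval_def)
      then have "0 < h (address t k)" using mass_le[of "address t k"] by simp
      then have "K \<inter> cylinder (address t k) \<noteq> {}"
        unfolding h_def by auto
      then show ?thesis by (auto simp: cylinder_def)
    qed
    then obtain \<sigma> where \<sigma>: "\<And>k. \<sigma> k \<in> K" "\<And>k. prefix_word (\<sigma> k) k = address t k" by metis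
    have "\<sigma> \<longlonglongrightarrow> digits t"
    proof (rule tendsto_coordinatewise)
      fix i
      have "\<sigma> k i = digits t i" if "k \<ge> Suc i" for k
      proof -
        have "prefix_word (\<sigma> k) k ! i = prefix_word (digits t) k ! i"
          by (simp add: \<sigma>(2) prefix_word_digits)
        then show ?thesis using that by (simp add: prefix_word_def)
      qed
      then show "(\<lambda>k. \<sigma> k i) \<longlonglongrightarrow> digits t i"
        by (intro tendsto_eventually eventually_sequentiallyI)
    qed
    then have "digits t \<in> K"
      using closed_sequentially[OF compact_imp_closed_product[OF K(1)]] \<sigma>(1) by blast
    with notin show False ..
  qed
  define \<mu> where "\<mu> = distr ?M borel (\<lambda>t. \<pi> (digits t))"
  have em: "emeasure \<mu> B = emeasure lborel {t\<in>?I. \<pi> (digits t) \<in> B}" if "B \<in> sets borel" for B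
  proof -
    have "emeasure \<mu> B = emeasure ?M ((\<lambda>t. \<pi> (digits t)) -` B \<inter> space ?M)"
      unfolding \<mu>_def by (rule emeasure_distr[OF meas that])
    also have "(\<lambda>t. \<pi> (digits t)) -` B \<inter> space ?M = {t\<in>?I. \<pi> (digits t) \<in> B}"
      by (auto simp: space_restrict_space)
    also have "emeasure ?M \<dots> = emeasure lborel \<dots>"
      by (intro emeasure_restrict_space) (auto simp: sets_word_interval)
    finally show ?thesis .
  qed
  show ?thesis
  proof
    show "sets \<mu> = sets borel" by (simp add: \<mu>_def)
    have "compact (\<pi> ` K)"
      by (rule compact_continuous_image[OF continuous_on_subset[OF \<pi>] K(1)]) simp
    then have "- \<pi> ` K \<in> sets borel" by (simp add: compact_imp_closed borel_closed borel_open open_Compl)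
    moreover have "{t\<in>?I. \<pi> (digits t) \<in> - \<pi> ` K} = {}" using digits_K by auto
    ultimately show "emeasure \<mu> (- \<pi> ` K) = 0" by (simp only: em emeasure_empty)
    have "emeasure \<mu> UNIV = ennreal (h [])"
      by (simp add: em emeasure_word_interval mass_Nil)
    then show "emeasure \<mu> UNIV \<noteq> 0" "emeasure \<mu> UNIV \<noteq> \<infinity>" using h_Nil by auto
  next
    fix B :: "'a set" and k assume B: "B \<in> sets borel"
    let ?W = "{w. w \<in> lists {..<N} \<and> length w = k \<and> (\<exists>\<sigma>\<in>cylinder w \<inter> sequences_below N. \<pi> \<sigma> \<in> B)}"
    have "finite {w. set w \<subseteq> {..<N} \<and> length w = k}" by (rule finite_lists_length_eq) simp
    then have fin_W: "finite ?W" by (rule rev_finite_subset) auto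
    have "{t\<in>?I. \<pi> (digits t) \<in> B} \<subseteq> (\<Union>w\<in>?W. word_interval w)"
    proof
      fix t assume t: "t \<in> {t\<in>?I. \<pi> (digits t) \<in> B}"
      then have "address t k \<in> ?W"
        using address_props[of t k] digits_cyl[of t k] digits_seq[of t] by auto
      moreover have "t \<in> word_interval (address t k)" using t address_props[of t k] by simp
      ultimately show "t \<in> (\<Union>w\<in>?W. word_interval w)" by (rule UN_I)
    qed
    then have "emeasure \<mu> B \<le> emeasure lborel (\<Union>w\<in>?W. word_interval w)"
      unfolding em[OF B] by (intro emeasure_mono sets.finite_UN fin_W) (auto simp: sets_word_interval)
    also have "\<dots> \<le> (\<Sum>w\<in>?W. emeasure lborel (word_interval w))"
      by (intro emeasure_subadditive_finite fin_W) (auto simp: sets_word_interval)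
    also have "\<dots> \<le> (\<Sum>w\<in>?W. ennreal (q ^ k))"
    proof (intro sum_mono)
      fix w assume w: "w \<in> ?W"
      have "ennreal (mass w) \<le> ennreal (h w)" by (intro ennreal_leI mass_le)
      also have "\<dots> \<le> ennreal (q ^ k)"
        using cylinder_content_Int_cylinder[of q K w] w by (simp add: h)
      finally show "emeasure lborel (word_interval w) \<le> ennreal (q ^ k)"
        by (simp add: emeasure_word_interval)
    qed
    also have "\<dots> = ennreal (q ^ k * real (card ?W))"
      using q by (simp add: ennreal_of_nat_eq_real_of_nat ennreal_mult'' mult.commute)
    finally show "emeasure \<mu> B \<le> ennreal (q ^ k * real (card ?W))" .
  qed
qed

section \<open>Dyadic expansions in Euclidean spaces\<close>

text \<open>
  Words code dyadic cubes: a letter \<open>a < 2 ^ DIM('a)\<close> stands for a set of coordinate directions,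
  namely those in which the next binary digit is \<open>1\<close>.
\<close>

definition letter_set :: "nat \<Rightarrow> 'a::euclidean_space set" where
  "letter_set = (SOME f. bij_betw f {..<2 ^ DIM('a)} (Pow Basis))"

definition letter_digit :: "nat \<Rightarrow> 'a::euclidean_space \<Rightarrow> int" where
  "letter_digit a b = (if b \<in> letter_set a then 1 else 0)"

text \<open>This is the numerator over \<open>2 ^ length w\<close> of the lower endpoint of the
  dyadic cube in direction \<open>b\<close>.\<close>

definition dyadic_index :: "nat list \<Rightarrow> 'a::euclidean_space \<Rightarrow> int" where
  "dyadic_index w b = foldl (\<lambda>z a. 2 * z + letter_digit a b) 0 w"

definition dyadic_coord :: "'a::euclidean_space \<Rightarrow> (nat \<Rightarrow> nat) \<Rightarrow> real" where
  "dyadic_coord b \<sigma> = (\<Sum>k. real_of_int (letter_digit (\<sigma> k) b) * (1/2) ^ Suc k)"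

definition dyadic_point :: "(nat \<Rightarrow> nat) \<Rightarrow> 'a::euclidean_space" where
  "dyadic_point \<sigma> = (\<Sum>b\<in>Basis. dyadic_coord b \<sigma> *\<^sub>R b)"

lemma bij_letter_set: "bij_betw (letter_set :: nat \<Rightarrow> 'a::euclidean_space set) {..<2 ^ DIM('a)} (Pow Basis)"
proof -
  have "finite (Pow (Basis :: 'a set))" by simp
  from ex_bij_betw_nat_finite[OF this]
  have "\<exists>f. bij_betw f {..<(2::nat) ^ DIM('a)} (Pow (Basis :: 'a set))"
    by (simp add: card_Pow atLeast0LessThan)
  then show ?thesis unfolding letter_set_def by (rule someI_ex)
qed

lemma letter_digit_range: "0 \<le> letter_digit a b" "letter_digit a b \<le> 1"
  by (auto simp: letter_digit_def)

lemma dyadic_index_snoc: "dyadic_index (w @ [a]) b = 2 * dyadic_index w b + letter_digit a b"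
  by (simp add: dyadic_index_def)

lemma summable_half: "summable (\<lambda>k. (1/2 :: real) ^ Suc k)"
  using power_half_series sums_summable by blast

lemma summable_digits:
  "summable (\<lambda>k. real_of_int (letter_digit (\<sigma> k) b) * (1/2) ^ Suc k)"
proof (rule summable_comparison_test'[OF summable_half])
  fix k
  show "norm (real_of_int (letter_digit (\<sigma> k) b) * (1/2) ^ Suc k) \<le> (1/2) ^ Suc k"
    by (simp add: letter_digit_def)
qed

lemma dyadic_partial_sum:
  "(\<Sum>i<k. real_of_int (letter_digit (\<sigma> i) b) * (1/2) ^ Suc i)
     = real_of_int (dyadic_index (prefix_word \<sigma> k) b) * (1/2) ^ k"
proof (induction k)
  case 0
  then show ?case by (simp add: dyadic_index_def prefix_word_def)
next
  case (Suc k)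
  then show ?case by (simp add: prefix_word_Suc dyadic_index_snoc algebra_simps)
qed

lemma dyadic_coord_bounds:
  fixes k :: nat and \<sigma> :: "nat \<Rightarrow> nat" and b :: "'a::euclidean_space"
  defines "z \<equiv> real_of_int (dyadic_index (prefix_word \<sigma> k) b) * (1/2) ^ k"
  shows "z \<le> dyadic_coord b \<sigma>" "dyadic_coord b \<sigma> \<le> z + (1/2) ^ k"
proof -
  let ?f = "\<lambda>i. real_of_int (letter_digit (\<sigma> i) b) * (1/2) ^ Suc i"
  have split: "dyadic_coord b \<sigma> = (\<Sum>i. ?f (i + k)) + z"
    unfolding dyadic_coord_def z_def dyadic_partial_sum[symmetric]
    by (rule suminf_split_initial_segment[OF summable_digits])
  have sm: "summable (\<lambda>i. ?f (i + k))"
    using summable_digits by (rule summable_ignore_initial_segment)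
  have "0 \<le> (\<Sum>i. ?f (i + k))"
    by (intro suminf_nonneg sm) (simp add: letter_digit_def)
  then show "z \<le> dyadic_coord b \<sigma>" using split by simp
  have geo: "(\<lambda>i. (1/2 :: real) ^ k * (1/2) ^ Suc i) sums ((1/2) ^ k * 1)"
    by (intro sums_mult power_half_series)
  have le: "?f (i + k) \<le> (1/2) ^ k * (1/2) ^ Suc i" for i
    by (simp add: letter_digit_def power_add)
  have "(\<Sum>i. ?f (i + k)) \<le> (1/2) ^ k * 1"
    by (rule sums_le[OF le summable_sums[OF sm] geo])
  then show "dyadic_coord b \<sigma> \<le> z + (1/2) ^ k" using split by simp
qed

lemma inner_dyadic_point: "b \<in> Basis \<Longrightarrow> dyadic_point \<sigma> \<bullet> b = dyadic_coord b \<sigma>"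
  unfolding dyadic_point_def by (rule inner_sum_left_Basis)

lemma continuous_dyadic_point:
  "continuous_on UNIV (dyadic_point :: _ \<Rightarrow> 'a::euclidean_space)"
proof -
  have "continuous_on UNIV (dyadic_coord b)" for b :: 'a
  proof (rule uniform_limit_theorem)
    let ?f = "\<lambda>k \<sigma>. real_of_int (letter_digit (\<sigma> k) b) * (1/2) ^ Suc k"
    show "\<forall>\<^sub>F n in sequentially. continuous_on UNIV (\<lambda>\<sigma>. \<Sum>k<n. ?f k \<sigma>)"
    proof (intro always_eventually allI continuous_on_sum)
      fix n k
      have "continuous_on UNIV (\<lambda>\<sigma> :: nat \<Rightarrow> nat. \<sigma> k)"
        by (rule continuous_on_product_then_coordinatewise[OF continuous_on_id])
      from continuous_on_compose2[OF _ this, of UNIV "\<lambda>a. real_of_int (letter_digit a b) * (1/2) ^ Suc k"]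
      show "continuous_on UNIV (?f k)" by simp
    qed
    show "uniform_limit UNIV (\<lambda>n \<sigma>. \<Sum>k<n. ?f k \<sigma>) (dyadic_coord b) sequentially"
      unfolding dyadic_coord_def[abs_def]
      by (rule Weierstrass_m_test[OF _ summable_half]) (simp add: letter_digit_def)
  qed simp
  then show ?thesis
    unfolding dyadic_point_def[abs_def] by (intro continuous_intros)
qed

lemma binary_expansion:
  fixes y :: real
  assumes "0 \<le> y" "y \<le> 1"
  shows "\<exists>D :: nat \<Rightarrow> bool. (\<lambda>k. of_bool (D k) * (1/2) ^ Suc k) sums y"
proof -
  \<comment> \<open>The doubling map. Its fixed point 1 stays in the range, so \<open>y = 1\<close>
    gets the expansion with all digits 1.\<close>
  define x where "x = rec_nat y (\<lambda>_ z. 2 * z - of_bool (z \<ge> 1/2) :: real)"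
  have x0: "x 0 = y" and xS: "x (Suc k) = 2 * x k - of_bool (x k \<ge> 1/2)" for k
    by (simp_all add: x_def)
  have bd: "0 \<le> x k \<and> x k \<le> 1" for k
    by (induction k) (use assms in \<open>auto simp: x0 xS\<close>)
  have eq: "(\<Sum>i<k. of_bool (x i \<ge> 1/2) * (1/2) ^ Suc i) = y - (1/2) ^ k * x k" for k
    by (induction k) (auto simp: x0 xS field_simps)
  have "(\<lambda>k. (1/2) ^ k * x k) \<longlonglongrightarrow> 0"
  proof (rule Lim_null_comparison)
    show "\<forall>\<^sub>F k in sequentially. norm ((1/2) ^ k * x k) \<le> (1/2) ^ k"
      using bd by (intro always_eventually allI) (simp add: abs_mult mult_left_le)
    show "(\<lambda>k. (1/2 :: real) ^ k) \<longlonglongrightarrow> 0" by (intro LIMSEQ_power_zero) simp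
  qed
  then have "(\<lambda>k. y - (1/2) ^ k * x k) \<longlonglongrightarrow> y - 0" by (intro tendsto_diff tendsto_const)
  then have "(\<lambda>k. of_bool (x k \<ge> 1/2) * (1/2) ^ Suc k) sums y"
    unfolding sums_def eq by simp
  then show ?thesis by (intro exI[of _ "\<lambda>k. x k \<ge> 1/2"])
qed

lemma dyadic_point_surj:
  fixes y :: "'a::euclidean_space"
  assumes "\<And>b. b \<in> Basis \<Longrightarrow> 0 \<le> y \<bullet> b \<and> y \<bullet> b \<le> 1"
  shows "\<exists>\<sigma>\<in>sequences_below (2 ^ DIM('a)). dyadic_point \<sigma> = y"
proof -
  have "\<exists>D. \<forall>b\<in>Basis. (\<lambda>k. of_bool (D b k) * (1/2) ^ Suc k) sums (y \<bullet> b)"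
    using binary_expansion assms by (intro bchoice) blast
  then obtain D where D: "\<And>b. b \<in> Basis \<Longrightarrow> (\<lambda>k. of_bool (D b k) * (1/2) ^ Suc k) sums (y \<bullet> b)"
    by blast
  have "\<exists>a<2 ^ DIM('a). letter_set a = {b\<in>Basis. D b k}" for k
    using bij_betw_imp_surj_on[OF bij_letter_set[where 'a = 'a]]
    by (metis (no_types, lifting) PowI imageE lessThan_iff mem_Collect_eq subsetI)
  then obtain \<sigma> where \<sigma>: "\<And>k. \<sigma> k < 2 ^ DIM('a)" "\<And>k. letter_set (\<sigma> k) = {b\<in>Basis. D b k}"
    by metis
  have "dyadic_point \<sigma> = y"
  proof (rule euclidean_eqI)
    fix b :: 'a assume b: "b \<in> Basis"
    have "letter_digit (\<sigma> k) b = of_bool (D b k)" for k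
      using b by (simp add: letter_digit_def \<sigma>)
    then have "dyadic_coord b \<sigma> = y \<bullet> b"
      using sums_unique[OF D[OF b]] by (simp add: dyadic_coord_def)
    then show "dyadic_point \<sigma> \<bullet> b = y \<bullet> b" using b by (simp add: inner_dyadic_point)
  qed
  with \<sigma>(1) show ?thesis by (auto simp: sequences_below_def)
qed

lemma dist_dyadic_point_le:
  fixes w :: "nat list"
  assumes "\<sigma> \<in> cylinder w" "\<tau> \<in> cylinder w"
  shows "dist (dyadic_point \<sigma> :: 'a::euclidean_space) (dyadic_point \<tau>) \<le> real DIM('a) * (1/2) ^ length w"
proof -
  have "dist (dyadic_point \<sigma> :: 'a) (dyadic_point \<tau>)
      \<le> (\<Sum>b\<in>Basis. \<bar>(dyadic_point \<sigma> - dyadic_point \<tau>) \<bullet> (b :: 'a)\<bar>)"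
    unfolding dist_norm by (rule norm_le_l1)
  also have "\<dots> \<le> (\<Sum>b\<in>(Basis :: 'a set). (1/2) ^ length w)"
  proof (rule sum_mono)
    fix b :: 'a assume b: "b \<in> Basis"
    show "\<bar>(dyadic_point \<sigma> - dyadic_point \<tau>) \<bullet> b\<bar> \<le> (1/2) ^ length w"
      using dyadic_coord_bounds[where \<sigma> = \<sigma> and k = "length w" and b = b] dyadic_coord_bounds[where \<sigma> = \<tau> and k = "length w" and b = b] assms b
      by (simp add: cylinder_def inner_diff_left inner_dyadic_point abs_le_iff)
  qed
  finally show ?thesis by simp
qed

text \<open>The last digit is the parity of the index, so the letters can be read off from the
  end.\<close>

lemma dyadic_index_inject:
  fixes w w' :: "nat list"
  assumes "w \<in> lists {..<2 ^ DIM('a::euclidean_space)}" "w' \<in> lists {..<2 ^ DIM('a)}" "length w = length w'"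
    and "\<And>b :: 'a. b \<in> Basis \<Longrightarrow> dyadic_index w b = dyadic_index w' b"
  shows "w = w'"
  using assms
proof (induction w arbitrary: w' rule: rev_induct)
  case Nil
  then show ?case by simp
next
  case (snoc a v)
  from snoc.prems(3) obtain v' a' where w': "w' = v' @ [a']"
    by (cases w' rule: rev_cases) auto
  have eq: "2 * dyadic_index v b + letter_digit a b = 2 * dyadic_index v' b + letter_digit a' b"
    if "b \<in> Basis" for b :: 'a
    using snoc.prems(4)[OF that] by (simp add: w' dyadic_index_snoc)
  have *: "letter_digit a b = letter_digit a' b \<and> dyadic_index v b = dyadic_index v' b"
    if "b \<in> Basis" for b :: 'a
    using eq[OF that] letter_digit_range[of a b] letter_digit_range[of a' b] by presburger
  then have "v = v'" using snoc.prems by (intro snoc.IH) (auto simp: w')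
  moreover have "a = a'"
  proof -
    have lt: "a < 2 ^ DIM('a)" "a' < 2 ^ DIM('a)" using snoc.prems by (auto simp: w')
    then have "letter_set a \<subseteq> (Basis :: 'a set)" "letter_set a' \<subseteq> (Basis :: 'a set)"
      using bij_betw_apply[OF bij_letter_set[where 'a = 'a]] by blast+
    moreover have "b \<in> letter_set a \<longleftrightarrow> b \<in> letter_set a'" if "b \<in> Basis" for b :: 'a
      using *[OF that] by (auto simp: letter_digit_def split: if_splits)
    ultimately have "letter_set a = (letter_set a' :: 'a set)" by blast
    then show ?thesis
      using bij_betw_imp_inj_on[OF bij_letter_set[where 'a = 'a]] lt by (auto dest: inj_onD)
  qed
  ultimately show ?case by (simp add: w')
qed

text \<open>In each direction the coordinate of a point in the ball is off by at most one side
  length, and the index by one more; this leaves four consecutive integers.\<close>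

lemma card_dyadic_cubes_le:
  fixes x :: "'a::euclidean_space"
  assumes r: "r \<le> (1/2) ^ k"
  shows "card {w. w \<in> lists {..<2 ^ DIM('a)} \<and> length w = k \<and>
      (\<exists>\<sigma>\<in>cylinder w. dyadic_point \<sigma> \<in> cball x r)} \<le> 4 ^ DIM('a)"
    (is "card ?W \<le> _")
proof -
  let ?z = "\<lambda>b. \<lfloor>2 ^ k * (x \<bullet> b)\<rfloor>"
  let ?P = "PiE (Basis :: 'a set) (\<lambda>b. {?z b - 2..?z b + 1})"
  let ?g = "\<lambda>w. restrict (dyadic_index w) (Basis :: 'a set)"
  have "?g ` ?W \<subseteq> ?P"
  proof (rule image_subsetI)
    fix w assume "w \<in> ?W"
    then obtain \<sigma> where \<sigma>: "\<sigma> \<in> cylinder w" "dyadic_point \<sigma> \<in> cball x r" "length w = k" by blast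
    have "dyadic_index w b \<in> {?z b - 2..?z b + 1}" if b: "b \<in> Basis" for b
    proof -
      let ?i = "real_of_int (dyadic_index w b)"
      have "\<bar>(x - dyadic_point \<sigma>) \<bullet> b\<bar> \<le> norm (x - dyadic_point \<sigma>)"
        using b by (rule Basis_le_norm)
      also have "\<dots> \<le> (1/2) ^ k" using \<sigma>(2) r by (simp add: dist_norm)
      finally have "\<bar>x \<bullet> b - dyadic_coord b \<sigma>\<bar> \<le> (1/2) ^ k"
        using b by (simp add: inner_diff_left inner_dyadic_point)
      moreover have "?i * (1/2) ^ k \<le> dyadic_coord b \<sigma>" "dyadic_coord b \<sigma> \<le> ?i * (1/2) ^ k + (1/2) ^ k"
        using dyadic_coord_bounds[where \<sigma> = \<sigma> and k = k and b = b] \<sigma> by (simp_all add: cylinder_def)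
      ultimately have "?i * (1/2) ^ k \<le> x \<bullet> b + (1/2) ^ k" "x \<bullet> b \<le> ?i * (1/2) ^ k + 2 * (1/2) ^ k"
        by linarith+
      from mult_left_mono[OF this(1), of "2 ^ k"] mult_left_mono[OF this(2), of "2 ^ k"]
      have "?i \<le> 2 ^ k * (x \<bullet> b) + 1" "2 ^ k * (x \<bullet> b) \<le> ?i + 2"
        by (simp_all add: algebra_simps power_mult_distrib[symmetric])
      then show ?thesis by (auto simp: le_floor_iff floor_le_iff) linarith+
    qed
    then show "?g w \<in> ?P" by auto
  qed
  moreover have "finite ?P" by (intro finite_PiE) auto
  moreover have "inj_on ?g ?W"
  proof (rule inj_onI)
    fix w w' assume w: "w \<in> ?W" "w' \<in> ?W" and eq: "?g w = ?g w'"
    have "dyadic_index w b = dyadic_index w' b" if "b \<in> Basis" for b :: 'a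
      using fun_cong[OF eq, of b] that by simp
    then show "w = w'"
      using w by (intro dyadic_index_inject[where 'a = 'a]) auto
  qed
  ultimately have "card ?W \<le> card ?P" by (intro card_inj_on_le)
  also have "\<dots> = 4 ^ DIM('a)" by (simp add: card_PiE)
  finally show ?thesis .
qed

section \<open>Frostman's lemma\<close>

text \<open>Vanishing Hausdorff content: the diameters of the covering sets are unrestricted, which
  suits covers by cylinders of any level.\<close>

definition hausdorff_null :: "real \<Rightarrow> 'a::metric_space set \<Rightarrow> bool" where
  "hausdorff_null s A \<longleftrightarrow> (\<forall>e>0. \<exists>U :: nat \<Rightarrow> 'a set.
      A \<subseteq> (\<Union>i. U i) \<and> (\<forall>i. bounded (U i)) \<and> (\<Sum>i. diam_pow s (U i)) < ennreal e)"

lemma diam_pow_le: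
  assumes "0 < s" "\<And>x y. x \<in> U \<Longrightarrow> y \<in> U \<Longrightarrow> dist x y \<le> D" "0 \<le> D"
  shows "diam_pow s U \<le> ennreal (D powr s)"
proof (cases "U = {}")
  case False
  have "diameter U \<le> D"
    unfolding diameter_def using False assms(2) by (auto intro!: cSUP_least)
  moreover have "0 \<le> diameter U"
    unfolding diameter_def
  proof (cases "bounded U")
    case True
    then show "0 \<le> (if U = {} then 0 else SUP (x, y)\<in>U \<times> U. dist x y)"
      using diameter_ge_0[OF True] by (simp add: diameter_def)
  next
    case False
    moreover obtain x where "x \<in> U" using \<open>U \<noteq> {}\<close> by auto
    ultimately have False using assms(2) unfolding bounded_def by blast
    then show "0 \<le> (if U = {} then 0 else SUP (x, y)\<in>U \<times> U. dist x y)" ..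
  qed
  ultimately show ?thesis
    using assms(1) False by (auto simp: diam_pow_def intro!: ennreal_leI powr_mono2)
qed (simp add: diam_pow_def)

text \<open>For \<open>s > 0\<close> a total below \<open>\<delta> powr s\<close> forces each
  diameter below \<open>\<delta>\<close>, so covers of small total are automatically fine.\<close>

lemma hausdorff_null_imp_measure_0:
  fixes A :: "'a::metric_space set"
  assumes s: "0 < s" and null: "hausdorff_null s A"
  shows "hausdorff_measure s A = 0"
proof -
  have le: "hausdorff_premeasure \<delta> s A \<le> ennreal e" if "0 < \<delta>" "0 < e" for \<delta> e :: real
  proof -
    define e' where "e' = min e (\<delta> powr s)"
    have "0 < e'" using that by (simp add: e'_def)
    then obtain U :: "nat \<Rightarrow> 'a set" where U: "A \<subseteq> (\<Union>i. U i)" "\<And>i. bounded (U i)"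
        "(\<Sum>i. diam_pow s (U i)) < ennreal e'"
      using null unfolding hausdorff_null_def by blast
    have "diameter (U i) \<le> \<delta>" for i
    proof (cases "U i = {}")
      case False
      have "diam_pow s (U i) \<le> (\<Sum>i. diam_pow s (U i))"
        using sum_le_suminf[of "\<lambda>i. diam_pow s (U i)" "{i}"] by simp
      also have "\<dots> < ennreal e'" by (rule U)
      finally have "diameter (U i) powr s < e'"
        using False s \<open>0 < e'\<close> by (simp add: diam_pow_def ennreal_less_iff)
      then have lt: "diameter (U i) powr s < \<delta> powr s" by (simp add: e'_def)
      show ?thesis
      proof (rule ccontr)
        assume "\<not> ?thesis"
        then have "\<delta> powr s \<le> diameter (U i) powr s"
          using s that by (intro powr_mono2) auto
        with lt show False by simp
      qed
    qed (use that in \<open>simp add: diameter_def\<close>)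
    then have "hausdorff_premeasure \<delta> s A \<le> (\<Sum>i. diam_pow s (U i))"
      unfolding hausdorff_premeasure_def using U by (intro Inf_lower) blast
    also have "\<dots> \<le> ennreal e" using U(3) by (rule order.trans[OF less_imp_le]) (simp add: e'_def ennreal_leI)
    finally show ?thesis .
  qed
  have "hausdorff_premeasure \<delta> s A \<le> 0" if "0 < \<delta>" for \<delta>
  proof (rule ennreal_le_epsilon)
    fix e :: real assume "0 < e"
    then show "hausdorff_premeasure \<delta> s A \<le> 0 + ennreal e" using le[OF that] by simp
  qed
  then have "hausdorff_measure s A \<le> 0"
    unfolding hausdorff_measure_def by (intro SUP_least) simp
  then show ?thesis by simp
qed

lemma hausdorff_null_UN:
  fixes A :: "nat \<Rightarrow> 'a::metric_space set"
  assumes "\<And>n. hausdorff_null s (A n)"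
  shows "hausdorff_null s (\<Union>n. A n)"
  unfolding hausdorff_null_def
proof (intro allI impI)
  fix e :: real assume e: "0 < e"
  \<comment> \<open>The extra factor 1/2 leaves room for the strict inequality after
    summation.\<close>
  have "\<exists>U :: nat \<Rightarrow> 'a set. A n \<subseteq> (\<Union>i. U i) \<and> (\<forall>i. bounded (U i)) \<and>
      (\<Sum>i. diam_pow s (U i)) < ennreal (e / 2 * (1/2) ^ Suc n)" for n
  proof -
    have "0 < e / 2 * (1/2) ^ Suc n" using e by simp
    then show ?thesis using assms[of n] unfolding hausdorff_null_def by blast
  qed
  then obtain U :: "nat \<Rightarrow> nat \<Rightarrow> 'a set" where U: "\<And>n. A n \<subseteq> (\<Union>i. U n i)" "\<And>n i. bounded (U n i)"
      "\<And>n. (\<Sum>i. diam_pow s (U n i)) < ennreal (e / 2 * (1/2) ^ Suc n)"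
    by metis
  let ?V = "\<lambda>k. case prod_decode k of (n, i) \<Rightarrow> U n i"
  have "(\<Sum>k. diam_pow s (?V k)) = (\<Sum>n. \<Sum>i. diam_pow s (U n i))"
  proof -
    have "(\<Sum>k. diam_pow s (?V k)) = (\<Sum>n. \<Sum>i. diam_pow s (U n i))"
      using suminf_ennreal_2dimen[of "\<lambda>n. \<Sum>i. diam_pow s (U n i)" "\<lambda>p. diam_pow s (case p of (n, i) \<Rightarrow> U n i)"]
      by (simp add: o_def)
    then show ?thesis .
  qed
  also have "\<dots> \<le> (\<Sum>n. ennreal (e / 2 * (1/2) ^ Suc n))"
    by (intro suminf_le less_imp_le U) auto
  also have "\<dots> = ennreal (e / 2)" using e by (intro suminf_geometric_half) simp
  also have "\<dots> < ennreal e" using e by (simp add: ennreal_less_iff)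
  finally have "(\<Sum>k. diam_pow s (?V k)) < ennreal e" .
  moreover have "(\<Union>n. A n) \<subseteq> (\<Union>k. ?V k)"
  proof
    fix x assume "x \<in> (\<Union>n. A n)"
    then obtain n i where "x \<in> U n i" using U(1) by blast
    then have "x \<in> ?V (prod_encode (n, i))" by simp
    then show "x \<in> (\<Union>k. ?V k)" by (rule UN_I[OF UNIV_I])
  qed
  moreover have "\<forall>k. bounded (?V k)" using U(2) by (simp split: prod.split)
  ultimately show "\<exists>V :: nat \<Rightarrow> 'a set. (\<Union>n. A n) \<subseteq> (\<Union>i. V i) \<and> (\<forall>i. bounded (V i)) \<and>
      (\<Sum>i. diam_pow s (V i)) < ennreal e"
    by (intro exI[of _ ?V]) blast
qed

lemma less_hausdorff_dim_not_null:
  assumes "0 < s" "ereal s < hausdorff_dim A"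
  shows "\<not> hausdorff_null s A"
proof
  assume "hausdorff_null s A"
  then have "hausdorff_measure s A = 0" using assms(1) by (rule hausdorff_null_imp_measure_0[rotated])
  then have "hausdorff_dim A \<le> ereal s"
    unfolding hausdorff_dim_def using assms(1) by (intro Inf_lower) auto
  with assms(2) show False by simp
qed

definition frostman_measure :: "real \<Rightarrow> 'a::euclidean_space set \<Rightarrow> 'a measure \<Rightarrow> bool" where
  "frostman_measure s K \<mu> \<longleftrightarrow> compact K \<and> sets \<mu> = sets borel \<and> emeasure \<mu> UNIV = 1 \<and>
     emeasure \<mu> (- K) = 0 \<and>
     (\<exists>C>0. \<forall>x. \<forall>r>0. emeasure \<mu> (cball x r) \<le> ennreal (C * r powr s))"

text \<open>Some bounded piece of \<open>A\<close> has positive content. Coding its points by words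
  turns it into an analytic set of words of positive content, as covers by cylinders become covers
  by cubes. A compact subset then carries the measure.\<close>

lemma frostman_lemma_pos:
  fixes A :: "'a::euclidean_space set"
  assumes A: "A \<in> sets borel" and s: "0 < s" and dim: "ereal s < hausdorff_dim A"
  shows "\<exists>K \<mu>. K \<subseteq> A \<and> frostman_measure s K \<mu>"
proof -
  define N where "N = (2::nat) ^ DIM('a)"
  \<comment> \<open>With this choice \<open>q ^ k\<close> is the \<open>s\<close>-th power of the
    side of a dyadic cube of level \<open>k\<close>.\<close>
  define q where "q = (1/2 :: real) powr s"
  have q: "0 < q" "q \<le> 1" unfolding q_def using s by (auto intro: powr_le1)
  have q_power: "q ^ k = ((1/2) ^ k) powr s" for k
    unfolding q_def by (simp add: powr_realpow[symmetric] powr_powr mult.commute)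
  define box where "box n = {x :: 'a. \<forall>b\<in>Basis. \<bar>x \<bullet> b\<bar> \<le> real (Suc n)}" for n :: nat
  have "A = (\<Union>n. A \<inter> box n)"
  proof -
    have "\<exists>n. x \<in> box n" for x
    proof -
      obtain n where "norm x \<le> real n" using real_arch_simple by blast
      then have "\<bar>x \<bullet> b\<bar> \<le> real (Suc n)" if "b \<in> Basis" for b
        using Basis_le_norm[OF that, of x] by simp
      then show ?thesis unfolding box_def by blast
    qed
    then show ?thesis by blast
  qed
  then obtain m where m: "\<not> hausdorff_null s (A \<inter> box m)"
    using hausdorff_null_UN[of s "\<lambda>n. A \<inter> box n"] less_hausdorff_dim_not_null[OF s dim] by metis
  define l where "l = 2 * real (Suc m)"
  have l: "0 < l" by (simp add: l_def)
  \<comment> \<open>The lower corner of the cube \<open>box m\<close>, whose side is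
    \<open>l\<close>; \<open>\<pi>\<close> maps the unit cube onto it.\<close>
  define c where "c = - (real (Suc m)) *\<^sub>R (\<Sum>b\<in>Basis. b :: 'a)"
  define \<pi> where "\<pi> \<sigma> = c + l *\<^sub>R (dyadic_point \<sigma> :: 'a)" for \<sigma>
  have cont: "continuous_on UNIV \<pi>"
    unfolding \<pi>_def by (intro continuous_intros continuous_dyadic_point)
  have surj: "\<exists>\<sigma>\<in>sequences_below N. \<pi> \<sigma> = x" if "x \<in> box m" for x
  proof -
    have "0 \<le> ((x - c) /\<^sub>R l) \<bullet> b \<and> ((x - c) /\<^sub>R l) \<bullet> b \<le> 1" if "b \<in> Basis" for b
    proof -
      have cb: "c \<bullet> b = - real (Suc m)"
        using that unfolding c_def by simp
      have "\<bar>x \<bullet> b\<bar> \<le> real (Suc m)" using \<open>x \<in> box m\<close> that unfolding box_def by blast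
      moreover have "((x - c) /\<^sub>R l) \<bullet> b = (x \<bullet> b + real (Suc m)) / l"
        by (simp add: inner_diff_left cb divide_inverse mult.commute)
      ultimately show ?thesis
        using l by (simp only: divide_le_eq zero_le_divide_iff) (simp add: l_def abs_le_iff)
    qed
    then obtain \<sigma> where "\<sigma> \<in> sequences_below N" "dyadic_point \<sigma> = (x - c) /\<^sub>R l"
      unfolding N_def using dyadic_point_surj by blast
    then show ?thesis using l by (intro bexI[of _ \<sigma>]) (simp_all add: \<pi>_def)
  qed
  define B where "B = \<pi> -` A \<inter> sequences_below N"
  have "analytic_set B"
    unfolding B_def
    by (intro analytic_set_vimage_Int analytic_set_borel A cont compact_imp_closed_product
        compact_sequences_below)
  have pos: "0 < cylinder_content q B"
  proof (rule ccontr)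
    assume "\<not> ?thesis"
    then have zero: "cylinder_content q B = 0" by simp
    define L where "L = (l * real DIM('a)) powr s"
    have L: "0 < L" using l by (simp add: L_def)
    have "hausdorff_null s (A \<inter> box m)"
      unfolding hausdorff_null_def
    proof (intro allI impI)
      fix e :: real assume e: "0 < e"
      have "cylinder_content q B < ennreal (e / L)" using zero e L by simp
      then obtain V where V: "B \<subseteq> (\<Union>w\<in>V. cylinder w)" "emeasure (word_weight q) V < ennreal (e / L)"
        by (rule cylinder_content_less)
      define U where "U i = (\<Union>w\<in>V \<inter> {w. to_nat w = i}. \<pi> ` cylinder w)" for i
      have U_cases: "(V \<inter> {w. to_nat w = i} = {} \<and> U i = {}) \<or>
          (\<exists>w. V \<inter> {w. to_nat w = i} = {w} \<and> U i = \<pi> ` cylinder w)" for i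
      proof (cases "V \<inter> {w. to_nat w = i} = {}")
        case False
        then obtain w where "V \<inter> {w. to_nat w = i} = {w}" by auto
        then show ?thesis unfolding U_def by (intro disjI2 exI[of _ w]) simp
      qed (simp add: U_def)
      have dist_le: "dist x y \<le> l * real DIM('a) * (1/2) ^ length w"
        if xy: "x \<in> \<pi> ` cylinder w" "y \<in> \<pi> ` cylinder w" for x y w
      proof -
        obtain \<sigma> \<tau> where st: "\<sigma> \<in> cylinder w" "\<tau> \<in> cylinder w" "x = \<pi> \<sigma>" "y = \<pi> \<tau>"
          using xy by blast
        have "dist x y = l * dist (dyadic_point \<sigma> :: 'a) (dyadic_point \<tau>)"
          using l by (simp add: st \<pi>_def dist_norm scaleR_diff_right[symmetric])
        also have "\<dots> \<le> l * (real DIM('a) * (1/2) ^ length w)"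
          using l st by (intro mult_left_mono dist_dyadic_point_le) auto
        finally show ?thesis by (simp add: mult.assoc)
      qed
      have dp: "diam_pow s (U i) \<le> ennreal L * emeasure (word_weight q) (V \<inter> {w. to_nat w = i})" for i
        using U_cases[of i]
      proof (elim disjE exE conjE)
        assume *: "V \<inter> {w. to_nat w = i} = {}" "U i = {}"
        show ?thesis unfolding * by (simp add: diam_pow_def)
      next
        fix w assume *: "V \<inter> {w. to_nat w = i} = {w}" "U i = \<pi> ` cylinder w"
        have "diam_pow s (\<pi> ` cylinder w) \<le> ennreal ((l * real DIM('a) * (1/2) ^ length w) powr s)"
          using l by (intro diam_pow_le s dist_le) auto
        also have "\<dots> = ennreal L * ennreal (q ^ length w)"
          unfolding L_def q_power using l
          by (subst powr_mult) (auto simp: ennreal_mult')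
        finally show ?thesis unfolding * by (simp add: emeasure_word_weight_singleton)
      qed
      have "(\<Sum>i. diam_pow s (U i)) \<le> (\<Sum>i. ennreal L * emeasure (word_weight q) (V \<inter> {w. to_nat w = i}))"
        by (intro suminf_le dp) auto
      also have "\<dots> = ennreal L * (\<Sum>i. emeasure (word_weight q) (V \<inter> {w. to_nat w = i}))"
        by (rule ennreal_suminf_cmult)
      also have "(\<Sum>i. emeasure (word_weight q) (V \<inter> {w. to_nat w = i}))
          = emeasure (word_weight q) (\<Union>i. V \<inter> {w. to_nat w = i})"
        by (rule suminf_emeasure) (auto simp: disjoint_family_on_def)
      also have "(\<Union>i. V \<inter> {w. to_nat w = i}) = V" by auto
      also have "ennreal L * emeasure (word_weight q) V < ennreal L * ennreal (e / L)"
        using V(2) L by (intro ennreal_mult_strict_left_mono) auto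
      also have "\<dots> = ennreal e" using L e by (simp add: ennreal_mult'[symmetric])
      finally have "(\<Sum>i. diam_pow s (U i)) < ennreal e" .
      moreover have "A \<inter> box m \<subseteq> (\<Union>i. U i)"
      proof
        fix x assume x: "x \<in> A \<inter> box m"
        then obtain \<sigma> where \<sigma>: "\<sigma> \<in> sequences_below N" "\<pi> \<sigma> = x" using surj by blast
        then have "\<sigma> \<in> B" using x by (simp add: B_def)
        with V(1) have "\<sigma> \<in> (\<Union>w\<in>V. cylinder w)" by (rule subsetD)
        then obtain w where "w \<in> V" "\<sigma> \<in> cylinder w" by (rule UN_E)
        then have "x \<in> U (to_nat w)" using \<sigma> unfolding U_def by blast
        then show "x \<in> (\<Union>i. U i)" by (rule UN_I[OF UNIV_I])
      qed
      moreover have "bounded (U i)" for i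
        using U_cases[of i]
      proof (elim disjE exE conjE)
        fix w assume *: "U i = \<pi> ` cylinder w"
        show ?thesis
          unfolding * by (rule bounded_two_points[THEN iffD2]) (use dist_le in blast)
      qed simp
      ultimately show "\<exists>U :: nat \<Rightarrow> 'a set. A \<inter> box m \<subseteq> (\<Union>i. U i) \<and> (\<forall>i. bounded (U i)) \<and>
          (\<Sum>i. diam_pow s (U i)) < ennreal e" by blast
    qed
    with m show False ..
  qed
  obtain K where K: "compact K" "K \<subseteq> B" "0 < cylinder_content q K"
    by (rule cylinder_content_compact_subset[OF q \<open>analytic_set B\<close> _ pos, of N]) (auto simp: B_def)
  have KN: "K \<subseteq> sequences_below N" using K(2) by (auto simp: B_def)
  obtain \<mu> :: "'a measure" where \<mu>: "sets \<mu> = sets borel" "emeasure \<mu> (- \<pi> ` K) = 0"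
    "emeasure \<mu> UNIV \<noteq> 0" "emeasure \<mu> UNIV \<noteq> \<infinity>"
    "\<And>B k. B \<in> sets borel \<Longrightarrow> emeasure \<mu> B \<le> ennreal (q ^ k *
       real (card {w. w \<in> lists {..<N} \<and> length w = k \<and> (\<exists>\<sigma>\<in>cylinder w \<inter> sequences_below N. \<pi> \<sigma> \<in> B)}))"
    by (rule cylinder_content_frostman[OF q(1) K(1) KN K(3) cont]) (rule that, assumption+)
  \<comment> \<open>At most \<open>4 ^ DIM('a)\<close> cubes meet the ball, each of mass at most
    \<open>(2 * r / l) powr s\<close>.\<close>
  define D where "D = (4::real) ^ DIM('a) * (2 / l) powr s"
  have D: "0 < D" using l by (simp add: D_def)
  have ball: "emeasure \<mu> (cball x r) \<le> ennreal (D * r powr s)" if r: "0 < r" for x r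
  proof -
    \<comment> \<open>The level is chosen with side comparable to \<open>r\<close>. Balls larger
      than the cube use level 0, where the empty word is the only one to count.\<close>
    have "\<exists>k. (k = 0 \<or> r / l \<le> (1/2) ^ k) \<and> (1/2) ^ k \<le> 2 * (r / l)"
    proof (cases "1 \<le> r / l")
      case True
      then show ?thesis by (intro exI[of _ 0]) simp
    next
      case False
      obtain n where n: "(1/2 :: real) ^ n < r / l"
        using real_arch_pow_inv[of "r / l" "1/2"] r l by auto
      moreover have "\<not> (1/2 :: real) ^ 0 < r / l" using False by simp
      ultimately have "\<exists>k<n. (\<forall>i\<le>k. \<not> (1/2) ^ i < r / l) \<and> (1/2 :: real) ^ Suc k < r / l"
        by (rule ex_least_nat_less)
      then obtain k where "\<not> (1/2) ^ k < r / l" "(1/2 :: real) ^ Suc k < r / l" by blast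
      then have "r / l \<le> (1/2) ^ k" "(1/2) ^ k \<le> 2 * (r / l)" by (simp_all add: mult.commute)
      then show ?thesis by (intro exI[of _ k]) blast
    qed
    then obtain k where k: "k = 0 \<or> r / l \<le> (1/2) ^ k" "(1/2) ^ k \<le> 2 * (r / l)" by blast
    let ?W = "{w. w \<in> lists {..<N} \<and> length w = k \<and> (\<exists>\<sigma>\<in>cylinder w \<inter> sequences_below N. \<pi> \<sigma> \<in> cball x r)}"
    have card: "card ?W \<le> 4 ^ DIM('a)"
      using k(1)
    proof
      assume "k = 0"
      then have "?W \<subseteq> {[]}" by auto
      then have "card ?W \<le> card {[] :: nat list}" by (intro card_mono) auto
      also have "\<dots> \<le> 4 ^ DIM('a)" by simp
      finally show ?thesis .
    next
      assume le: "r / l \<le> (1/2) ^ k"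
      let ?W' = "{w. w \<in> lists {..<2 ^ DIM('a)} \<and> length w = k \<and>
          (\<exists>\<sigma>\<in>cylinder w. dyadic_point \<sigma> \<in> cball ((x - c) /\<^sub>R l) (r / l))}"
      have "?W \<subseteq> ?W'"
      proof
        fix w assume w: "w \<in> ?W"
        then obtain \<sigma> where \<sigma>: "\<sigma> \<in> cylinder w" "dist x (\<pi> \<sigma>) \<le> r" by auto
        have "(x - c) /\<^sub>R l - dyadic_point \<sigma> = (x - \<pi> \<sigma>) /\<^sub>R l"
          using l by (simp add: \<pi>_def algebra_simps)
        then have "dist ((x - c) /\<^sub>R l) (dyadic_point \<sigma>) = dist x (\<pi> \<sigma>) / l"
          using l by (simp add: dist_norm divide_inverse mult.commute)
        also have "\<dots> \<le> r / l" using l \<sigma> by (intro divide_right_mono) auto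
        finally show "w \<in> ?W'" using \<sigma> w by (auto simp: N_def)
      qed
      moreover have "finite {w. set w \<subseteq> {..<(2::nat) ^ DIM('a)} \<and> length w = k}"
        by (rule finite_lists_length_eq) simp
      then have "finite ?W'" by (rule rev_finite_subset) auto
      ultimately have "card ?W \<le> card ?W'" by (intro card_mono)
      also have "\<dots> \<le> 4 ^ DIM('a)" by (rule card_dyadic_cubes_le[OF le])
      finally show ?thesis .
    qed
    have "emeasure \<mu> (cball x r) \<le> ennreal (q ^ k * real (card ?W))" by (rule \<mu>(5)) simp
    also have "q ^ k * real (card ?W) \<le> (2 * (r / l)) powr s * 4 ^ DIM('a)"
    proof (rule mult_mono)
      show "q ^ k \<le> (2 * (r / l)) powr s"
        unfolding q_power using k(2) s by (intro powr_mono2) auto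
      show "real (card ?W) \<le> 4 ^ DIM('a)"
        using of_nat_mono[OF card, where 'a = real] by (simp only: of_nat_power of_nat_numeral)
    qed auto
    also have "(2 * (r / l)) powr s = (2 / l) powr s * r powr s"
      using l r by (subst powr_mult[symmetric]) auto
    finally show ?thesis by (simp add: D_def ac_simps ennreal_leI)
  qed
  define M where "M = measure \<mu> UNIV"
  have M_eq: "emeasure \<mu> UNIV = ennreal M"
    unfolding M_def using \<mu>(4) by (intro emeasure_eq_ennreal_measure) simp
  then have "ennreal M \<noteq> 0" using \<mu>(3) by metis
  then have "0 < M" by (simp add: ennreal_eq_0_iff)
  note M = M_eq this
  define \<nu> where "\<nu> = scale_measure (ennreal (1 / M)) \<mu>"
  have "frostman_measure s (\<pi> ` K) \<nu>"
    unfolding frostman_measure_def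
  proof (intro conjI exI[of _ "D / M"] allI impI)
    show "compact (\<pi> ` K)"
      by (rule compact_continuous_image[OF continuous_on_subset[OF cont] K(1)]) simp
    show "sets \<nu> = sets borel" by (simp add: \<nu>_def \<mu>)
    show "emeasure \<nu> UNIV = 1" using M by (simp add: \<nu>_def ennreal_mult'[symmetric])
    show "emeasure \<nu> (- \<pi> ` K) = 0" by (simp add: \<nu>_def \<mu>)
    show "0 < D / M" using D M by simp
  next
    fix x :: 'a and r :: real assume r: "0 < r"
    have "emeasure \<nu> (cball x r) \<le> ennreal (1 / M) * ennreal (D * r powr s)"
      unfolding \<nu>_def emeasure_scale_measure by (intro mult_left_mono ball r) simp
    also have "\<dots> = ennreal (D / M * r powr s)"
      using M D by (simp add: ennreal_mult'[symmetric])
    finally show "emeasure \<nu> (cball x r) \<le> ennreal (D / M * r powr s)" .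
  qed
  moreover have "\<pi> ` K \<subseteq> A" using K(2) by (auto simp: B_def)
  ultimately show ?thesis by blast
qed

text \<open>Exponent 0 is included so that sets of dimension zero, such as single points, are
  treated like all others.\<close>

lemma frostman_lemma:
  fixes A :: "'a::euclidean_space set"
  assumes A: "A \<in> sets borel" "A \<noteq> {}" and s: "0 < s \<longrightarrow> ereal s < hausdorff_dim A" "0 \<le> s"
  shows "\<exists>K \<mu>. K \<subseteq> A \<and> frostman_measure s K \<mu>"
proof (cases "0 < s")
  case True
  then show ?thesis using frostman_lemma_pos A s by blast
next
  case False
  obtain a where a: "a \<in> A" using A by auto
  \<comment> \<open>For \<open>s = 0\<close> the bound only asks for total mass one, as
    \<open>r powr 0 = 1\<close>; a point mass will do.\<close>
  have "frostman_measure s {a} (return borel a)"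
    unfolding frostman_measure_def
  proof (intro conjI exI[of _ 1] allI impI)
    fix x :: 'a and r :: real assume "0 < r"
    then show "emeasure (return borel a) (cball x r) \<le> ennreal (1 * r powr s)"
      using False s by (simp add: indicator_def)
  qed (auto simp: indicator_def)
  then show ?thesis using a by blast
qed

section \<open>Frostman measures on the orthogonal group\<close>

lemma orthogonal_matrix_inner_rows:
  fixes Q :: "real^'n^'n"
  assumes "orthogonal_matrix Q"
  shows "Q $ i \<bullet> Q $ j = (if i = j then 1 else 0)"
proof -
  have "(Q ** transpose Q) $ i $ j = Q $ i \<bullet> Q $ j"
    by (simp add: matrix_matrix_mult_def transpose_def inner_vec_def)
  then show ?thesis using assms by (simp add: orthogonal_matrix_def mat_def)
qed

lemma orthogonal_matrix_norm_row: "orthogonal_matrix (Q :: real^'n^'n) \<Longrightarrow> norm (Q $ i) = 1"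
  by (simp add: norm_eq_sqrt_inner orthogonal_matrix_inner_rows)

lemma orthogonal_matrix_norm_mult:
  fixes Q :: "real^'n^'n"
  assumes "orthogonal_matrix Q"
  shows "norm (Q *v x) = norm x"
proof -
  have "orthogonal_transformation ((*v) Q)"
    using assms by (simp add: orthogonal_transformation_matrix)
  then show ?thesis by (rule orthogonal_transformation_norm)
qed

lemma card_floor_interval_le:
  fixes B :: real
  assumes "0 \<le> B"
  shows "real (card {\<lfloor>- B\<rfloor>..\<lfloor>B\<rfloor>}) \<le> 2 * B + 2"
proof -
  have "real (card {\<lfloor>- B\<rfloor>..\<lfloor>B\<rfloor>}) = real_of_int (\<lfloor>B\<rfloor> - \<lfloor>- B\<rfloor> + 1)"
  proof -
    have "0 \<le> \<lfloor>B\<rfloor> - \<lfloor>- B\<rfloor> + 1" using assms by linarith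
    then show ?thesis by simp
  qed
  also have "\<dots> \<le> 2 * B + 2" by linarith
  finally show ?thesis .
qed

text \<open>
  A unit vector has a coordinate of size at least \<open>1 / sqrt d\<close>, which is determined up to sign, in
  a Lipschitz way, by the other coordinates. So a grid in the other coordinates suffices.
\<close>

lemma unit_sphere_grid_dist:
  fixes v w :: "real^'n" and i :: 'n and r :: real
  defines "d \<equiv> real CARD('n)"
  assumes unit: "norm v = 1" "norm w = 1"
    and i: "1 \<le> d * (v $ i)\<^sup>2" "1 \<le> d * (w $ i)\<^sup>2" "v $ i > 0 \<longleftrightarrow> w $ i > 0"
    and close: "\<And>j. j \<noteq> i \<Longrightarrow> \<bar>v $ j - w $ j\<bar> \<le> r / (2 * d\<^sup>2)" and r: "0 \<le> r"
  shows "norm (v - w) \<le> r"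
proof -
  have d: "1 \<le> d" unfolding d_def by (simp add: Suc_le_eq)
  \<comment> \<open>The errors in the single coordinates will add up to
    \<open>(d\<^sup>2 - 1) * s\<close>, which this grid width keeps below \<open>r\<close>.\<close>
  define s where "s = r / (2 * d\<^sup>2)"
  have s: "0 \<le> s" using r d by (simp add: s_def)
  have coord_le: "\<bar>x $ j\<bar> \<le> 1" if "norm x = 1" for x :: "real^'n" and j
    using component_le_norm_cart[of x j] that by simp
  \<comment> \<open>Both vectors have norm one, so the change of the square of coordinate
    \<open>i\<close> is compensated by the others.\<close>
  have rest: "(\<Sum>j\<in>UNIV - {i}. (w $ j)\<^sup>2 - (v $ j)\<^sup>2) = (v $ i)\<^sup>2 - (w $ i)\<^sup>2"
  proof -
    have one: "(\<Sum>j\<in>UNIV. (x $ j)\<^sup>2) = 1" if "norm x = 1" for x :: "real^'n"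
      using that by (simp add: norm_eq_1 inner_vec_def power2_eq_square)
    have "(\<Sum>j\<in>UNIV. (w $ j)\<^sup>2 - (v $ j)\<^sup>2) = 0"
      using one[OF unit(1)] one[OF unit(2)] by (simp add: sum_subtractf)
    then show ?thesis by (simp add: sum.remove[of UNIV i])
  qed
  have "\<bar>(v $ i)\<^sup>2 - (w $ i)\<^sup>2\<bar> \<le> (\<Sum>j\<in>UNIV - {i}. \<bar>(w $ j)\<^sup>2 - (v $ j)\<^sup>2\<bar>)"
    unfolding rest[symmetric] by (rule sum_abs)
  also have "\<dots> \<le> (\<Sum>j\<in>UNIV - {i}. 2 * s)"
  proof (rule sum_mono)
    fix j assume "j \<in> UNIV - {i}"
    then have "\<bar>v $ j - w $ j\<bar> \<le> s" using close by (simp add: s_def)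
    moreover have "\<bar>w $ j + v $ j\<bar> \<le> 2" using coord_le[OF unit(1), of j] coord_le[OF unit(2), of j] by linarith
    ultimately have "\<bar>w $ j - v $ j\<bar> * \<bar>w $ j + v $ j\<bar> \<le> s * 2"
      by (intro mult_mono) (auto simp: s abs_minus_commute)
    then show "\<bar>(w $ j)\<^sup>2 - (v $ j)\<^sup>2\<bar> \<le> 2 * s"
      by (simp add: power2_eq_square square_diff_square_factored abs_mult mult.commute)
  qed
  also have "\<dots> = 2 * (d - 1) * s"
    by (simp add: card_Diff_singleton d_def of_nat_diff Suc_le_eq)
  finally have sq: "\<bar>(v $ i)\<^sup>2 - (w $ i)\<^sup>2\<bar> \<le> 2 * (d - 1) * s" .
  \<comment> \<open>Division by \<open>v $ i + w $ i\<close>: entries of a unit vector satisfy |x|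
    \<ge> x^2, so both entries have size at least 1/d, and equal signs prevent cancellation.\<close>
  have "\<bar>v $ i - w $ i\<bar> \<le> d * (d - 1) * s"
  proof -
    have "1 \<le> d * (\<bar>v $ i\<bar> * 1)" "1 \<le> d * (\<bar>w $ i\<bar> * 1)"
    proof -
      have sq_le: "(x $ i)\<^sup>2 \<le> \<bar>x $ i\<bar> * 1" if "norm x = 1" for x :: "real^'n"
        unfolding power2_eq_square abs_mult_self_eq[symmetric, of "x $ i"]
        by (intro mult_left_mono coord_le that) simp
      have "d * (v $ i)\<^sup>2 \<le> d * (\<bar>v $ i\<bar> * 1)" "d * (w $ i)\<^sup>2 \<le> d * (\<bar>w $ i\<bar> * 1)"
        using d by (intro mult_left_mono sq_le unit; simp)+
      then show "1 \<le> d * (\<bar>v $ i\<bar> * 1)" "1 \<le> d * (\<bar>w $ i\<bar> * 1)" using i by linarith+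
    qed
    moreover have "\<bar>v $ i + w $ i\<bar> = \<bar>v $ i\<bar> + \<bar>w $ i\<bar>"
      using i(3) by auto
    ultimately have "2 \<le> d * \<bar>v $ i + w $ i\<bar>" by (simp add: distrib_left)
    then have "2 * \<bar>v $ i - w $ i\<bar> \<le> (d * \<bar>v $ i + w $ i\<bar>) * \<bar>v $ i - w $ i\<bar>"
      by (intro mult_right_mono) auto
    also have "\<dots> = d * \<bar>(v $ i)\<^sup>2 - (w $ i)\<^sup>2\<bar>"
      by (simp add: power2_eq_square square_diff_square_factored abs_mult)
    also have "\<dots> \<le> d * (2 * (d - 1) * s)" using d by (intro mult_left_mono sq) auto
    also have "\<dots> = 2 * (d * (d - 1) * s)" by (simp only: mult_ac)
    finally show ?thesis by (simp only: mult_le_cancel_left_pos zero_less_numeral)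
  qed
  moreover have "norm (v - w) \<le> (\<Sum>j\<in>UNIV. \<bar>(v - w) $ j\<bar>)" by (rule norm_le_l1_cart)
  moreover have "(\<Sum>j\<in>UNIV. \<bar>(v - w) $ j\<bar>) = \<bar>v $ i - w $ i\<bar> + (\<Sum>j\<in>UNIV - {i}. \<bar>v $ j - w $ j\<bar>)"
    by (subst sum.remove[of UNIV i]) auto
  moreover have "(\<Sum>j\<in>UNIV - {i}. \<bar>v $ j - w $ j\<bar>) \<le> (\<Sum>j\<in>UNIV - {i}. s)"
    using close by (intro sum_mono) (auto simp: s_def)
  moreover have "(\<Sum>j\<in>UNIV - {i}. s) = (d - 1) * s"
    by (simp add: card_Diff_singleton d_def of_nat_diff Suc_le_eq)
  ultimately have "norm (v - w) \<le> d * (d - 1) * s + (d - 1) * s" by linarith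
  also have "\<dots> = (d\<^sup>2 - 1) * s" by (simp add: algebra_simps power2_eq_square)
  also have "\<dots> \<le> (2 * d\<^sup>2) * s"  using zero_le_power2[of d] by (intro mult_right_mono s) linarith
  also have "\<dots> = r" using d by (simp add: s_def)
  finally show ?thesis .
qed

lemma floor_eq_imp_abs_diff_less:
  fixes x y :: real
  shows "\<lfloor>x\<rfloor> = \<lfloor>y\<rfloor> \<Longrightarrow> \<bar>x - y\<bar> < 1"
  by linarith

text \<open>A coordinate in \<open>J\<close> is so small that it meets boundedly many grid cells,
  the large coordinate is determined by the rest, and each of the remaining
  \<open>CARD('n) - 1 - card J\<close> coordinates meets about 1/r cells.\<close>

lemma unit_sphere_slice_covering:
  "\<exists>C>0. \<forall>(J :: 'n::finite set) r. J \<noteq> UNIV \<longrightarrow> 0 < r \<longrightarrow> 4 * real CARD('n) * r \<le> 1 \<longrightarrow>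
     (\<exists>Z :: (real^'n) set. finite Z \<and> real (card Z) \<le> C * (1 / r) ^ (CARD('n) - 1 - card J) \<and>
        (\<forall>v. norm v = 1 \<longrightarrow> (\<forall>j\<in>J. \<bar>v $ j\<bar> \<le> 2 * r) \<longrightarrow> (\<exists>z\<in>Z. norm (v - z) \<le> r)))"
proof -
  define d where "d = real CARD('n)"
  have d: "1 \<le> d" unfolding d_def by (simp add: Suc_le_eq)
  define M where "M = 2 * d\<^sup>2"
  have "1 \<le> d\<^sup>2" using d by simp
  then have M: "1 \<le> M" by (simp add: M_def)
  \<comment> \<open>The factors count the positions of the large coordinate, its signs, and, up to
    powers of 1/r, the grid cells in each coordinate.\<close>
  define C where "C = d * 2 * (4 * M + 2) ^ CARD('n)"
  show ?thesis
  proof (intro exI[of _ C] conjI allI impI)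
    show "0 < C" using d M by (simp add: C_def)
    fix J :: "'n set" and r :: real
    assume J: "J \<noteq> UNIV" and r: "0 < r" and small: "4 * real CARD('n) * r \<le> 1"
    have dr: "4 * d * r \<le> 1" using small by (simp add: d_def)
    have r4: "4 * r \<le> 4 * d * r" using d r by simp
    then have r1: "r \<le> 1" using dr r by linarith
    define U where "U = {v :: real^'n. norm v = 1 \<and> (\<forall>j\<in>J. \<bar>v $ j\<bar> \<le> 2 * r)}"
    define big where "big v = (SOME i. i \<notin> J \<and> 1 \<le> d * (v $ i)\<^sup>2)" for v :: "real^'n"
    have big: "big v \<notin> J \<and> 1 \<le> d * (v $ big v)\<^sup>2" if v: "v \<in> U" for v
    proof -
      have "\<exists>i. 1 \<le> d * (v $ i)\<^sup>2"
      proof (rule ccontr)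
        assume "\<nexists>i. 1 \<le> d * (v $ i)\<^sup>2"
        then have "(v $ i)\<^sup>2 < 1 / d" for i using d by (simp add: not_le field_simps)
        then have "(\<Sum>i\<in>UNIV. (v $ i)\<^sup>2) < (\<Sum>i\<in>(UNIV :: 'n set). 1 / d)"
          by (intro sum_strict_mono) auto
        then have "(\<Sum>i\<in>UNIV. (v $ i)\<^sup>2) < 1" using d by (simp add: d_def)
        moreover have "(\<Sum>i\<in>UNIV. (v $ i)\<^sup>2) = 1"
          using v by (simp add: U_def norm_eq_1 inner_vec_def power2_eq_square)
        ultimately show False by simp
      qed
      then obtain i where i: "1 \<le> d * (v $ i)\<^sup>2" ..
      \<comment> \<open>This is the purpose of the smallness of \<open>r\<close>: on
        \<open>J\<close> the quantity \<open>d * (v $ i)\<^sup>2\<close> is at most (4dr)r <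
        1.\<close>
      have "i \<notin> J"
      proof
        assume "i \<in> J"
        then have "\<bar>v $ i\<bar> \<le> 2 * r" using v by (simp add: U_def)
        then have "\<bar>v $ i\<bar>\<^sup>2 \<le> (2 * r)\<^sup>2" by (rule power_mono) simp
        then have "(v $ i)\<^sup>2 \<le> (2 * r)\<^sup>2" by (simp only: power2_abs)
        then have "d * (v $ i)\<^sup>2 \<le> d * (2 * r)\<^sup>2" using d by (intro mult_left_mono) auto
        also have "\<dots> = (4 * d * r) * r" by (simp add: power2_eq_square)
        also have "\<dots> \<le> 1 * r" using dr r by (intro mult_right_mono) auto
        also have "\<dots> < 1"
          using dr r r4 by linarith
        finally show False using i by simp
      qed
      with i have "\<exists>i. i \<notin> J \<and> 1 \<le> d * (v $ i)\<^sup>2" by blast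
      then show ?thesis unfolding big_def by (rule someI_ex)
    qed
    define B where "B j = (if j \<in> J then 2 * M else M / r)" for j
    have B_pos: "0 \<le> B j" for j using M r by (simp add: B_def)
    define cell where "cell v = (big v, v $ big v > 0, restrict (\<lambda>j. \<lfloor>M * v $ j / r\<rfloor>) (UNIV - {big v}))" for v
    let ?R = "\<lambda>i. PiE (UNIV - {i}) (\<lambda>j. {\<lfloor>- B j\<rfloor>..\<lfloor>B j\<rfloor>})"
    let ?T = "Sigma (- J) (\<lambda>i. (UNIV :: bool set) \<times> ?R i)"
    have fin_R: "finite (?R i)" for i by (intro finite_PiE) auto
    then have fin_T: "finite ?T" by (intro finite_SigmaI) auto
    have cell_T: "cell ` U \<subseteq> ?T"
    proof (rule image_subsetI)
      fix v assume v: "v \<in> U"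
      have bd: "\<bar>M * v $ j / r\<bar> \<le> B j" for j
      proof (cases "j \<in> J")
        case True
        then have "M * \<bar>v $ j\<bar> / r \<le> M * (2 * r) / r"
          using v M r by (intro divide_right_mono mult_left_mono) (auto simp: U_def)
        then show ?thesis using True M r by (simp add: B_def abs_mult)
      next
        case False
        have "\<bar>v $ j\<bar> \<le> 1" using v component_le_norm_cart[of v j] by (simp add: U_def)
        then have "M * \<bar>v $ j\<bar> / r \<le> M * 1 / r"
          using M r by (intro divide_right_mono mult_left_mono) auto
        then show ?thesis using False M r by (simp add: B_def abs_mult)
      qed
      have "\<lfloor>M * v $ j / r\<rfloor> \<in> {\<lfloor>- B j\<rfloor>..\<lfloor>B j\<rfloor>}" for j
      proof -
        have "- B j \<le> M * v $ j / r" "M * v $ j / r \<le> B j" using bd[of j] by linarith+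
        then show ?thesis by (simp only: atLeastAtMost_iff floor_mono simp_thms)
      qed
      then show "cell v \<in> ?T" using big[OF v] by (auto simp: cell_def)
    qed
    \<comment> \<open>One representative for every occupied cell; it need only be close to the other
      points of its cell.\<close>
    define Z where "Z = inv_into U cell ` (cell ` U)"
    have fin_cell: "finite (cell ` U)" using fin_T cell_T by (rule rev_finite_subset)
    have cardR: "real (card (?R i)) \<le> (4 * M + 2) ^ CARD('n) * (1 / r) ^ (CARD('n) - 1 - card J)"
      if i: "i \<notin> J" for i
    proof -
      have "real (card (?R i)) = (\<Prod>j\<in>UNIV - {i}. real (card {\<lfloor>- B j\<rfloor>..\<lfloor>B j\<rfloor>}))"
        by (simp add: card_PiE)
      also have "\<dots> \<le> (\<Prod>j\<in>UNIV - {i}. (4 * M + 2) * (if j \<in> J then 1 else 1 / r))"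
      proof (intro prod_mono conjI)
        fix j
        have "real (card {\<lfloor>- B j\<rfloor>..\<lfloor>B j\<rfloor>}) \<le> 2 * B j + 2"
          by (rule card_floor_interval_le[OF B_pos])
        also have "\<dots> \<le> (4 * M + 2) * (if j \<in> J then 1 else 1 / r)"
        proof (cases "j \<in> J")
          case False
          have "2 * M / r + 2 \<le> 4 * M / r + 2 / r"
            using M r r1 by (intro add_mono divide_right_mono) (auto simp: pos_le_divide_eq)
          then show ?thesis using False by (simp add: B_def add_divide_distrib)
        qed (simp add: B_def)
        finally show "real (card {\<lfloor>- B j\<rfloor>..\<lfloor>B j\<rfloor>}) \<le> (4 * M + 2) * (if j \<in> J then 1 else 1 / r)" .
      qed simp
      also have "\<dots> = (4 * M + 2) ^ (CARD('n) - 1) * (\<Prod>j\<in>UNIV - {i}. if j \<in> J then 1 else 1 / r)"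
        by (simp add: prod.distrib card_Diff_singleton)
      also have "(\<Prod>j\<in>UNIV - {i}. if j \<in> J then 1 else 1 / r) = (1 / r) ^ (CARD('n) - 1 - card J)"
      proof -
        have "(\<Prod>j\<in>UNIV - {i}. if j \<in> J then 1 else 1 / r) = (\<Prod>j\<in>(UNIV - {i}) - J. 1 / r)"
          by (intro prod.mono_neutral_cong_right) auto
        also have "\<dots> = (1 / r) ^ card ((UNIV - {i}) - J)" by (rule prod_constant)
        also have "card ((UNIV - {i}) - J) = CARD('n) - 1 - card J"
          using i by (subst card_Diff_subset) (auto simp: card_Diff_singleton)
        finally show ?thesis .
      qed
      also have "(4 * M + 2) ^ (CARD('n) - 1) \<le> (4 * M + 2) ^ CARD('n)"
        using M by (intro power_increasing) auto
      finally show ?thesis using r by (simp add: mult_right_mono)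
    qed
    show "\<exists>Z :: (real^'n) set. finite Z \<and> real (card Z) \<le> C * (1 / r) ^ (CARD('n) - 1 - card J) \<and>
        (\<forall>v. norm v = 1 \<longrightarrow> (\<forall>j\<in>J. \<bar>v $ j\<bar> \<le> 2 * r) \<longrightarrow> (\<exists>z\<in>Z. norm (v - z) \<le> r))"
    proof (intro exI[of _ Z] conjI allI impI)
      show "finite Z" unfolding Z_def by (intro finite_imageI fin_cell)
      have "card Z \<le> card (cell ` U)" unfolding Z_def by (rule card_image_le[OF fin_cell])
      also have "\<dots> \<le> card ?T" by (rule card_mono[OF fin_T cell_T])
      also have "\<dots> = (\<Sum>i\<in>- J. 2 * card (?R i))"
        using fin_R by (subst card_SigmaI) (auto simp: card_cartesian_product)
      finally have "real (card Z) \<le> (\<Sum>i\<in>- J. 2 * real (card (?R i)))"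
        by (simp flip: of_nat_le_iff[where 'a = real])
      also have "\<dots> \<le> (\<Sum>i\<in>- J. 2 * ((4 * M + 2) ^ CARD('n) * (1 / r) ^ (CARD('n) - 1 - card J)))"
        by (intro sum_mono mult_left_mono cardR) auto
      also have "\<dots> \<le> d * (2 * ((4 * M + 2) ^ CARD('n) * (1 / r) ^ (CARD('n) - 1 - card J)))"
        using M r by (simp add: d_def card_mono mult_right_mono)
      finally show "real (card Z) \<le> C * (1 / r) ^ (CARD('n) - 1 - card J)"
        by (simp add: C_def mult.assoc)
    next
      fix v :: "real^'n" assume "norm v = 1" "\<forall>j\<in>J. \<bar>v $ j\<bar> \<le> 2 * r"
      then have v: "v \<in> U" by (simp add: U_def)
      define z where "z = inv_into U cell (cell v)"
      have z: "z \<in> U" "cell z = cell v"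
        unfolding z_def using v by (auto intro: inv_into_into f_inv_into_f)
      have eq: "big z = big v" "z $ big v > 0 \<longleftrightarrow> v $ big v > 0"
          "restrict (\<lambda>j. \<lfloor>M * z $ j / r\<rfloor>) (UNIV - {big v}) = restrict (\<lambda>j. \<lfloor>M * v $ j / r\<rfloor>) (UNIV - {big v})"
        using z(2) by (auto simp: cell_def)
      have "norm (v - z) \<le> r"
      proof (rule unit_sphere_grid_dist[of v z "big v"])
        show "norm v = 1" "norm z = 1" using v z by (auto simp: U_def)
        show "1 \<le> real CARD('n) * (v $ big v)\<^sup>2" "1 \<le> real CARD('n) * (z $ big v)\<^sup>2"
          using big[OF v] big[OF z(1)] eq by (auto simp: d_def)
        show "v $ big v > 0 \<longleftrightarrow> z $ big v > 0" using eq by simp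
        fix j assume "j \<noteq> big v"
        then have "\<lfloor>M * z $ j / r\<rfloor> = \<lfloor>M * v $ j / r\<rfloor>"
          using fun_cong[OF eq(3), of j] by simp
        then have "\<bar>M * v $ j / r - M * z $ j / r\<bar> \<le> 1"
          using floor_eq_imp_abs_diff_less[of "M * v $ j / r" "M * z $ j / r"] by simp
        then have "(M / r) * \<bar>v $ j - z $ j\<bar> \<le> 1"
          using M r by (simp add: right_diff_distrib[symmetric] diff_divide_distrib[symmetric] abs_mult)
        then show "\<bar>v $ j - z $ j\<bar> \<le> r / (2 * (real CARD('n))\<^sup>2)"
          using M r unfolding M_def d_def by (simp add: field_simps)
      qed (use r in simp)
      moreover have "z \<in> Z" using v by (simp add: Z_def z_def)
      ultimately show "\<exists>z\<in>Z. norm (v - z) \<le> r" by blast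
    qed
  qed
qed

section \<open>Orthogonal matrices with some rows nearly prescribed\<close>

lemma matrix_mult_row: "(A ** B) $ i = (\<Sum>k\<in>UNIV. A $ i $ k *\<^sub>R B $ k)"
  for A :: "real^'n^'m" and B :: "real^'p^'n"
  by (simp add: vec_eq_iff matrix_matrix_mult_def)

lemma matrix_mult_diff_distrib: "A ** (B - C) = A ** B - A ** C"
  for A :: "real^'n^'m" and B C :: "real^'p^'n"
  by (simp add: vec_eq_iff matrix_matrix_mult_def right_diff_distrib sum_subtractf)

lemma continuous_on_matrix_mult_row [continuous_intros]:
  "continuous_on S (\<lambda>g. (A ** g) $ i)" for A :: "real^'n^'m" and S :: "(real^'p^'n) set"
  unfolding matrix_mult_row by (intro continuous_intros)

text \<open>Row \<open>j\<close> of \<open>A ** g\<close> is the image under the transpose of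
  \<open>g\<close> of row \<open>j\<close> of \<open>A\<close>. The frame \<open>A\<close> thus
  allows prescribing the images of arbitrary orthonormal vectors instead of coordinate
  vectors.\<close>

definition row_tube :: "real^'n^'n \<Rightarrow> real^'n^'n \<Rightarrow> 'n set \<Rightarrow> real \<Rightarrow> (real^'n^'n) set" where
  "row_tube A Y J r = {g. \<forall>j\<in>J. norm ((A ** g) $ j - Y $ j) \<le> r}"

lemma closed_row_tube: "closed (row_tube A Y J r)"
proof -
  have "row_tube A Y J r = (\<Inter>j\<in>J. {g. norm ((A ** g) $ j - Y $ j) \<le> r})"
    by (auto simp: row_tube_def)
  also have "closed \<dots>"
    by (intro closed_INT ballI closed_Collect_le continuous_intros)
  finally show ?thesis .
qed

text \<open>All rows together determine \<open>g\<close>: multiplying by the transpose of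
  \<open>A\<close>, whose entries are at most 1, recovers it with a bounded loss.\<close>

lemma row_tube_UNIV_subset:
  fixes A :: "real^'n^'n"
  assumes A: "orthogonal_matrix A" and g0: "g0 \<in> row_tube A Y UNIV r"
  shows "row_tube A Y UNIV r \<subseteq> cball g0 (2 * (real CARD('n))\<^sup>2 * r)"
proof
  fix g assume g: "g \<in> row_tube A Y UNIV r"
  have row: "norm ((A ** g0) $ j - (A ** g) $ j) \<le> 2 * r" for j
  proof -
    have "norm ((A ** g0) $ j - Y $ j) \<le> r" "norm ((A ** g) $ j - Y $ j) \<le> r"
      using g g0 by (auto simp: row_tube_def)
    then show ?thesis
      using norm_triangle_ineq4[of "(A ** g0) $ j - Y $ j" "(A ** g) $ j - Y $ j"] by simp
  qed
  have A': "transpose A ** A = mat 1" using A by (simp add: orthogonal_matrix_def)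
  have "g0 - g = transpose A ** (A ** g0 - A ** g)"
    by (simp add: matrix_mult_diff_distrib[symmetric] matrix_mul_assoc A')
  then have "(g0 - g) $ i = (\<Sum>k\<in>UNIV. transpose A $ i $ k *\<^sub>R (A ** g0 - A ** g) $ k)" for i
    by (simp only: matrix_mult_row)
  moreover have "norm (\<Sum>k\<in>UNIV. transpose A $ i $ k *\<^sub>R (A ** g0 - A ** g) $ k) \<le> (\<Sum>k\<in>(UNIV :: 'n set). 2 * r)" for i
  proof (rule order_trans[OF norm_sum sum_mono])
    fix k
    have "\<bar>transpose A $ i $ k\<bar> \<le> 1"
      using component_le_norm_cart[of "A $ k" i] orthogonal_matrix_norm_row[OF A, of k]
      by (simp add: transpose_def)
    then have "\<bar>transpose A $ i $ k\<bar> * norm ((A ** g0) $ k - (A ** g) $ k) \<le> 1 * (2 * r)"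
      by (intro mult_mono row) auto
    then show "norm (transpose A $ i $ k *\<^sub>R (A ** g0 - A ** g) $ k) \<le> 2 * r" by simp
  qed
  ultimately have rows: "norm ((g0 - g) $ i) \<le> real CARD('n) * (2 * r)" for i by simp
  have "norm (g0 - g) \<le> (\<Sum>i\<in>UNIV. norm ((g0 - g) $ i))"
    unfolding norm_vec_def by (rule L2_set_le_sum) simp
  also have "\<dots> \<le> (\<Sum>i\<in>(UNIV :: 'n set). real CARD('n) * (2 * r))"
    by (intro sum_mono rows)
  finally have "norm (g0 - g) \<le> real CARD('n) * (real CARD('n) * (2 * r))" by simp
  then show "g \<in> cball g0 (2 * (real CARD('n))\<^sup>2 * r)"
    by (simp add: dist_norm power2_eq_square mult_ac)
qed

text \<open>Row \<open>i\<close> of \<open>A ** g\<close> is a unit vector orthogonal to the rows in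
  \<open>J\<close>, and these are within \<open>2 * r\<close> of the rows of \<open>A ** g0\<close>.
  In the frame \<open>A ** g0\<close> its coordinates in \<open>J\<close> are therefore small, and
  the net \<open>Z\<close> of the spherical slice applies.\<close>

lemma row_tube_covering:
  fixes A :: "real^'n^'n"
  assumes A: "orthogonal_matrix A" and g0: "g0 \<in> row_tube A Y J r" "orthogonal_matrix g0"
    and i: "i \<notin> J"
    and Z: "\<And>v. norm v = 1 \<Longrightarrow> (\<forall>j\<in>J. \<bar>v $ j\<bar> \<le> 2 * r) \<Longrightarrow> (\<exists>z\<in>Z. norm (v - z) \<le> r)"
  shows "row_tube A Y J r \<inter> {g. orthogonal_matrix g}
    \<subseteq> (\<Union>z\<in>Z. row_tube A (\<chi> j. if j = i then transpose (A ** g0) *v z else Y $ j) (insert i J) r)"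
proof
  fix g assume g: "g \<in> row_tube A Y J r \<inter> {g. orthogonal_matrix g}"
  define F where "F = A ** g0"
  have F: "orthogonal_matrix F" unfolding F_def using A g0(2) by (rule orthogonal_matrix_mul)
  have Ag: "orthogonal_matrix (A ** g)" using A g by (auto intro: orthogonal_matrix_mul)
  define u where "u = (A ** g) $ i"
  define v where "v = F *v u"
  have u: "norm u = 1" unfolding u_def by (rule orthogonal_matrix_norm_row[OF Ag])
  have "\<bar>v $ j\<bar> \<le> 2 * r" if j: "j \<in> J" for j
  proof -
    have "v $ j = F $ j \<bullet> u" by (simp add: v_def matrix_vector_mul_component)
    also have "\<dots> = (F $ j - (A ** g) $ j) \<bullet> u"
      using orthogonal_matrix_inner_rows[OF Ag, of j i] i j by (auto simp: u_def inner_diff_left)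
    finally have "\<bar>v $ j\<bar> \<le> norm (F $ j - (A ** g) $ j)"
      using Cauchy_Schwarz_ineq2[of "F $ j - (A ** g) $ j" u] u by simp
    also have "\<dots> = norm ((F $ j - Y $ j) - ((A ** g) $ j - Y $ j))" by simp
    also have "\<dots> \<le> norm (F $ j - Y $ j) + norm ((A ** g) $ j - Y $ j)" by (rule norm_triangle_ineq4)
    also have "\<dots> \<le> r + r"
      using g0(1) g j by (intro add_mono) (auto simp: row_tube_def F_def)
    finally show ?thesis by simp
  qed
  moreover have "norm v = 1" unfolding v_def by (simp add: orthogonal_matrix_norm_mult[OF F] u)
  ultimately obtain z where z: "z \<in> Z" "norm (v - z) \<le> r" using Z by blast
  have "transpose F *v v = u"
    unfolding v_def using F by (simp add: matrix_vector_mul_assoc orthogonal_matrix_def)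
  then have eq: "u - transpose F *v z = transpose F *v (v - z)"
    by (simp only: matrix_vector_mult_diff_distrib)
  have "norm (u - transpose F *v z) = norm (v - z)"
    unfolding eq by (rule orthogonal_matrix_norm_mult) (use F in \<open>simp add: orthogonal_matrix_transpose\<close>)
  then have "norm (u - transpose F *v z) \<le> r" using z by simp
  then have "g \<in> row_tube A (\<chi> j. if j = i then transpose F *v z else Y $ j) (insert i J) r"
    using g i by (auto simp: row_tube_def u_def)
  then show "g \<in> (\<Union>z\<in>Z. row_tube A (\<chi> j. if j = i then transpose (A ** g0) *v z else Y $ j) (insert i J) r)"
    using z unfolding F_def by blast
qed

text \<open>Fixing \<open>card J\<close> rows leaves a coset of the orthogonal group in the
  remaining dimensions; with k = d - card J its dimension is k(k - 1)/2, the number subtracted from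
  \<open>t\<close>.\<close>

definition tube_decay :: "real \<Rightarrow> (real^'n^'n) measure \<Rightarrow> 'n set \<Rightarrow> bool" where
  "tube_decay t \<nu> J \<longleftrightarrow> (\<exists>C>0. \<forall>A Y r. orthogonal_matrix A \<longrightarrow> 0 < r \<longrightarrow> 4 * real CARD('n) * r \<le> 1 \<longrightarrow>
     emeasure \<nu> (row_tube A Y J r)
       \<le> ennreal (C * r powr (t - (real CARD('n) - real (card J)) * (real CARD('n) - real (card J) - 1) / 2)))"

lemma frostman_measureD:
  assumes "frostman_measure s K \<mu>"
  shows "compact K" "sets \<mu> = sets borel" "emeasure \<mu> UNIV = 1" "emeasure \<mu> (- K) = 0"
    "space \<mu> = UNIV"
  using assms sets_eq_imp_space_eq[of \<mu> borel] by (auto simp: frostman_measure_def)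

lemma frostman_measure_ball:
  assumes "frostman_measure s K \<mu>"
  obtains C where "0 < C" "\<And>x r. 0 < r \<Longrightarrow> emeasure \<mu> (cball x r) \<le> ennreal (C * r powr s)"
  using assms unfolding frostman_measure_def by blast

lemma frostman_measure_emeasure_le_1:
  assumes "frostman_measure s K \<mu>"
  shows "emeasure \<mu> B \<le> 1"
  using emeasure_space[of \<mu> B] frostman_measureD[OF assms] by simp

lemma tube_decay_UNIV:
  fixes \<nu> :: "(real^'n^'n) measure"
  assumes \<nu>: "frostman_measure t K \<nu>"
  shows "tube_decay t \<nu> UNIV"
proof -
  obtain C where C: "0 < C" "\<And>x r. 0 < r \<Longrightarrow> emeasure \<nu> (cball x r) \<le> ennreal (C * r powr t)"
    using frostman_measure_ball[OF \<nu>] by blast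
  let ?D = "C * (2 * (real CARD('n))\<^sup>2) powr t"
  show ?thesis
    unfolding tube_decay_def
  proof (intro exI[of _ ?D] conjI allI impI)
    show "0 < ?D" using C by simp
    fix A Y :: "real^'n^'n" and r :: real assume A: "orthogonal_matrix A" and r: "0 < r"
    have "emeasure \<nu> (row_tube A Y UNIV r) \<le> ennreal (?D * r powr t)"
    proof (cases "row_tube A Y UNIV r = {}")
      case False
      then obtain g0 where g0: "g0 \<in> row_tube A Y UNIV r" by blast
      have "emeasure \<nu> (row_tube A Y UNIV r) \<le> emeasure \<nu> (cball g0 (2 * (real CARD('n))\<^sup>2 * r))"
        using row_tube_UNIV_subset[OF A g0] by (intro emeasure_mono) (simp_all add: frostman_measureD[OF \<nu>])
      also have "\<dots> \<le> ennreal (C * (2 * (real CARD('n))\<^sup>2 * r) powr t)"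
        by (rule C) (use r in simp)
      also have "\<dots> = ennreal (?D * r powr t)"
        using r by (subst powr_mult) (auto simp: mult_ac)
      finally show ?thesis .
    qed simp
    then show "emeasure \<nu> (row_tube A Y UNIV r)
       \<le> ennreal (?D * r powr (t - (real CARD('n) - real (card (UNIV :: 'n set))) * (real CARD('n) - real (card (UNIV :: 'n set)) - 1) / 2))"
      by simp
  qed
qed

text \<open>Prescribing one more row splits the tube into about
  \<open>(1 / r) ^ (CARD('n) - 1 - card J)\<close> thinner tubes. With k = d - card J this exponent
  k - 1 is the difference of the dimensions of O(k) and O(k - 1).\<close>

lemma tube_decay_step:
  fixes \<nu> :: "(real^'n^'n) measure"
  assumes \<nu>: "frostman_measure t K \<nu>" and K: "K \<subseteq> {g. orthogonal_matrix g}"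
    and i: "i \<notin> J" and decay: "tube_decay t \<nu> (insert i J)"
  shows "tube_decay t \<nu> J"
proof -
  define d where "d = real CARD('n)"
  define m where "m = card J"
  have card_insert: "card (insert i J) = Suc m" using i by (simp add: m_def)
  have m_less: "m + 1 \<le> CARD('n)"
    using card_mono[of UNIV "insert i J"] by (simp add: card_insert)
  let ?e = "\<lambda>k. (d - real k) * (d - real k - 1) / 2"
  obtain C where C: "0 < C" "\<And>A Y r. orthogonal_matrix A \<Longrightarrow> 0 < r \<Longrightarrow> 4 * real CARD('n) * r \<le> 1 \<Longrightarrow>
     emeasure \<nu> (row_tube A Y (insert i J) r) \<le> ennreal (C * r powr (t - ?e (Suc m)))"
    using decay unfolding tube_decay_def card_insert d_def by blast
  obtain C' where C': "0 < C'" "\<And>J :: 'n set. \<And>r. J \<noteq> UNIV \<Longrightarrow> 0 < r \<Longrightarrow> 4 * real CARD('n) * r \<le> 1 \<Longrightarrow>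
     (\<exists>Z :: (real^'n) set. finite Z \<and> real (card Z) \<le> C' * (1 / r) ^ (CARD('n) - 1 - card J) \<and>
        (\<forall>v. norm v = 1 \<longrightarrow> (\<forall>j\<in>J. \<bar>v $ j\<bar> \<le> 2 * r) \<longrightarrow> (\<exists>z\<in>Z. norm (v - z) \<le> r)))"
    using unit_sphere_slice_covering[where 'n = 'n] by blast
  show ?thesis
    unfolding tube_decay_def
  proof (intro exI[of _ "C' * C"] conjI allI impI)
    show "0 < C' * C" using C C' by simp
    fix A Y :: "real^'n^'n" and r :: real
    assume A: "orthogonal_matrix A" and r: "0 < r" "4 * real CARD('n) * r \<le> 1"
    show "emeasure \<nu> (row_tube A Y J r)
       \<le> ennreal (C' * C * r powr (t - (real CARD('n) - real (card J)) * (real CARD('n) - real (card J) - 1) / 2))"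
    proof (cases "row_tube A Y J r \<inter> K = {}")
      case True
      then have "emeasure \<nu> (row_tube A Y J r) \<le> emeasure \<nu> (- K)"
        using frostman_measureD[OF \<nu>]
        by (intro emeasure_mono) (auto simp: compact_imp_closed borel_closed)
      then show ?thesis by (simp add: frostman_measureD[OF \<nu>])
    next
      case False
      then obtain g0 where g0: "g0 \<in> row_tube A Y J r" "orthogonal_matrix g0" using K by blast
      have "J \<noteq> UNIV" using i by auto
      from C'(2)[OF this r] obtain Z :: "(real^'n) set" where Z: "finite Z"
          "real (card Z) \<le> C' * (1 / r) ^ (CARD('n) - 1 - card J)"
          "\<And>v. norm v = 1 \<Longrightarrow> (\<forall>j\<in>J. \<bar>v $ j\<bar> \<le> 2 * r) \<Longrightarrow> (\<exists>z\<in>Z. norm (v - z) \<le> r)"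
        by blast
      define T where "T z = row_tube A (\<chi> j. if j = i then transpose (A ** g0) *v z else Y $ j) (insert i J) r" for z
      have "row_tube A Y J r \<inter> {g. orthogonal_matrix g} \<subseteq> (\<Union>z\<in>Z. T z)"
        unfolding T_def by (rule row_tube_covering[OF A g0 i Z(3)])
      then have sub: "row_tube A Y J r \<subseteq> - K \<union> (\<Union>z\<in>Z. T z)" using K by blast
      have meas: "T z \<in> sets \<nu>" for z
        unfolding T_def frostman_measureD(2)[OF \<nu>] by (intro borel_closed closed_row_tube)
      have mK: "- K \<in> sets \<nu>"
        unfolding frostman_measureD(2)[OF \<nu>]
        by (intro borel_open open_Compl compact_imp_closed frostman_measureD(1)[OF \<nu>])
      have mU: "(\<Union>z\<in>Z. T z) \<in> sets \<nu>" by (intro sets.finite_UN Z meas)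
      have "emeasure \<nu> (row_tube A Y J r) \<le> emeasure \<nu> (- K \<union> (\<Union>z\<in>Z. T z))"
        by (intro emeasure_mono sub sets.Un mK mU)
      also have "\<dots> \<le> emeasure \<nu> (- K) + emeasure \<nu> (\<Union>z\<in>Z. T z)"
        by (rule emeasure_subadditive[OF mK mU])
      also have "\<dots> = emeasure \<nu> (\<Union>z\<in>Z. T z)" by (simp add: frostman_measureD[OF \<nu>])
      also have "\<dots> \<le> (\<Sum>z\<in>Z. emeasure \<nu> (T z))"
        by (intro emeasure_subadditive_finite Z) (auto simp: meas)
      also have "\<dots> \<le> (\<Sum>z\<in>Z. ennreal (C * r powr (t - ?e (Suc m))))"
        unfolding T_def by (intro sum_mono C A r)
      also have "\<dots> = ennreal (real (card Z) * (C * r powr (t - ?e (Suc m))))"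
        using C by (simp add: ennreal_of_nat_eq_real_of_nat ennreal_mult)
      also have "\<dots> \<le> ennreal (C' * (1 / r) ^ (CARD('n) - 1 - card J) * (C * r powr (t - ?e (Suc m))))"
        using C by (intro ennreal_leI mult_right_mono Z) auto
      also have "(1 / r) ^ (CARD('n) - 1 - card J) = r powr (- (d - 1 - real m))"
      proof -
        have "real (CARD('n) - 1 - card J) = d - 1 - real m"
          using m_less by (simp add: d_def m_def of_nat_diff)
        then have "(1 / r) ^ (CARD('n) - 1 - card J) = (1 / r) powr (d - 1 - real m)"
          using r powr_realpow[of "1 / r" "CARD('n) - 1 - card J"] by simp
        also have "\<dots> = r powr (- (d - 1 - real m))"
          using r by (subst powr_minus_divide) (simp add: powr_divide)
        finally show ?thesis .
      qed
      also have "C' * r powr (- (d - 1 - real m)) * (C * r powr (t - ?e (Suc m)))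
          = C' * C * r powr (- (d - 1 - real m) + (t - ?e (Suc m)))"
        by (simp only: powr_add mult_ac)
      also have "- (d - 1 - real m) + (t - ?e (Suc m)) = t - ?e m"
        by (simp add: field_simps)
      finally show ?thesis by (simp add: d_def m_def)
    qed
  qed
qed

lemma tube_decay_all:
  fixes \<nu> :: "(real^'n^'n) measure"
  assumes \<nu>: "frostman_measure t K \<nu>" and K: "K \<subseteq> {g. orthogonal_matrix g}"
  shows "tube_decay t \<nu> J"
proof -
  \<comment> \<open>The induction starts from all rows being prescribed and frees them one at a
    time; \<open>S\<close> is the set of free rows.\<close>
  have "tube_decay t \<nu> (UNIV - S)" if "finite S" for S :: "'n set"
    using that
  proof (induction S)
    case empty
    then show ?case using tube_decay_UNIV[OF \<nu>] by simp
  next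
    case (insert x S)
    have "insert x (UNIV - insert x S) = UNIV - S" using insert.hyps by auto
    then have "tube_decay t \<nu> (insert x (UNIV - insert x S))" using insert.IH by metis
    then show ?case by (rule tube_decay_step[OF \<nu> K, rotated]) simp
  qed
  from this[of "- J"] show ?thesis by (simp add: Diff_Compl)
qed

text \<open>With no row prescribed the tube is the whole space of mass one, which bounds the
  exponent by the dimension of O(d). It yields the upper bound on the dimension of
  \<open>G\<close>.\<close>

lemma orthogonal_frostman_exponent_le:
  fixes \<nu> :: "(real^'n^'n) measure"
  assumes \<nu>: "frostman_measure t K \<nu>" and K: "K \<subseteq> {g. orthogonal_matrix g}"
  shows "t \<le> real CARD('n) * (real CARD('n) - 1) / 2"
proof (rule ccontr)
  define d where "d = real CARD('n)"
  define p where "p = t - d * (d - 1) / 2"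
  assume "\<not> t \<le> real CARD('n) * (real CARD('n) - 1) / 2"
  then have p: "0 < p" by (simp add: p_def d_def)
  obtain C where C: "0 < C" "\<And>A Y r. orthogonal_matrix A \<Longrightarrow> 0 < r \<Longrightarrow> 4 * real CARD('n) * r \<le> 1 \<Longrightarrow>
     emeasure \<nu> (row_tube A Y {} r) \<le> ennreal (C * r powr p)"
    using tube_decay_all[OF \<nu> K, of "{}"] unfolding tube_decay_def p_def d_def by auto
  \<comment> \<open>The second entry makes \<open>C * r powr p\<close> at most 1/2.\<close>
  define r where "r = min (1 / (4 * d)) ((1 / (2 * C)) powr (1 / p))"
  have d: "0 < d" by (simp add: d_def)
  have r: "0 < r" "4 * d * r \<le> 1"
    using d C p by (auto simp: r_def field_simps min_def)
  have "r powr p \<le> ((1 / (2 * C)) powr (1 / p)) powr p"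
    using r p by (intro powr_mono2) (auto simp: r_def)
  also have "\<dots> = 1 / (2 * C)" using p C by (simp add: powr_powr)
  finally have "C * r powr p \<le> 1 / 2" using C by (simp add: field_simps)
  moreover have "1 \<le> ennreal (C * r powr p)"
    using C(2)[OF orthogonal_matrix_id r(1), of "0"] r frostman_measureD[OF \<nu>]
    by (simp add: row_tube_def d_def)
  ultimately show False by simp
qed

text \<open>This is the case of one prescribed row, in a frame whose row \<open>k\<close> is
  \<open>\<omega>\<close>; the number subtracted is the dimension of O(d - 1). The assumption on
  \<open>t\<close> makes the exponent nonnegative, so radii too large for the tube bound cost only a
  constant.\<close>

lemma orthogonal_frostman_orbit:
  fixes \<nu> :: "(real^'n^'n) measure"
  assumes \<nu>: "frostman_measure t K \<nu>" and K: "K \<subseteq> {g. orthogonal_matrix g}"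
    and t: "(real CARD('n) - 1) * (real CARD('n) - 2) / 2 \<le> t"
  shows "\<exists>C>0. \<forall>\<omega> y r. norm \<omega> = 1 \<longrightarrow> 0 < r \<longrightarrow> emeasure \<nu> {g. norm (\<omega> v* g - y) \<le> r}
    \<le> ennreal (C * r powr (t - (real CARD('n) - 1) * (real CARD('n) - 2) / 2))"
proof -
  fix k :: 'n
  define d where "d = real CARD('n)"
  define p where "p = t - (d - 1) * (d - 2) / 2"
  have d: "0 < d" by (simp add: d_def)
  have p: "0 \<le> p" using t by (simp add: p_def d_def)
  obtain C where C: "0 < C" "\<And>A Y r. orthogonal_matrix A \<Longrightarrow> 0 < r \<Longrightarrow> 4 * real CARD('n) * r \<le> 1 \<Longrightarrow>
     emeasure \<nu> (row_tube A Y {k} r) \<le> ennreal (C * r powr p)"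
    using tube_decay_all[OF \<nu> K, of "{k}"] unfolding tube_decay_def p_def d_def by auto
  \<comment> \<open>The second summand handles radii above 1/(4d), where the mass is at most
    one.\<close>
  define D where "D = C + (4 * d) powr p"
  have D: "0 < D" using C d by (simp add: D_def add_pos_nonneg)
  have "emeasure \<nu> {g. norm (\<omega> v* g - y) \<le> r} \<le> ennreal (D * r powr p)"
    if \<omega>: "norm \<omega> = 1" and r: "0 < r" for \<omega> y r
  proof (cases "4 * real CARD('n) * r \<le> 1")
    case True
    obtain B where B: "orthogonal_matrix B" "B *v axis k 1 = \<omega>"
      using orthogonal_matrix_exists_basis[OF \<omega>] by blast
    have row: "transpose B $ k = \<omega>"
      using B(2) by (simp add: matrix_vector_mul_component vec_eq_iff transpose_def inner_axis)
    have "(transpose B ** g) $ k = \<omega> v* g" for g :: "real^'n^'n"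
      unfolding row[symmetric] by (simp add: vec_eq_iff matrix_matrix_mult_def vector_matrix_mult_def mult.commute)
    then have "{g. norm (\<omega> v* g - y) \<le> r} = row_tube (transpose B) (\<chi> j. y) {k} r"
      by (simp add: row_tube_def)
    also have "emeasure \<nu> \<dots> \<le> ennreal (C * r powr p)"
      by (intro C) (use B True r in \<open>auto simp: orthogonal_matrix_transpose\<close>)
    also have "\<dots> \<le> ennreal (D * r powr p)"
      by (intro ennreal_leI mult_right_mono) (auto simp: D_def)
    finally show ?thesis .
  next
    case False
    have "emeasure \<nu> {g. norm (\<omega> v* g - y) \<le> r} \<le> ennreal 1"
      using frostman_measure_emeasure_le_1[OF \<nu>] by simp
    also have "1 \<le> (4 * d * r) powr p"
      using False p by (intro ge_one_powr_ge_zero) (auto simp: d_def)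
    also have "\<dots> = (4 * d) powr p * r powr p" using d r by (simp add: powr_mult)
    also have "\<dots> \<le> D * r powr p" using C by (intro mult_right_mono) (auto simp: D_def)
    finally show ?thesis by (simp add: ennreal_leI)
  qed
  with D show ?thesis unfolding p_def d_def by blast
qed

section \<open>Fourier transforms of Frostman measures\<close>

definition wave :: "real \<Rightarrow> complex" where
  "wave t = exp (- 2 * of_real pi * \<i> * of_real t)"

lemma wave_iexp: "wave t = iexp (- 2 * pi * t)"
  by (simp add: wave_def mult_ac)

lemma norm_wave [simp]: "norm (wave t) = 1"
  unfolding wave_iexp by (simp only: norm_exp_i_times)

lemma wave_0 [simp]: "wave 0 = 1"
  by (simp add: wave_def)

lemma wave_add: "wave (s + t) = wave s * wave t"
  by (simp add: wave_def distrib_left exp_add[symmetric])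

lemma cnj_wave: "cnj (wave t) = wave (- t)"
  by (simp add: wave_def exp_cnj)

lemma wave_sum: "finite A \<Longrightarrow> wave (\<Sum>i\<in>A. f i) = (\<Prod>i\<in>A. wave (f i))"
  by (induction A rule: finite_induct) (auto simp: wave_add)

lemma borel_measurable_wave [measurable]: "wave \<in> borel_measurable borel"
  unfolding wave_def by measurable

lemma fourier_transform_wave: "fourier_transform \<mu> \<xi> = (\<integral>x. wave (\<xi> \<bullet> x) \<partial>\<mu>)"
  by (simp add: fourier_transform_def wave_def)

section \<open>Gaussians and their Fourier transforms\<close>

lemma gauss_real:
  assumes k: "0 < k"
  shows "has_bochner_integral lborel (\<lambda>z. wave (z * t) * of_real (exp (- pi * k\<^sup>2 * z\<^sup>2)))
    (of_real (exp (- pi * t\<^sup>2 / k\<^sup>2) / k))"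
proof -
  \<comment> \<open>The substitution x = sqrt(2 pi) k z turns the standard normal density into the
    Gaussian, and its characteristic function at this \<open>s\<close> into the wanted
    transform.\<close>
  define s where "s = - 2 * pi * t / (sqrt (2 * pi) * k)"
  have "has_bochner_integral std_normal_distribution (\<lambda>x. iexp (s * x)) (char std_normal_distribution s)"
  proof -
    interpret prob_space std_normal_distribution by (rule prob_space_normal_density) simp
    show ?thesis
      unfolding char_def by (intro has_bochner_integral_integrable integrable_const_bound[where B = 1]) auto
  qed
  then have "has_bochner_integral lborel (\<lambda>x. std_normal_density x *\<^sub>R iexp (s * x))
      (of_real (exp (- s\<^sup>2 / 2)))"
    unfolding char_std_normal_distribution has_bochner_integral_iff
    by (simp add: integrable_density integral_density normal_density_nonneg)
  then have "has_bochner_integral lborel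
      (\<lambda>z. std_normal_density (0 + sqrt (2 * pi) * k * z) *\<^sub>R iexp (s * (0 + sqrt (2 * pi) * k * z)))
      (of_real (exp (- s\<^sup>2 / 2)) /\<^sub>R \<bar>sqrt (2 * pi) * k\<bar>)"
    by (subst (asm) lborel_has_bochner_integral_real_affine_iff[where c = "sqrt (2 * pi) * k" and t = 0])
      (use k in auto)
  from has_bochner_integral_scaleR_right[OF this, of "sqrt (2 * pi)"]
  have "has_bochner_integral lborel
      (\<lambda>z. sqrt (2 * pi) *\<^sub>R (std_normal_density (0 + sqrt (2 * pi) * k * z) *\<^sub>R iexp (s * (0 + sqrt (2 * pi) * k * z))))
      (sqrt (2 * pi) *\<^sub>R (of_real (exp (- s\<^sup>2 / 2)) /\<^sub>R \<bar>sqrt (2 * pi) * k\<bar>))"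
    by simp
  moreover have "(\<lambda>z. sqrt (2 * pi) *\<^sub>R (std_normal_density (0 + sqrt (2 * pi) * k * z) *\<^sub>R iexp (s * (0 + sqrt (2 * pi) * k * z))))
      = (\<lambda>z. wave (z * t) * of_real (exp (- pi * k\<^sup>2 * z\<^sup>2)))"
  proof
    fix z
    have e1: "s * (0 + sqrt (2 * pi) * k * z) = - 2 * pi * (z * t)"
      using k by (simp add: s_def)
    have e2: "sqrt (2 * pi) * std_normal_density (0 + sqrt (2 * pi) * k * z) = exp (- pi * k\<^sup>2 * z\<^sup>2)"
      by (simp add: std_normal_density_def power_mult_distrib)
    show "sqrt (2 * pi) *\<^sub>R (std_normal_density (0 + sqrt (2 * pi) * k * z) *\<^sub>R iexp (s * (0 + sqrt (2 * pi) * k * z)))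
        = wave (z * t) * of_real (exp (- pi * k\<^sup>2 * z\<^sup>2))"
      unfolding scaleR_scaleR e1 e2 wave_iexp by (simp only: scaleR_conv_of_real mult.commute)
  qed
  moreover have "sqrt (2 * pi) *\<^sub>R (of_real (exp (- s\<^sup>2 / 2)) /\<^sub>R \<bar>sqrt (2 * pi) * k\<bar>)
      = (of_real (exp (- pi * t\<^sup>2 / k\<^sup>2) / k) :: complex)"
  proof -
    have e3: "- s\<^sup>2 / 2 = - pi * t\<^sup>2 / k\<^sup>2"
      by (simp add: s_def power_divide power_mult_distrib power2_eq_square)
    have e4: "sqrt (2 * pi) * (inverse \<bar>sqrt (2 * pi) * k\<bar> * e) = e / k" for e
      using k by (simp add: abs_mult divide_inverse)
    show ?thesis unfolding e3 scaleR_conv_of_real of_real_mult[symmetric] e4 ..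
  qed
  ultimately show ?thesis by simp
qed

lemma has_bochner_integral_lborel_prod:
  fixes f :: "'a::euclidean_space \<Rightarrow> real \<Rightarrow> complex"
  assumes f: "\<And>b. b \<in> Basis \<Longrightarrow> has_bochner_integral lborel (f b) (c b)"
  shows "has_bochner_integral lborel (\<lambda>z::'a. \<Prod>b\<in>Basis. f b (z \<bullet> b)) (\<Prod>b\<in>Basis. c b)"
proof -
  interpret product_sigma_finite "\<lambda>_ :: 'a. lborel :: real measure" ..
  let ?P = "\<Pi>\<^sub>M b\<in>(Basis :: 'a set). (lborel :: real measure)"
  let ?h = "\<lambda>x. \<Sum>b\<in>Basis. x b *\<^sub>R (b :: 'a)"
  have int: "integrable lborel (f b)" "integral\<^sup>L lborel (f b) = c b" if "b \<in> Basis" for b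
    using f[OF that] by (auto simp: has_bochner_integral_iff)
  have [measurable]: "f b \<in> borel_measurable borel" if "b \<in> Basis" for b
    using int(1)[OF that] by auto
  have h [measurable]: "?h \<in> measurable ?P borel" by measurable
  have m: "(\<lambda>z::'a. \<Prod>b\<in>Basis. f b (z \<bullet> b)) \<in> borel_measurable borel"
    by (intro borel_measurable_prod) measurable
  have eq: "(\<Prod>b\<in>Basis. f b (?h x \<bullet> b)) = (\<Prod>b\<in>Basis. f b (x b))" for x
    by (intro prod.cong refl arg_cong[where f = "f _"] inner_sum_left_Basis)
  have "integrable ?P (\<lambda>x. \<Prod>b\<in>Basis. f b (x b))"
    by (rule product_integrable_prod) (auto simp: int)
  then have "integrable (distr ?P borel ?h) (\<lambda>z::'a. \<Prod>b\<in>Basis. f b (z \<bullet> b))"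
    by (subst integrable_distr_eq[OF h]) (simp_all only: m eq)
  moreover have "integral\<^sup>L (distr ?P borel ?h) (\<lambda>z::'a. \<Prod>b\<in>Basis. f b (z \<bullet> b)) = (\<Prod>b\<in>Basis. c b)"
  proof -
    have "integral\<^sup>L (distr ?P borel ?h) (\<lambda>z::'a. \<Prod>b\<in>Basis. f b (z \<bullet> b))
        = integral\<^sup>L ?P (\<lambda>x. \<Prod>b\<in>Basis. f b (x b))"
      by (subst integral_distr[OF h m]) (simp only: eq)
    also have "\<dots> = (\<Prod>b\<in>Basis. integral\<^sup>L lborel (f b))"
      by (rule product_integral_prod) (auto simp: int)
    also have "\<dots> = (\<Prod>b\<in>Basis. c b)" by (intro prod.cong) (auto simp: int)
    finally show ?thesis .
  qed
  ultimately show ?thesis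
    unfolding has_bochner_integral_iff lborel_eq[where 'a = 'a, symmetric] by blast
qed

text \<open>The parameter \<open>k\<close> is an inverse width, normalised so that
  \<open>gauss 1\<close> is its own Fourier transform and has integral one.\<close>

definition gauss :: "real \<Rightarrow> 'a::euclidean_space \<Rightarrow> real" where
  "gauss k z = exp (- pi * k\<^sup>2 * (norm z)\<^sup>2)"

lemma gauss_pos [simp]: "0 < gauss k z" and gauss_nonneg [simp]: "0 \<le> gauss k z"
  by (simp_all add: gauss_def)

lemma borel_measurable_gauss [measurable]: "gauss k \<in> borel_measurable borel"
  unfolding gauss_def[abs_def] by measurable

lemma gauss_fourier:
  fixes x :: "'a::euclidean_space"
  assumes k: "0 < k"
  shows "has_bochner_integral lborel (\<lambda>z. wave (z \<bullet> x) * of_real (gauss k z))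
    (of_real (gauss (1 / k) x / k ^ DIM('a)))"
proof -
  have sq: "(norm y)\<^sup>2 = (\<Sum>b\<in>Basis. (y \<bullet> b)\<^sup>2)" for y :: 'a
    by (subst power2_norm_eq_inner, subst euclidean_inner) (simp add: power2_eq_square)
  have "has_bochner_integral lborel (\<lambda>z::'a. \<Prod>b\<in>Basis. wave ((z \<bullet> b) * (x \<bullet> b)) * of_real (exp (- pi * k\<^sup>2 * (z \<bullet> b)\<^sup>2)))
      (\<Prod>b\<in>Basis. of_real (exp (- pi * (x \<bullet> b)\<^sup>2 / k\<^sup>2) / k))"
    by (rule has_bochner_integral_lborel_prod) (rule gauss_real[OF k])
  moreover have "(\<Prod>b\<in>Basis. wave ((z \<bullet> b) * (x \<bullet> b)) * of_real (exp (- pi * k\<^sup>2 * (z \<bullet> b)\<^sup>2)))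
      = wave (z \<bullet> x) * of_real (gauss k z)" for z :: 'a
    unfolding prod.distrib gauss_def sq sum_distrib_left euclidean_inner[of z x] of_real_prod[symmetric]
    by (simp add: wave_sum exp_sum)
  moreover have "(\<Prod>b\<in>(Basis :: 'a set). (of_real (exp (- pi * (x \<bullet> b)\<^sup>2 / k\<^sup>2) / k) :: complex))
      = of_real (gauss (1 / k) x / k ^ DIM('a))"
    unfolding of_real_prod[symmetric] prod_dividef prod_constant gauss_def sq sum_distrib_left
    by (simp add: exp_sum power_divide)
  ultimately show ?thesis by simp
qed

lemma gauss_fourier_shift:
  fixes x y :: "'a::euclidean_space"
  shows "has_bochner_integral lborel (\<lambda>z. wave (z \<bullet> x) * of_real (gauss 1 (z - y)))
    (wave (y \<bullet> x) * of_real (gauss 1 x))"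
proof -
  let ?f = "\<lambda>z. wave ((z - y) \<bullet> x) * of_real (gauss 1 (z - y)) :: complex"
  have "has_bochner_integral (distr lborel borel ((+) y)) ?f (of_real (gauss 1 x))"
    using gauss_fourier[of 1 x] unfolding has_bochner_integral_iff
    by (subst integrable_distr_eq, simp, measurable, subst integral_distr) (simp_all)
  then have "has_bochner_integral lborel ?f (of_real (gauss 1 x))"
    by (simp add: lborel_distr_plus)
  then have "has_bochner_integral lborel (\<lambda>z. wave (y \<bullet> x) * ?f z) (wave (y \<bullet> x) * of_real (gauss 1 x))"
    by (intro has_bochner_integral_mult_right) simp
  moreover have "wave (y \<bullet> x) * ?f z = wave (z \<bullet> x) * of_real (gauss 1 (z - y))" for z
    by (simp add: mult.assoc[symmetric] wave_add[symmetric] inner_diff_left)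
  ultimately show ?thesis by simp
qed

lemma nn_integral_gauss_shift:
  fixes y :: "'a::euclidean_space"
  shows "(\<integral>\<^sup>+z. ennreal (gauss 1 (z - y)) \<partial>lborel) = 1"
proof -
  have "has_bochner_integral lborel (\<lambda>z. of_real (gauss 1 (z - y)) :: complex) 1"
    using gauss_fourier_shift[of 0 y] by (simp add: gauss_def)
  from has_bochner_integral_Re[OF this]
  have "has_bochner_integral lborel (\<lambda>z. gauss 1 (z - y)) 1" by simp
  then show ?thesis
    by (subst nn_integral_eq_integral) (auto simp: has_bochner_integral_iff)
qed

lemma nn_integral_gauss_finite:
  assumes "0 < k"
  shows "(\<integral>\<^sup>+z. ennreal (gauss k z) \<partial>(lborel :: 'a::euclidean_space measure)) < \<infinity>"
proof -
  have "has_bochner_integral lborel (\<lambda>z :: 'a. of_real (gauss k z) :: complex) (of_real (gauss (1 / k) (0 :: 'a) / k ^ DIM('a)))"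
    using gauss_fourier[OF assms, of 0] by simp
  from has_bochner_integral_Re[OF this]
  have "integrable lborel (\<lambda>z :: 'a. gauss k z)" by (simp add: has_bochner_integral_iff)
  then show ?thesis by (simp add: integrable_iff_bounded)
qed

section \<open>Energies with Gaussian weights\<close>

lemma borel_measurable_fourier_transform [measurable]:
  fixes \<mu> :: "'a::euclidean_space measure"
  assumes "finite_measure \<mu>" and [measurable_cong]: "sets \<mu> = sets borel"
  shows "fourier_transform \<mu> \<in> borel_measurable borel"
proof -
  interpret finite_measure \<mu> by fact
  have "(\<lambda>\<xi>. \<integral>x. wave (\<xi> \<bullet> x) \<partial>\<mu>) \<in> borel_measurable borel"
    by (rule borel_measurable_lebesgue_integral) measurable
  then show ?thesis by (simp add: fourier_transform_wave[abs_def])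
qed

lemma norm_fourier_transform_le:
  fixes \<mu> :: "'a::euclidean_space measure"
  assumes "finite_measure \<mu>" and "sets \<mu> = sets borel"
  shows "norm (fourier_transform \<mu> \<xi>) \<le> measure \<mu> UNIV"
proof -
  interpret finite_measure \<mu> by fact
  have "norm (fourier_transform \<mu> \<xi>) \<le> (\<integral>x. norm (wave (\<xi> \<bullet> x)) \<partial>\<mu>)"
    unfolding fourier_transform_wave by (rule integral_norm_bound)
  then show ?thesis using sets_eq_imp_space_eq[OF assms(2)] by simp
qed

text \<open>The square of the transform is the double integral of
  \<open>wave (z \<bullet> (x - y))\<close>; the Gaussian makes everything absolutely integrable,
  and integrating over \<open>z\<close> first gives the right side. It is used in both directions,
  to bound energies by ball conditions and conversely.\<close>

lemma gauss_energy_identity: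
  fixes \<mu> :: "'a::euclidean_space measure"
  assumes fin: "finite_measure \<mu>" and sets [measurable_cong]: "sets \<mu> = sets borel" and k: "0 < k"
  shows "(\<integral>\<^sup>+z. ennreal ((cmod (fourier_transform \<mu> z))\<^sup>2 * gauss k z) \<partial>lborel)
    = (\<integral>\<^sup>+x. \<integral>\<^sup>+y. ennreal (gauss (1 / k) (x - y) / k ^ DIM('a)) \<partial>\<mu> \<partial>\<mu>)"
proof -
  interpret finite_measure \<mu> by fact
  interpret pp: pair_sigma_finite \<mu> \<mu> ..
  let ?M = "\<mu> \<Otimes>\<^sub>M \<mu>"
  interpret M: finite_measure ?M by (rule finite_measure_pair_measure) fact+
  have sfM: "sigma_finite_measure ?M" by unfold_locales
  interpret LM: pair_sigma_finite lborel ?M ..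
  let ?g = "\<lambda>z p. wave (z \<bullet> (fst p - snd p)) * of_real (gauss k z) :: complex"
  have sq: "of_real ((cmod (fourier_transform \<mu> z))\<^sup>2) = (\<integral>p. wave (z \<bullet> (fst p - snd p)) \<partial>?M)" for z
  proof -
    have int: "integrable ?M (\<lambda>(x, y). wave (z \<bullet> (x - y)))"
      by (rule M.integrable_const_bound[where B = 1]) (auto split: prod.split)
    have "of_real ((cmod (fourier_transform \<mu> z))\<^sup>2) = fourier_transform \<mu> z * cnj (fourier_transform \<mu> z)"
      by (rule complex_norm_square)
    also have "\<dots> = (\<integral>x. wave (z \<bullet> x) * (\<integral>y. cnj (wave (z \<bullet> y)) \<partial>\<mu>) \<partial>\<mu>)"
      unfolding fourier_transform_wave
      by (simp only: Bochner_Integration.integral_mult_left_zero Bochner_Integration.integral_cnj)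
    also have "\<dots> = (\<integral>x. (\<integral>y. wave (z \<bullet> (x - y)) \<partial>\<mu>) \<partial>\<mu>)"
    proof (intro Bochner_Integration.integral_cong refl)
      fix x
      have "wave (z \<bullet> (x - y)) = wave (z \<bullet> x) * cnj (wave (z \<bullet> y))" for y
        unfolding cnj_wave wave_add[symmetric] by (simp add: inner_diff_right)
      then show "wave (z \<bullet> x) * (\<integral>y. cnj (wave (z \<bullet> y)) \<partial>\<mu>) = (\<integral>y. wave (z \<bullet> (x - y)) \<partial>\<mu>)"
        by (simp add: integral_cnj)
    qed
    also have "\<dots> = (\<integral>p. wave (z \<bullet> (fst p - snd p)) \<partial>?M)"
      using pp.integral_fst'[OF int[unfolded case_prod_beta]] by simp
    finally show ?thesis .
  qed
  have int_g: "integrable (lborel \<Otimes>\<^sub>M ?M) (case_prod ?g)"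
  proof (rule integrableI_bounded)
    show "case_prod ?g \<in> borel_measurable (lborel \<Otimes>\<^sub>M ?M)" by measurable
    have "(\<integral>\<^sup>+x. ennreal (norm (case_prod ?g x)) \<partial>(lborel \<Otimes>\<^sub>M ?M))
        = (\<integral>\<^sup>+z. \<integral>\<^sup>+p. ennreal (gauss k z) \<partial>?M \<partial>(lborel :: 'a measure))"
      by (subst sigma_finite_measure.nn_integral_fst[OF sfM, symmetric]) (auto simp: norm_mult case_prod_beta)
    also have "\<dots> = (\<integral>\<^sup>+z. ennreal (gauss k z) \<partial>(lborel :: 'a measure)) * emeasure ?M (space ?M)"
      by (simp add: nn_integral_multc)
    also have "\<dots> < \<infinity>"
      using nn_integral_gauss_finite[OF k, where 'a = 'a] M.emeasure_finite[of "space ?M"]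
      by (simp add: ennreal_mult_eq_top_iff less_top[symmetric])
    finally show "(\<integral>\<^sup>+x. ennreal (norm (case_prod ?g x)) \<partial>(lborel \<Otimes>\<^sub>M ?M)) < \<infinity>" .
  qed
  have inner_z: "(\<integral>z. ?g z p \<partial>lborel) = of_real (gauss (1 / k) (fst p - snd p) / k ^ DIM('a))" for p :: "'a \<times> 'a"
    by (rule has_bochner_integral_integral_eq[OF gauss_fourier[OF k]])
  have inner_p: "(\<integral>p. ?g z p \<partial>?M) = of_real ((cmod (fourier_transform \<mu> z))\<^sup>2 * gauss k z)" for z
    by (simp only: Bochner_Integration.integral_mult_left_zero sq[symmetric] of_real_mult)
  have int1: "integrable lborel (\<lambda>z. of_real ((cmod (fourier_transform \<mu> z))\<^sup>2 * gauss k z) :: complex)"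
    using LM.integrable_fst'[OF int_g] by (simp only: inner_p prod.case)
  have int2: "integrable ?M (\<lambda>p. of_real (gauss (1 / k) (fst p - snd p) / k ^ DIM('a)) :: complex)"
    using LM.integrable_snd[OF int_g] by (simp only: inner_z prod.case)
  have "(\<integral>z. of_real ((cmod (fourier_transform \<mu> z))\<^sup>2 * gauss k z) \<partial>lborel)
      = (\<integral>p. of_real (gauss (1 / k) (fst p - snd p) / k ^ DIM('a)) \<partial>?M :: complex)"
    using LM.Fubini_integral[OF int_g] by (simp only: inner_z inner_p)
  then have eq: "(\<integral>z. (cmod (fourier_transform \<mu> z))\<^sup>2 * gauss k z \<partial>lborel)
      = (\<integral>p. gauss (1 / k) (fst p - snd p) / k ^ DIM('a) \<partial>?M)"
    by (simp only: integral_complex_of_real of_real_eq_iff)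
  have int1': "integrable lborel (\<lambda>z. (cmod (fourier_transform \<mu> z))\<^sup>2 * gauss k z)"
    using integrable_Re[OF int1] by simp
  have int2': "integrable ?M (\<lambda>p. gauss (1 / k) (fst p - snd p) / k ^ DIM('a))"
    using integrable_Re[OF int2] by simp
  have "(\<integral>\<^sup>+z. ennreal ((cmod (fourier_transform \<mu> z))\<^sup>2 * gauss k z) \<partial>lborel)
      = (\<integral>\<^sup>+p. ennreal (gauss (1 / k) (fst p - snd p) / k ^ DIM('a)) \<partial>?M)"
    using k by (subst (1 2) nn_integral_eq_integral) (auto simp: int1' int2' eq)
  also have "\<dots> = (\<integral>\<^sup>+x. \<integral>\<^sup>+y. ennreal (gauss (1 / k) (x - y) / k ^ DIM('a)) \<partial>\<mu> \<partial>\<mu>)"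
    by (subst nn_integral_fst[symmetric]) auto
  finally show ?thesis .
qed

text \<open>The constant left over when a Gaussian is cut into shells of width \<open>1 / k\<close>,
  with a ball bound of exponent \<open>b\<close> on each.\<close>

definition layer_const :: "real \<Rightarrow> real" where
  "layer_const b = (\<Sum>j. exp (- pi * (real j)\<^sup>2) * (real j + 1) powr b)"

lemma summable_layer: "summable (\<lambda>j. exp (- pi * (real j)\<^sup>2) * (real j + 1) powr b)"
proof (rule summable_comparison_test_bigo)
  show "summable (\<lambda>j. norm (1 / real j ^ 2))"
    using inverse_power_summable[of 2, where 'a = real] by (simp add: divide_inverse)
  show "(\<lambda>j. exp (- pi * (real j)\<^sup>2) * (real j + 1) powr b) \<in> O(\<lambda>j. 1 / real j ^ 2)"
    by real_asymp
qed

lemma layer_const_nonneg: "0 \<le> layer_const b"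
  unfolding layer_const_def by (intro suminf_nonneg summable_layer) simp

text \<open>On the shell where k times the distance lies between \<open>j\<close> and
  \<open>j + 1\<close> the Gaussian is at most exp(-pi j^2), and the shell lies in a ball of radius
  (j + 1)/k.\<close>

lemma nn_integral_gauss_le:
  fixes Y :: "'b \<Rightarrow> 'a::euclidean_space"
  assumes Y [measurable]: "Y \<in> borel_measurable P" and C: "0 \<le> C" and k: "0 < k"
    and bound: "\<And>\<delta>. 0 < \<delta> \<Longrightarrow> emeasure P {\<omega>\<in>space P. norm (Y \<omega> - z) \<le> \<delta>} \<le> ennreal (C * \<delta> powr b)"
  shows "(\<integral>\<^sup>+\<omega>. ennreal (gauss k (Y \<omega> - z)) \<partial>P) \<le> ennreal (C * layer_const b * k powr (- b))"
proof -
  let ?e = "\<lambda>j. exp (- pi * (real j)\<^sup>2)"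
  let ?S = "\<lambda>j. {\<omega>\<in>space P. norm (Y \<omega> - z) \<le> (real j + 1) / k}"
  have "ennreal (gauss k (Y \<omega> - z)) \<le> (\<Sum>j. ennreal (?e j) * indicator (?S j) \<omega>)" if \<omega>: "\<omega> \<in> space P" for \<omega>
  proof -
    define w where "w = norm (Y \<omega> - z)"
    define j where "j = nat \<lfloor>k * w\<rfloor>"
    have w: "0 \<le> k * w" using k by (simp add: w_def)
    then have j: "real j \<le> k * w" "k * w < real j + 1" by (simp_all add: j_def) 
    have "\<omega> \<in> ?S j" using j(2) k \<omega> by (simp add: w_def pos_le_divide_eq mult.commute)
    have "(real j)\<^sup>2 \<le> k\<^sup>2 * w\<^sup>2"
      using power_mono[OF j(1), of 2] by (simp add: power_mult_distrib)
    then have "gauss k (Y \<omega> - z) \<le> ?e j" by (simp add: gauss_def w_def)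
    then have "ennreal (gauss k (Y \<omega> - z)) \<le> ennreal (?e j) * indicator (?S j) \<omega>"
      using \<open>\<omega> \<in> ?S j\<close> by (simp add: ennreal_leI)
    also define f where "f = (\<lambda>j. ennreal (?e j) * indicator (?S j) \<omega>)"
    then have "ennreal (?e j) * indicator (?S j) \<omega> = f j" by simp
    also have "f j \<le> suminf f" using sum_le_suminf[of f "{j}"] by simp
    finally show ?thesis by (simp only: f_def)
  qed
  then have "(\<integral>\<^sup>+\<omega>. ennreal (gauss k (Y \<omega> - z)) \<partial>P)
      \<le> (\<integral>\<^sup>+\<omega>. (\<Sum>j. ennreal (?e j) * indicator (?S j) \<omega>) \<partial>P)"
    by (rule nn_integral_mono)
  also have "\<dots> = (\<Sum>j. \<integral>\<^sup>+\<omega>. ennreal (?e j) * indicator (?S j) \<omega> \<partial>P)"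
    by (rule nn_integral_suminf) measurable
  also have "\<dots> = (\<Sum>j. ennreal (?e j) * emeasure P (?S j))"
    by (intro suminf_cong nn_integral_cmult_indicator) measurable
  also have "\<dots> \<le> (\<Sum>j. ennreal (C * k powr (- b) * (?e j * (real j + 1) powr b)))"
  proof (intro suminf_le allI)
    fix j
    have "emeasure P (?S j) \<le> ennreal (C * ((real j + 1) / k) powr b)"
      using k by (intro bound) simp
    also have "C * ((real j + 1) / k) powr b = C * k powr (- b) * (real j + 1) powr b"
      using k by (simp add: powr_divide powr_minus_divide)
    finally have "ennreal (?e j) * emeasure P (?S j) \<le> ennreal (?e j) * ennreal (C * k powr (- b) * (real j + 1) powr b)"
      by (rule mult_left_mono) simp
    also have "\<dots> = ennreal (C * k powr (- b) * (?e j * (real j + 1) powr b))"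
      using C by (subst ennreal_mult[symmetric]) (auto simp: mult_ac)
    finally show "ennreal (?e j) * emeasure P (?S j) \<le> ennreal (C * k powr (- b) * (?e j * (real j + 1) powr b))" .
  qed auto
  also have "\<dots> = ennreal (\<Sum>j. C * k powr (- b) * (?e j * (real j + 1) powr b))"
    using C by (intro suminf_ennreal2 summable_mult summable_layer) auto
  also have "(\<Sum>j. C * k powr (- b) * (?e j * (real j + 1) powr b)) = C * k powr (- b) * layer_const b"
    unfolding layer_const_def by (rule suminf_mult[OF summable_layer])
  finally show ?thesis by (simp add: mult_ac)
qed

text \<open>The double integral sees a Gaussian of width about \<open>k\<close>, of mass about
  \<open>k powr s\<close> by the ball condition, divided by \<open>k ^ DIM('a)\<close>. For
  \<open>k = 1 / R\<close> this is the growth of the energy up to frequency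
  \<open>R\<close>.\<close>

lemma fourier_energy_le:
  fixes \<mu> :: "'a::euclidean_space measure"
  assumes fin: "finite_measure \<mu>" and sets [measurable_cong]: "sets \<mu> = sets borel" and C: "0 \<le> C"
    and bound: "\<And>x r. 0 < r \<Longrightarrow> emeasure \<mu> (cball x r) \<le> ennreal (C * r powr s)" and k: "0 < k"
  shows "(\<integral>\<^sup>+z. ennreal ((cmod (fourier_transform \<mu> z))\<^sup>2 * gauss k z) \<partial>lborel)
    \<le> ennreal (C * layer_const s * measure \<mu> UNIV * k powr (s - real DIM('a)))"
proof -
  interpret finite_measure \<mu> by fact
  have sp: "space \<mu> = UNIV" using sets_eq_imp_space_eq[OF sets] by simp
  have "(\<integral>\<^sup>+z. ennreal ((cmod (fourier_transform \<mu> z))\<^sup>2 * gauss k z) \<partial>lborel)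
      = (\<integral>\<^sup>+x. \<integral>\<^sup>+y. ennreal (gauss (1 / k) (x - y) / k ^ DIM('a)) \<partial>\<mu> \<partial>\<mu>)"
    by (rule gauss_energy_identity[OF fin sets k])
  also have "\<dots> \<le> (\<integral>\<^sup>+x. ennreal (C * layer_const s * k powr (s - real DIM('a))) \<partial>\<mu>)"
  proof (rule nn_integral_mono)
    fix x
    have "(\<integral>\<^sup>+y. ennreal (gauss (1 / k) (x - y) / k ^ DIM('a)) \<partial>\<mu>)
        = (\<integral>\<^sup>+y. ennreal (1 / k ^ DIM('a)) * ennreal (gauss (1 / k) (y - x)) \<partial>\<mu>)"
      using k by (intro nn_integral_cong) (simp add: ennreal_mult'[symmetric] gauss_def norm_minus_commute)
    also have "\<dots> = ennreal (1 / k ^ DIM('a)) * (\<integral>\<^sup>+y. ennreal (gauss (1 / k) (y - x)) \<partial>\<mu>)"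
      by (rule nn_integral_cmult) measurable
    also have "\<dots> \<le> ennreal (1 / k ^ DIM('a)) * ennreal (C * layer_const s * (1 / k) powr (- s))"
    proof (intro mult_left_mono nn_integral_gauss_le C)
      fix \<delta> :: real assume "0 < \<delta>"
      have "{y \<in> space \<mu>. norm (y - x) \<le> \<delta>} = cball x \<delta>"
        by (auto simp: sp dist_norm norm_minus_commute)
      then show "emeasure \<mu> {y \<in> space \<mu>. norm (y - x) \<le> \<delta>} \<le> ennreal (C * \<delta> powr s)"
        using bound[OF \<open>0 < \<delta>\<close>] by simp
    qed (use k in auto)
    also have "\<dots> = ennreal (1 / k ^ DIM('a) * (C * layer_const s * (1 / k) powr (- s)))"
      using C k layer_const_nonneg by (subst ennreal_mult[symmetric]) auto
    also have "1 / k ^ DIM('a) * (C * layer_const s * (1 / k) powr (- s)) = C * layer_const s * k powr (s - real DIM('a))"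
      using k by (simp add: powr_diff powr_realpow powr_minus powr_divide inverse_eq_divide)
    finally show "(\<integral>\<^sup>+y. ennreal (gauss (1 / k) (x - y) / k ^ DIM('a)) \<partial>\<mu>)
        \<le> ennreal (C * layer_const s * k powr (s - real DIM('a)))" .
  qed
  also have "\<dots> = ennreal (C * layer_const s * k powr (s - real DIM('a))) * emeasure \<mu> UNIV"
    by (simp add: sp)
  also have "\<dots> = ennreal (C * layer_const s * measure \<mu> UNIV * k powr (s - real DIM('a)))"
    using C layer_const_nonneg by (simp add: emeasure_eq_measure ennreal_mult[symmetric] mult_ac)
  finally show ?thesis .
qed

section \<open>Local constancy of transforms of compactly supported measures\<close>

definition gauss_tilt :: "real \<Rightarrow> 'a::euclidean_space measure \<Rightarrow> 'a measure" where
  "gauss_tilt M \<alpha> = density \<alpha> (\<lambda>x. ennreal (indicator (cball 0 M) x * exp (pi * (norm x)\<^sup>2)))"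

text \<open>The cut-off to the ball keeps the growing weight bounded, so the tilted measure inherits
  finiteness and ball bounds.\<close>

lemma gauss_tilt_weight_le:
  "indicator (cball 0 M) x * exp (pi * (norm x)\<^sup>2) \<le> exp (pi * M\<^sup>2)"
proof (cases "x \<in> cball 0 M")
  case True
  then have "(norm x)\<^sup>2 \<le> M\<^sup>2" by (intro power_mono) auto
  then show ?thesis using True by simp
qed simp

lemma borel_measurable_gauss_tilt_weight [measurable]:
  "(\<lambda>x :: 'a::euclidean_space. indicator (cball 0 M) x * exp (pi * (norm x)\<^sup>2) :: real) \<in> borel_measurable borel"
  by (intro borel_measurable_times borel_measurable_indicator) simp_all

lemma sets_gauss_tilt: "sets (gauss_tilt M \<alpha>) = sets \<alpha>"
  by (simp add: gauss_tilt_def)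

lemma emeasure_gauss_tilt_le:
  fixes \<alpha> :: "'a::euclidean_space measure"
  assumes sets [measurable_cong]: "sets \<alpha> = sets borel" and B [measurable]: "B \<in> sets borel"
  shows "emeasure (gauss_tilt M \<alpha>) B \<le> ennreal (exp (pi * M\<^sup>2)) * emeasure \<alpha> B"
proof -
  have bm: "borel_measurable \<alpha> = (borel_measurable borel :: ('a \<Rightarrow> ennreal) set)"
    using sets by (rule measurable_cong_sets) simp
  have "(\<lambda>x. ennreal (indicator (cball 0 M) x * exp (pi * (norm x)\<^sup>2))) \<in> borel_measurable \<alpha>"
    unfolding bm by measurable
  then have "emeasure (gauss_tilt M \<alpha>) B
      = (\<integral>\<^sup>+x. ennreal (indicator (cball 0 M) x * exp (pi * (norm x)\<^sup>2)) * indicator B x \<partial>\<alpha>)"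
    unfolding gauss_tilt_def by (rule emeasure_density) (simp add: sets B)
  also have "\<dots> \<le> (\<integral>\<^sup>+x. ennreal (exp (pi * M\<^sup>2)) * indicator B x \<partial>\<alpha>)"
    by (intro nn_integral_mono mult_right_mono ennreal_leI gauss_tilt_weight_le) simp
  also have "\<dots> = ennreal (exp (pi * M\<^sup>2)) * emeasure \<alpha> B"
    by (rule nn_integral_cmult_indicator) (simp add: sets)
  finally show ?thesis .
qed

lemma finite_measure_gauss_tilt:
  fixes \<alpha> :: "'a::euclidean_space measure"
  assumes "finite_measure \<alpha>" and sets: "sets \<alpha> = sets borel"
  shows "finite_measure (gauss_tilt M \<alpha>)"
proof
  interpret finite_measure \<alpha> by fact
  have "emeasure (gauss_tilt M \<alpha>) UNIV \<le> ennreal (exp (pi * M\<^sup>2)) * emeasure \<alpha> UNIV"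
    by (rule emeasure_gauss_tilt_le[OF sets]) simp
  moreover have "ennreal (exp (pi * M\<^sup>2)) * emeasure \<alpha> UNIV \<noteq> \<top>"
    by (simp add: ennreal_mult_eq_top_iff)
  ultimately have "emeasure (gauss_tilt M \<alpha>) UNIV \<noteq> \<infinity>"
    by (auto simp: top_unique)
  moreover have "space (gauss_tilt M \<alpha>) = UNIV"
    using sets_eq_imp_space_eq[of "gauss_tilt M \<alpha>" borel] sets by (simp add: sets_gauss_tilt)
  ultimately show "emeasure (gauss_tilt M \<alpha>) (space (gauss_tilt M \<alpha>)) \<noteq> \<infinity>" by simp
qed

text \<open>
  Multiplying a measure by a Gaussian convolves its Fourier transform with a Gaussian; the
  tilt undoes this multiplication on the support.
\<close>

lemma fourier_transform_gauss_tilt: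
  fixes \<alpha> :: "'a::euclidean_space measure"
  assumes fin: "finite_measure \<alpha>" and sets [measurable_cong]: "sets \<alpha> = sets borel"
    and supp: "emeasure \<alpha> (- cball 0 M) = 0"
  shows "fourier_transform \<alpha> \<eta>
    = (\<integral>z. fourier_transform (gauss_tilt M \<alpha>) z * of_real (gauss 1 (z - \<eta>)) \<partial>lborel)"
proof -
  let ?T = "gauss_tilt M \<alpha>"
  let ?w = "\<lambda>x. indicator (cball 0 M) x * exp (pi * (norm x)\<^sup>2) :: real"
  have wm: "?w \<in> borel_measurable \<alpha>"
    using borel_measurable_gauss_tilt_weight measurable_cong_sets[OF sets refl, of borel] by blast
  interpret T: finite_measure ?T by (rule finite_measure_gauss_tilt[OF fin sets])
  have setsT [measurable_cong]: "sets ?T = sets borel" by (simp add: sets_gauss_tilt sets)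
  interpret LT: pair_sigma_finite lborel ?T ..
  let ?g = "\<lambda>z x. wave (z \<bullet> x) * of_real (gauss 1 (z - \<eta>)) :: complex"
  have int_g: "integrable (lborel \<Otimes>\<^sub>M ?T) (case_prod ?g)"
  proof (rule integrableI_bounded)
    show "case_prod ?g \<in> borel_measurable (lborel \<Otimes>\<^sub>M ?T)" by measurable
    have "(\<integral>\<^sup>+x. ennreal (norm (case_prod ?g x)) \<partial>(lborel \<Otimes>\<^sub>M ?T))
        = (\<integral>\<^sup>+z. \<integral>\<^sup>+x. ennreal (gauss 1 (z - \<eta>)) \<partial>?T \<partial>(lborel :: 'a measure))"
      by (subst T.nn_integral_fst[symmetric]) (auto simp: norm_mult case_prod_beta)
    also have "\<dots> = (\<integral>\<^sup>+z. ennreal (gauss 1 (z - \<eta>)) \<partial>(lborel :: 'a measure)) * emeasure ?T (space ?T)"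
      by (simp add: nn_integral_multc)
    also have "\<dots> < \<infinity>"
      unfolding nn_integral_gauss_shift using T.emeasure_finite[of "space ?T"]
      by (simp add: less_top[symmetric])
    finally show "(\<integral>\<^sup>+x. ennreal (norm (case_prod ?g x)) \<partial>(lborel \<Otimes>\<^sub>M ?T)) < \<infinity>" .
  qed
  have "(\<integral>z. fourier_transform ?T z * of_real (gauss 1 (z - \<eta>)) \<partial>lborel) = (\<integral>z. (\<integral>x. ?g z x \<partial>?T) \<partial>lborel)"
    unfolding fourier_transform_wave by (simp only: Bochner_Integration.integral_mult_left_zero)
  also have "\<dots> = (\<integral>x. (\<integral>z. ?g z x \<partial>lborel) \<partial>?T)"
    by (rule LT.Fubini_integral[OF int_g, symmetric])
  also have "\<dots> = (\<integral>x. wave (\<eta> \<bullet> x) * of_real (gauss 1 x) \<partial>?T)"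
    by (simp only: has_bochner_integral_integral_eq[OF gauss_fourier_shift])
  also have "\<dots> = (\<integral>x. ?w x *\<^sub>R (wave (\<eta> \<bullet> x) * of_real (gauss 1 x)) \<partial>\<alpha>)"
    unfolding gauss_tilt_def
  proof (rule integral_density)
    show "(\<lambda>x. wave (\<eta> \<bullet> x) * of_real (gauss 1 x)) \<in> borel_measurable \<alpha>" by measurable
    show "?w \<in> borel_measurable \<alpha>" by (rule wm)
    show "AE x in \<alpha>. 0 \<le> ?w x" by simp
  qed
  also have "\<dots> = (\<integral>x. wave (\<eta> \<bullet> x) \<partial>\<alpha>)"
  proof (rule integral_cong_AE)
    have "AE x in \<alpha>. x \<in> cball 0 M"
      by (rule AE_I[of _ _ "- cball 0 M"]) (use supp sets in auto)
    then show "AE x in \<alpha>. ?w x *\<^sub>R (wave (\<eta> \<bullet> x) * of_real (gauss 1 x)) = wave (\<eta> \<bullet> x)"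
    proof eventually_elim
      fix x :: 'a assume x: "x \<in> cball 0 M"
      have "?w x * gauss 1 x = 1" using x by (simp add: gauss_def exp_add[symmetric])
      then have "of_real (?w x) * of_real (gauss 1 x) = (1 :: complex)"
        by (metis of_real_1 of_real_mult)
      then show "?w x *\<^sub>R (wave (\<eta> \<bullet> x) * of_real (gauss 1 x)) = wave (\<eta> \<bullet> x)"
        by (simp add: scaleR_conv_of_real mult.left_commute[of _ "wave _"])
    qed
    show "(\<lambda>x. ?w x *\<^sub>R (wave (\<eta> \<bullet> x) * of_real (gauss 1 x))) \<in> borel_measurable \<alpha>"
      by (intro borel_measurable_scaleR wm) measurable
    show "(\<lambda>x. wave (\<eta> \<bullet> x)) \<in> borel_measurable \<alpha>" by measurable
  qed
  finally show ?thesis by (simp add: fourier_transform_wave)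
qed

text \<open>This makes precise that the transform is essentially constant at scale one: it is a
  Gaussian average of the transform of the tilted measure, and Cauchy-Schwarz against a Gaussian of
  mass one gives the bound for squares.\<close>

lemma fourier_transform_sq_le:
  fixes \<alpha> :: "'a::euclidean_space measure"
  assumes fin: "finite_measure \<alpha>" and sets [measurable_cong]: "sets \<alpha> = sets borel"
    and supp: "emeasure \<alpha> (- cball 0 M) = 0"
  shows "ennreal ((cmod (fourier_transform \<alpha> \<eta>))\<^sup>2)
    \<le> (\<integral>\<^sup>+z. ennreal ((cmod (fourier_transform (gauss_tilt M \<alpha>) z))\<^sup>2) * ennreal (gauss 1 (z - \<eta>)) \<partial>lborel)"
proof -
  let ?T = "gauss_tilt M \<alpha>"
  let ?F = "\<lambda>z. cmod (fourier_transform ?T z)" and ?G = "\<lambda>z. sqrt (gauss 1 (z - \<eta>))"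
  have finT: "finite_measure ?T" by (rule finite_measure_gauss_tilt[OF fin sets])
  have setsT: "sets ?T = sets borel" by (simp add: sets_gauss_tilt sets)
  note [measurable] = borel_measurable_fourier_transform[OF finT setsT]
  have G2: "?G z * ?G z = gauss 1 (z - \<eta>)" for z by simp
  have "ennreal (cmod (fourier_transform \<alpha> \<eta>))
      \<le> (\<integral>\<^sup>+z. ennreal (norm (fourier_transform ?T z * of_real (gauss 1 (z - \<eta>)))) \<partial>lborel)"
  proof (cases "integrable lborel (\<lambda>z. fourier_transform ?T z * of_real (gauss 1 (z - \<eta>)))")
    case True
    then show ?thesis
      unfolding fourier_transform_gauss_tilt[OF fin sets supp, of \<eta>]
      by (rule integral_norm_bound_ennreal)
  next
    \<comment> \<open>The Bochner integral is then 0 by convention and the bound is trivial.\<close>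
    case False
    then show ?thesis
      unfolding fourier_transform_gauss_tilt[OF fin sets supp, of \<eta>]
      by (simp add: not_integrable_integral_eq)
  qed
  also have "\<dots> = (\<integral>\<^sup>+z. ennreal (?F z * ?G z) * ennreal (?G z) \<partial>lborel)"
    by (intro nn_integral_cong) (simp add: norm_mult ennreal_mult'[symmetric] mult.assoc)
  finally have "(ennreal (cmod (fourier_transform \<alpha> \<eta>)))\<^sup>2
      \<le> (\<integral>\<^sup>+z. ennreal (?F z * ?G z) * ennreal (?G z) \<partial>lborel)\<^sup>2"
    by (rule power_mono) simp
  also have "\<dots> \<le> (\<integral>\<^sup>+z. (ennreal (?F z * ?G z))\<^sup>2 \<partial>lborel) * (\<integral>\<^sup>+z. (ennreal (?G z))\<^sup>2 \<partial>lborel)"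
    by (rule Cauchy_Schwarz_nn_integral) measurable
  also have "(\<integral>\<^sup>+z. (ennreal (?G z))\<^sup>2 \<partial>lborel) = (\<integral>\<^sup>+z. ennreal (gauss 1 (z - \<eta>)) \<partial>lborel)"
    by (intro nn_integral_cong) (simp add: ennreal_power)
  also have "\<dots> = 1" by (rule nn_integral_gauss_shift)
  also have "(\<integral>\<^sup>+z. (ennreal (?F z * ?G z))\<^sup>2 \<partial>lborel) = (\<integral>\<^sup>+z. ennreal ((?F z)\<^sup>2) * ennreal (gauss 1 (z - \<eta>)) \<partial>lborel)"
    by (intro nn_integral_cong) (simp add: ennreal_power ennreal_mult'[symmetric] power_mult_distrib)
  finally show ?thesis by (simp add: ennreal_power)
qed

text \<open>Since |z|^2 \<le> 2|y|^2 + 2|y - z|^2, half of the Gaussian decay in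
  \<open>y - z\<close> pays for localising \<open>z\<close> at scale \<open>R\<close>. The other
  half is kept for averaging over \<open>y\<close>.\<close>

lemma gauss_split_le:
  fixes y z :: "'a::euclidean_space"
  assumes y: "norm y \<le> L * R" and R: "1 \<le> R"
  shows "gauss 1 (z - y) \<le> exp (pi * L\<^sup>2 / 2) * gauss (1 / sqrt 2) (y - z) * gauss (1 / (2 * R)) z"
proof -
  define D where "D = (norm (y - z))\<^sup>2"
  have "norm z \<le> norm y + norm (y - z)" by (metis norm_minus_commute norm_triangle_sub)
  then have "(norm z)\<^sup>2 \<le> (norm y + norm (y - z))\<^sup>2" by (intro power_mono) auto
  also have "\<dots> \<le> 2 * (norm y)\<^sup>2 + 2 * D"
    using sum_squares_bound[of "norm y" "norm (y - z)"] by (simp add: D_def power2_sum)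
  also have "(norm y)\<^sup>2 \<le> (L * R)\<^sup>2" using y by (intro power_mono) auto
  finally have "(norm z)\<^sup>2 / (4 * R\<^sup>2) \<le> (2 * (L * R)\<^sup>2 + 2 * D) / (4 * R\<^sup>2)"
    using R by (intro divide_right_mono) auto
  also have "\<dots> = L\<^sup>2 / 2 + D / (2 * R\<^sup>2)" using R by (simp add: field_simps)
  also have "D / (2 * R\<^sup>2) \<le> D / 2"
    using R by (intro divide_left_mono) (auto simp: D_def one_le_power)
  finally have "(norm z)\<^sup>2 / (4 * R\<^sup>2) - L\<^sup>2 / 2 - D / 2 \<le> 0" by simp
  then have "pi * ((norm z)\<^sup>2 / (4 * R\<^sup>2) - L\<^sup>2 / 2 - D / 2) \<le> 0"
    by (simp add: mult_le_0_iff)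
  then have "- pi * D \<le> pi * L\<^sup>2 / 2 + (- pi * (1 / 2) * D) + (- pi * (norm z)\<^sup>2 / (4 * R\<^sup>2))"
    by (simp add: algebra_simps)
  then have "exp (- pi * D) \<le> exp (pi * L\<^sup>2 / 2) * exp (- pi * (1 / 2) * D) * exp (- pi * (norm z)\<^sup>2 / (4 * R\<^sup>2))"
    unfolding exp_add[symmetric] by simp
  then show ?thesis
    by (simp add: gauss_def D_def norm_minus_commute power_divide power_mult_distrib)
qed

text \<open>After exchanging the integrals, the average over \<omega> of the Gaussians centred at
  \<open>Y \<omega>\<close> is at most a constant times R^(-b), localised to |z| of order
  \<open>R\<close>, where the energy is of order R^(d - a). The constant is uniform in
  \<open>P\<close>, \<open>Y\<close> and \<open>R\<close>, so it serves all frequencies at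
  once.\<close>

lemma bilinear_fourier_estimate:
  fixes \<alpha> :: "'a::euclidean_space measure"
  assumes fin: "finite_measure \<alpha>" and sets [measurable_cong]: "sets \<alpha> = sets borel"
    and supp: "emeasure \<alpha> (- cball 0 M) = 0" and Ca: "0 \<le> Ca"
    and ball: "\<And>x r. 0 < r \<Longrightarrow> emeasure \<alpha> (cball x r) \<le> ennreal (Ca * r powr a)"
    and C: "0 \<le> C"
  shows "\<exists>D>0. \<forall>(P :: 'b measure) Y R. sigma_finite_measure P \<longrightarrow> Y \<in> borel_measurable P \<longrightarrow> 1 \<le> R \<longrightarrow>
    (AE \<omega> in P. norm (Y \<omega>) \<le> L * R) \<longrightarrow>
    (\<forall>z \<delta>. 0 < \<delta> \<longrightarrow> emeasure P {\<omega>\<in>space P. norm (Y \<omega> - z) \<le> \<delta>} \<le> ennreal (C * (\<delta> / R) powr b)) \<longrightarrow>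
    (\<integral>\<^sup>+\<omega>. ennreal ((cmod (fourier_transform \<alpha> (Y \<omega>)))\<^sup>2) \<partial>P) \<le> ennreal (D * R powr (real DIM('a) - a - b))"
proof -
  let ?T = "gauss_tilt M \<alpha>" and ?d = "real DIM('a)"
  let ?F = "\<lambda>z. (cmod (fourier_transform ?T z))\<^sup>2"
  have finT: "finite_measure ?T" by (rule finite_measure_gauss_tilt[OF fin sets])
  have setsT: "sets ?T = sets borel" by (simp add: sets_gauss_tilt sets)
  note [measurable] = borel_measurable_fourier_transform[OF finT setsT] borel_measurable_fourier_transform[OF fin sets]
  define A where "A = exp (pi * M\<^sup>2) * Ca"
  have A: "0 \<le> A" using Ca by (simp add: A_def)
  have ballT: "emeasure ?T (cball x r) \<le> ennreal (A * r powr a)" if "0 < r" for x r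
  proof -
    have "emeasure ?T (cball x r) \<le> ennreal (exp (pi * M\<^sup>2)) * emeasure \<alpha> (cball x r)"
      by (rule emeasure_gauss_tilt_le[OF sets]) simp
    also have "\<dots> \<le> ennreal (exp (pi * M\<^sup>2)) * ennreal (Ca * r powr a)"
      by (intro mult_left_mono ball that) simp
    also have "\<dots> = ennreal (A * r powr a)"
      using Ca by (simp add: A_def ennreal_mult'[symmetric] mult.assoc)
    finally show ?thesis .
  qed
  define E where "E = A * layer_const a * measure ?T UNIV"
  have E: "0 \<le> E" using A layer_const_nonneg by (simp add: E_def)
  define H where "H = exp (pi * L\<^sup>2 / 2) * (C * layer_const b * (1 / sqrt 2) powr (- b))"
  have H: "0 \<le> H" using C layer_const_nonneg by (simp add: H_def)
  \<comment> \<open>Adding 1 only secures positivity.\<close>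
  define D where "D = H * E * 2 powr (?d - a) + 1"
  show ?thesis
  proof (intro exI[of _ D] conjI allI impI)
    show "0 < D" using E H by (simp add: D_def add_nonneg_pos)
    fix P :: "'b measure" and Y :: "'b \<Rightarrow> 'a" and R
    assume P: "sigma_finite_measure P" and Y [measurable]: "Y \<in> borel_measurable P" and R: "1 \<le> R"
      and YL: "AE \<omega> in P. norm (Y \<omega>) \<le> L * R"
      and YP: "\<forall>z \<delta>. 0 < \<delta> \<longrightarrow> emeasure P {\<omega>\<in>space P. norm (Y \<omega> - z) \<le> \<delta>} \<le> ennreal (C * (\<delta> / R) powr b)"
    interpret P: sigma_finite_measure P by fact
    interpret PL: pair_sigma_finite P "lborel :: 'a measure" ..
    have "(\<integral>\<^sup>+\<omega>. ennreal ((cmod (fourier_transform \<alpha> (Y \<omega>)))\<^sup>2) \<partial>P)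
        \<le> (\<integral>\<^sup>+\<omega>. \<integral>\<^sup>+z. ennreal (?F z) * ennreal (gauss 1 (z - Y \<omega>)) \<partial>lborel \<partial>P)"
      by (intro nn_integral_mono fourier_transform_sq_le fin sets supp)
    also have "\<dots> = (\<integral>\<^sup>+z. \<integral>\<^sup>+\<omega>. ennreal (?F z) * ennreal (gauss 1 (z - Y \<omega>)) \<partial>P \<partial>lborel)"
      by (rule PL.Fubini'[symmetric]) measurable
    also have "\<dots> \<le> (\<integral>\<^sup>+z. ennreal (H * R powr (- b)) * ennreal (?F z * gauss (1 / (2 * R)) z) \<partial>lborel)"
    proof (rule nn_integral_mono)
      fix z :: 'a
      have "(\<integral>\<^sup>+\<omega>. ennreal (gauss 1 (z - Y \<omega>)) \<partial>P)
          \<le> (\<integral>\<^sup>+\<omega>. ennreal (exp (pi * L\<^sup>2 / 2) * gauss (1 / (2 * R)) z) * ennreal (gauss (1 / sqrt 2) (Y \<omega> - z)) \<partial>P)"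
      proof (rule nn_integral_mono_AE)
        from YL show "AE \<omega> in P. ennreal (gauss 1 (z - Y \<omega>))
            \<le> ennreal (exp (pi * L\<^sup>2 / 2) * gauss (1 / (2 * R)) z) * ennreal (gauss (1 / sqrt 2) (Y \<omega> - z))"
        proof eventually_elim
          fix \<omega> assume "norm (Y \<omega>) \<le> L * R"
          then have "gauss 1 (z - Y \<omega>) \<le> exp (pi * L\<^sup>2 / 2) * gauss (1 / sqrt 2) (Y \<omega> - z) * gauss (1 / (2 * R)) z"
            using R by (rule gauss_split_le)
          then show "ennreal (gauss 1 (z - Y \<omega>))
              \<le> ennreal (exp (pi * L\<^sup>2 / 2) * gauss (1 / (2 * R)) z) * ennreal (gauss (1 / sqrt 2) (Y \<omega> - z))"
            by (subst ennreal_mult[symmetric]) (auto intro!: ennreal_leI simp: mult_ac)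
        qed
      qed
      also have "\<dots> = ennreal (exp (pi * L\<^sup>2 / 2) * gauss (1 / (2 * R)) z) * (\<integral>\<^sup>+\<omega>. ennreal (gauss (1 / sqrt 2) (Y \<omega> - z)) \<partial>P)"
        by (rule nn_integral_cmult) measurable
      also have "\<dots> \<le> ennreal (exp (pi * L\<^sup>2 / 2) * gauss (1 / (2 * R)) z)
          * ennreal ((C * R powr (- b)) * layer_const b * (1 / sqrt 2) powr (- b))"
      proof (intro mult_left_mono nn_integral_gauss_le Y)
        fix \<delta> :: real assume "0 < \<delta>"
        then have "emeasure P {\<omega> \<in> space P. norm (Y \<omega> - z) \<le> \<delta>} \<le> ennreal (C * (\<delta> / R) powr b)"
          using YP by blast
        also have "C * (\<delta> / R) powr b = C * R powr (- b) * \<delta> powr b"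
          using R \<open>0 < \<delta>\<close> by (simp add: powr_divide powr_minus_divide)
        finally show "emeasure P {\<omega> \<in> space P. norm (Y \<omega> - z) \<le> \<delta>} \<le> ennreal (C * R powr (- b) * \<delta> powr b)" .
      qed (use C in auto)
      also have "\<dots> = ennreal (H * R powr (- b) * gauss (1 / (2 * R)) z)"
        using C layer_const_nonneg by (subst ennreal_mult[symmetric]) (auto simp: H_def mult_ac)
      finally have le: "(\<integral>\<^sup>+\<omega>. ennreal (gauss 1 (z - Y \<omega>)) \<partial>P) \<le> ennreal (H * R powr (- b) * gauss (1 / (2 * R)) z)" .
      have "(\<integral>\<^sup>+\<omega>. ennreal (?F z) * ennreal (gauss 1 (z - Y \<omega>)) \<partial>P)
          = ennreal (?F z) * (\<integral>\<^sup>+\<omega>. ennreal (gauss 1 (z - Y \<omega>)) \<partial>P)"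
        by (rule nn_integral_cmult) measurable
      also have "\<dots> \<le> ennreal (?F z) * ennreal (H * R powr (- b) * gauss (1 / (2 * R)) z)"
        by (rule mult_left_mono[OF le]) simp
      also have "\<dots> = ennreal (H * R powr (- b)) * ennreal (?F z * gauss (1 / (2 * R)) z)"
        using H by (simp add: ennreal_mult[symmetric] mult_ac)
      finally show "(\<integral>\<^sup>+\<omega>. ennreal (?F z) * ennreal (gauss 1 (z - Y \<omega>)) \<partial>P)
          \<le> ennreal (H * R powr (- b)) * ennreal (?F z * gauss (1 / (2 * R)) z)" .
    qed
    also have "\<dots> = ennreal (H * R powr (- b)) * (\<integral>\<^sup>+z. ennreal (?F z * gauss (1 / (2 * R)) z) \<partial>lborel)"
      by (rule nn_integral_cmult) measurable
    also have "\<dots> \<le> ennreal (H * R powr (- b)) * ennreal (E * (1 / (2 * R)) powr (a - ?d))"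
      unfolding E_def using R by (intro mult_left_mono fourier_energy_le finT setsT A ballT) auto
    also have "\<dots> = ennreal (H * E * 2 powr (?d - a) * R powr (?d - a - b))"
    proof -
      have "(1 / (2 * R)) powr (a - ?d) = (2 * R) powr (?d - a)"
        using R by (simp add: powr_divide powr_minus_divide[of _ "?d - a", simplified])
      also have "\<dots> = 2 powr (?d - a) * R powr (?d - a)" using R by (simp add: powr_mult)
      finally have eq: "(1 / (2 * R)) powr (a - ?d) = 2 powr (?d - a) * R powr (?d - a)" .
      have "R powr (?d - a - b) = R powr (- b) * R powr (?d - a)"
        by (simp add: powr_add[symmetric])
      then show ?thesis unfolding eq using H E by (simp add: ennreal_mult[symmetric] mult_ac)
    qed
    also have "\<dots> \<le> ennreal (D * R powr (?d - a - b))"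
      by (intro ennreal_leI mult_right_mono) (auto simp: D_def)
    finally show "(\<integral>\<^sup>+\<omega>. ennreal ((cmod (fourier_transform \<alpha> (Y \<omega>)))\<^sup>2) \<partial>P)
        \<le> ennreal (D * R powr (?d - a - b))" .
  qed
qed

section \<open>Decay for rotated dilates\<close>

lemma frostman_measure_prob:
  assumes "frostman_measure s K \<mu>"
  shows "prob_space \<mu>"
  by (rule prob_spaceI) (simp add: frostman_measureD[OF assms])

lemma frostman_measure_AE:
  assumes "frostman_measure s K \<mu>"
  shows "AE x in \<mu>. x \<in> K"
proof (rule AE_I)
  show "emeasure \<mu> (- K) = 0" by (rule frostman_measureD[OF assms])
  show "- K \<in> sets \<mu>"
    unfolding frostman_measureD(2)[OF assms]
    by (intro borel_open open_Compl compact_imp_closed frostman_measureD(1)[OF assms])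
qed auto

lemma continuous_on_vector_matrix_mult [continuous_intros]:
  "continuous_on S (\<lambda>g. x v* g)" for x :: "real^'n" and S :: "(real^'m^'n) set"
proof -
  have "x v* g = (\<Sum>i\<in>UNIV. x $ i *\<^sub>R g $ i)" for g :: "real^'m^'n"
    by (simp add: vec_eq_iff vector_matrix_mult_def mult.commute)
  then show ?thesis by (simp add: continuous_intros)
qed

lemma scaleR_vector_matrix_mult: "(c *\<^sub>R x) v* g = c *\<^sub>R (x v* g)"
  for x :: "real^'n" and g :: "real^'m^'n"
  by (simp add: vec_eq_iff vector_matrix_mult_def sum_distrib_left mult_ac)

lemma norm_vector_matrix_mult_orthogonal:
  fixes g :: "real^'n^'n"
  assumes "orthogonal_matrix g"
  shows "norm (x v* g) = norm x"
  using orthogonal_matrix_norm_mult[of "transpose g" x] assms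
  by (simp add: orthogonal_matrix_transpose)

text \<open>The complement of \<open>K\<close> is open and null, so the support is a closed subset
  of \<open>K\<close>.\<close>

lemma radon_measures_onI:
  fixes \<mu> :: "'a::euclidean_space measure"
  assumes "prob_space \<mu>" and sets: "sets \<mu> = sets borel" and K: "compact K" "K \<subseteq> A" "emeasure \<mu> (- K) = 0"
  shows "\<mu> \<in> radon_measures_on A"
proof -
  interpret prob_space \<mu> by fact
  have sub: "measure_support \<mu> \<subseteq> K"
  proof
    fix x assume x: "x \<in> measure_support \<mu>"
    show "x \<in> K"
    proof (rule ccontr)
      assume "x \<notin> K"
      then have "0 < emeasure \<mu> (- K)"
        using x K(1) unfolding measure_support_def by (auto simp: compact_imp_closed open_Compl)
      with K(3) show False by simp
    qed
  qed
  have "closed (measure_support \<mu>)"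
  proof -
    have "open (- measure_support \<mu>)"
    proof (subst open_subopen, intro ballI)
      fix x assume "x \<in> - measure_support \<mu>"
      then obtain U where U: "open U" "x \<in> U" "\<not> 0 < emeasure \<mu> U"
        unfolding measure_support_def by blast
      then have "U \<subseteq> - measure_support \<mu>" unfolding measure_support_def by blast
      with U show "\<exists>T. open T \<and> x \<in> T \<and> T \<subseteq> - measure_support \<mu>" by blast
    qed
    then show ?thesis by (simp add: closed_def)
  qed
  then have "compact (K \<inter> measure_support \<mu>)" by (rule compact_Int_closed[OF K(1)])
  moreover have "K \<inter> measure_support \<mu> = measure_support \<mu>" using sub by blast
  moreover have "emeasure \<mu> UNIV = 1"
    using emeasure_space_1 sets_eq_imp_space_eq[OF sets] by simp
  ultimately show ?thesis
    unfolding radon_measures_on_def radon_measure_def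
    using sub K sets emeasure_finite by (auto simp: less_top[symmetric])
qed

lemma cmod_integral_sq_le:
  fixes f :: "'b \<Rightarrow> complex"
  assumes "prob_space P" and f [measurable]: "f \<in> borel_measurable P"
  shows "ennreal ((cmod (integral\<^sup>L P f))\<^sup>2) \<le> (\<integral>\<^sup>+x. ennreal ((cmod (f x))\<^sup>2) \<partial>P)"
proof -
  interpret prob_space P by fact
  have "ennreal (cmod (integral\<^sup>L P f)) \<le> (\<integral>\<^sup>+x. ennreal (norm (f x)) * 1 \<partial>P)"
  proof (cases "integrable P f")
    case True
    then show ?thesis using integral_norm_bound_ennreal by simp
  qed (simp add: not_integrable_integral_eq)
  then have "(ennreal (cmod (integral\<^sup>L P f)))\<^sup>2 \<le> (\<integral>\<^sup>+x. ennreal (norm (f x)) * 1 \<partial>P)\<^sup>2"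
    by (rule power_mono) simp
  also have "\<dots> \<le> (\<integral>\<^sup>+x. (ennreal (norm (f x)))\<^sup>2 \<partial>P) * (\<integral>\<^sup>+x. 1\<^sup>2 \<partial>P)"
    by (rule Cauchy_Schwarz_nn_integral) measurable
  finally show ?thesis by (simp add: ennreal_power emeasure_space_1)
qed

text \<open>Orthogonal maps preserve norms, so the length of the point determines \<open>r\<close>
  up to \<delta>/|\<xi>|, which costs the exponent \<open>\<tau>\<close>. For each such
  \<open>r\<close> the direction lies in a ball of comparable radius, and the orbit bound
  contributes the other exponent.\<close>

lemma scaled_orbit_ball_bound:
  fixes \<nu> :: "(real^'n^'n) measure" and \<rho> :: "real measure"
  assumes \<nu>: "frostman_measure t KG \<nu>" "KG \<subseteq> {g. orthogonal_matrix g}"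
    and \<rho>: "frostman_measure \<tau> KT \<rho>" "KT \<subseteq> {0<..}"
    and t: "(real CARD('n) - 1) * (real CARD('n) - 2) / 2 \<le> t"
  shows "\<exists>C>0. \<forall>\<xi> z \<delta>. \<xi> \<noteq> 0 \<longrightarrow> 0 < \<delta> \<longrightarrow>
    emeasure (\<rho> \<Otimes>\<^sub>M \<nu>) {p. norm (fst p *\<^sub>R (\<xi> v* snd p) - z) \<le> \<delta>}
      \<le> ennreal (C * (\<delta> / norm \<xi>) powr (\<tau> + (t - (real CARD('n) - 1) * (real CARD('n) - 2) / 2)))"
proof -
  define p where "p = t - (real CARD('n) - 1) * (real CARD('n) - 2) / 2"
  have p: "0 \<le> p" using t by (simp add: p_def)
  interpret N: prob_space \<nu> by (rule frostman_measure_prob[OF \<nu>(1)])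
  have sets_\<nu> [measurable_cong]: "sets \<nu> = sets borel" by (rule frostman_measureD[OF \<nu>(1)])
  have sets_\<rho> [measurable_cong]: "sets \<rho> = sets borel" by (rule frostman_measureD[OF \<rho>(1)])
  obtain C1 where C1: "0 < C1" "\<And>\<omega> y r. norm \<omega> = 1 \<Longrightarrow> 0 < r \<Longrightarrow>
      emeasure \<nu> {g. norm (\<omega> v* g - y) \<le> r} \<le> ennreal (C1 * r powr p)"
    using orthogonal_frostman_orbit[OF \<nu> t] unfolding p_def by blast
  obtain C2 where C2: "0 < C2" "\<And>x r. 0 < r \<Longrightarrow> emeasure \<rho> (cball x r) \<le> ennreal (C2 * r powr \<tau>)"
    using frostman_measure_ball[OF \<rho>(1)] by blast
  have cKT: "compact KT" by (rule frostman_measureD[OF \<rho>(1)])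
  have "KT \<noteq> {}" using frostman_measureD[OF \<rho>(1)] by auto
  \<comment> \<open>The smallest element of \<open>KT\<close> is positive; dividing by
    \<open>r\<close> then costs at most the factor \<open>1 / c\<close>.\<close>
  with cKT obtain c where c: "c \<in> KT" "\<And>r. r \<in> KT \<Longrightarrow> c \<le> r"
    using compact_attains_inf by metis
  have c0: "0 < c" using c \<rho>(2) by auto
  show ?thesis
    unfolding p_def[symmetric]
  proof (intro exI[of _ "C1 * C2 * (1 / c) powr p"] conjI allI impI)
    show "0 < C1 * C2 * (1 / c) powr p" using C1 C2 c0 by simp
    fix \<xi> z :: "real^'n" and \<delta> :: real assume \<xi>: "\<xi> \<noteq> 0" and \<delta>: "0 < \<delta>"
    define R where "R = norm \<xi>"
    have R: "0 < R" using \<xi> by (simp add: R_def)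
    define \<omega> where "\<omega> = \<xi> /\<^sub>R R"
    have \<omega>: "norm \<omega> = 1" using R by (simp add: \<omega>_def R_def)
    have \<xi>_eq: "\<xi> v* g = R *\<^sub>R (\<omega> v* g)" for g :: "real^'n^'n"
      using R by (simp add: \<omega>_def scaleR_vector_matrix_mult)
    let ?S = "{p. norm (fst p *\<^sub>R (\<xi> v* snd p) - z) \<le> \<delta>}"
    have "closed ?S"
    proof (intro closed_Collect_le continuous_intros)
      show "continuous_on UNIV (\<lambda>p :: real \<times> (real^'n^'n). \<xi> v* snd p)"
        by (rule continuous_on_compose2[OF continuous_on_vector_matrix_mult[of UNIV]]) (auto intro: continuous_intros)
    qed
    moreover have "sets (\<rho> \<Otimes>\<^sub>M \<nu>) = sets (borel :: (real \<times> (real^'n^'n)) measure)"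
      unfolding borel_prod[symmetric] by (rule sets_pair_measure_cong[OF sets_\<rho> sets_\<nu>])
    ultimately have S: "?S \<in> sets (\<rho> \<Otimes>\<^sub>M \<nu>)" by simp
    let ?B = "cball (norm z / R) (\<delta> / R)"
    have "emeasure (\<rho> \<Otimes>\<^sub>M \<nu>) ?S = (\<integral>\<^sup>+r. emeasure \<nu> (Pair r -` ?S) \<partial>\<rho>)"
      by (rule N.emeasure_pair_measure_alt[OF S])
    also have "\<dots> \<le> (\<integral>\<^sup>+r. ennreal (C1 * (\<delta> / (c * R)) powr p) * indicator ?B r \<partial>\<rho>)"
    proof (rule nn_integral_mono_AE)
      from frostman_measure_AE[OF \<rho>(1)]
      show "AE r in \<rho>. emeasure \<nu> (Pair r -` ?S) \<le> ennreal (C1 * (\<delta> / (c * R)) powr p) * indicator ?B r"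
      proof eventually_elim
        fix r assume r: "r \<in> KT"
        then have rc: "c \<le> r" "0 < r" using c c0 by (auto intro: less_le_trans)
        show "emeasure \<nu> (Pair r -` ?S) \<le> ennreal (C1 * (\<delta> / (c * R)) powr p) * indicator ?B r"
        proof (cases "r \<in> ?B")
          case True
          have "Pair r -` ?S \<subseteq> {g. norm (\<omega> v* g - z /\<^sub>R (r * R)) \<le> \<delta> / (c * R)}"
          proof
            fix g assume "g \<in> Pair r -` ?S"
            then have g: "norm (r *\<^sub>R (\<xi> v* g) - z) \<le> \<delta>" by simp
            have "\<omega> v* g - z /\<^sub>R (r * R) = (r *\<^sub>R (\<xi> v* g) - z) /\<^sub>R (r * R)"
            proof -
              have "inverse (r * R) * (r * R) = 1" by (rule left_inverse) (use rc R in simp)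
              then show ?thesis by (simp only: \<xi>_eq scaleR_diff_right scaleR_scaleR scaleR_one)
            qed
            then have "norm (\<omega> v* g - z /\<^sub>R (r * R)) = norm (r *\<^sub>R (\<xi> v* g) - z) / (r * R)"
              using rc R by (simp add: divide_inverse mult.commute)
            also have "\<dots> \<le> \<delta> / (c * R)"
              using g rc R c0 \<delta> by (intro frac_le mult_right_mono) auto
            finally show "g \<in> {g. norm (\<omega> v* g - z /\<^sub>R (r * R)) \<le> \<delta> / (c * R)}" by simp
          qed
          moreover have "closed {g. norm (\<omega> v* g - z /\<^sub>R (r * R)) \<le> \<delta> / (c * R)}"
            by (intro closed_Collect_le continuous_intros)
          ultimately have "emeasure \<nu> (Pair r -` ?S) \<le> emeasure \<nu> {g. norm (\<omega> v* g - z /\<^sub>R (r * R)) \<le> \<delta> / (c * R)}"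
            by (intro emeasure_mono) (simp_all add: sets_\<nu>)
          also have "\<dots> \<le> ennreal (C1 * (\<delta> / (c * R)) powr p)"
            by (rule C1(2)[OF \<omega>]) (use \<delta> c0 R in simp)
          finally show ?thesis using True by simp
        next
          \<comment> \<open>For such \<open>r\<close> the lengths do not match, so only matrices
            outside \<open>KG\<close>, a null set, can occur.\<close>
          case False
          have "Pair r -` ?S \<subseteq> - KG"
          proof
            fix g assume "g \<in> Pair r -` ?S"
            then have g: "norm (r *\<^sub>R (\<xi> v* g) - z) \<le> \<delta>" by simp
            show "g \<in> - KG"
            proof
              assume "g \<in> KG"
              then have "norm (r *\<^sub>R (\<xi> v* g)) = r * R"
                using \<nu>(2) rc by (auto simp: norm_vector_matrix_mult_orthogonal R_def)
              then have "\<bar>r * R - norm z\<bar> \<le> \<delta>"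
                using norm_triangle_ineq3[of "r *\<^sub>R (\<xi> v* g)" z] g by simp
              moreover have "dist (norm z / R) r = \<bar>r * R - norm z\<bar> / R"
              proof -
                have "norm z / R - r = (norm z - r * R) / R" using R by (simp add: diff_divide_distrib)
                then show ?thesis using R by (simp add: dist_real_def abs_minus_commute)
              qed
              ultimately have "r \<in> ?B" using R by (simp add: divide_right_mono)
              with False show False ..
            qed
          qed
          then have "emeasure \<nu> (Pair r -` ?S) \<le> emeasure \<nu> (- KG)"
            using frostman_measureD(1)[OF \<nu>(1)]
            by (intro emeasure_mono) (auto simp: sets_\<nu> compact_imp_closed)
          then show ?thesis using frostman_measureD(4)[OF \<nu>(1)] by simp
        qed
      qed
    qed
    also have "\<dots> = ennreal (C1 * (\<delta> / (c * R)) powr p) * emeasure \<rho> ?B"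
      by (rule nn_integral_cmult_indicator) (simp add: sets_\<rho>)
    also have "\<dots> \<le> ennreal (C1 * (\<delta> / (c * R)) powr p) * ennreal (C2 * (\<delta> / R) powr \<tau>)"
      by (intro mult_left_mono C2) (use \<delta> R in auto)
    also have "\<dots> = ennreal (C1 * C2 * (1 / c) powr p * (\<delta> / R) powr (\<tau> + p))"
    proof -
      have "(\<delta> / (c * R)) powr p = (1 / c) powr p * (\<delta> / R) powr p"
        using \<delta> R c0 by (simp add: powr_mult[symmetric])
      then show ?thesis using C1 C2 by (simp add: ennreal_mult[symmetric] powr_add mult_ac)
    qed
    finally show "emeasure (\<rho> \<Otimes>\<^sub>M \<nu>) ?S \<le> ennreal (C1 * C2 * (1 / c) powr p * (\<delta> / norm \<xi>) powr (\<tau> + p))"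
      by (simp add: R_def)
  qed
qed

definition dilate_measure :: "real measure \<Rightarrow> (real^'n^'n) measure \<Rightarrow> (real^'n) measure \<Rightarrow> (real^'n) measure" where
  "dilate_measure \<rho> \<nu> \<alpha> = distr ((\<rho> \<Otimes>\<^sub>M \<nu>) \<Otimes>\<^sub>M \<alpha>) borel (\<lambda>p. fst (fst p) *\<^sub>R (snd (fst p) *v snd p))"

lemma continuous_on_dilation:
  "continuous_on S (\<lambda>p :: (real \<times> (real^'n^'m)) \<times> (real^'n). fst (fst p) *\<^sub>R (snd (fst p) *v snd p))"
  unfolding matrix_vector_mult_def
  by (intro continuous_intros continuous_on_vec_lambda)

lemma borel_measurable_dilation:
  fixes \<nu> :: "(real^'n^'n) measure"
  assumes "sets \<rho> = sets borel" "sets \<nu> = sets borel" "sets \<alpha> = sets borel"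
  shows "(\<lambda>p. fst (fst p) *\<^sub>R (snd (fst p) *v snd p)) \<in> borel_measurable ((\<rho> \<Otimes>\<^sub>M \<nu>) \<Otimes>\<^sub>M \<alpha>)"
proof -
  have "sets ((\<rho> \<Otimes>\<^sub>M \<nu>) \<Otimes>\<^sub>M \<alpha>) = sets (borel :: ((real \<times> (real^'n^'n)) \<times> (real^'n)) measure)"
    unfolding borel_prod[symmetric] by (intro sets_pair_measure_cong assms)
  then have "borel_measurable ((\<rho> \<Otimes>\<^sub>M \<nu>) \<Otimes>\<^sub>M \<alpha>)
      = (borel_measurable borel :: (((real \<times> (real^'n^'n)) \<times> (real^'n)) \<Rightarrow> real^'n) set)"
    by (rule measurable_cong_sets) simp
  then show ?thesis by (simp only: borel_measurable_continuous_onI continuous_on_dilation)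
qed

lemma prob_space_pair_measure: "prob_space M \<Longrightarrow> prob_space N \<Longrightarrow> prob_space (M \<Otimes>\<^sub>M N)"
proof -
  assume "prob_space M" "prob_space N"
  then interpret M: prob_space M + N: prob_space N .
  interpret pair_prob_space M N ..
  show ?thesis by unfold_locales
qed

text \<open>Moving the linear map to the other side of the inner product shows that the transform at
  \<open>\<xi>\<close> is the mean of the transform of \<open>\<alpha>\<close> over the points
  \<open>r *\<^sub>R (\<xi> v* g)\<close>. The mean of squares is then controlled with R =
  |\<xi>|.\<close>

lemma dilate_measure_decay:
  fixes \<nu> :: "(real^'n^'n) measure" and \<rho> :: "real measure" and \<alpha> :: "(real^'n) measure"
  assumes \<nu>: "frostman_measure t KG \<nu>" "KG \<subseteq> {g. orthogonal_matrix g}"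
    and \<rho>: "frostman_measure \<tau> KT \<rho>" "KT \<subseteq> {0<..}"
    and \<alpha>: "frostman_measure a KE \<alpha>"
    and t: "(real CARD('n) - 1) * (real CARD('n) - 2) / 2 \<le> t"
  defines "\<gamma> \<equiv> a + \<tau> + (t - (real CARD('n) - 1) * (real CARD('n) - 2) / 2) - real CARD('n)"
  shows "\<exists>D>0. \<forall>\<xi>. (cmod (fourier_transform (dilate_measure \<rho> \<nu> \<alpha>) \<xi>))\<^sup>2 \<le> D * (1 + norm \<xi>) powr (- \<gamma>)"
proof -
  define b where "b = \<tau> + (t - (real CARD('n) - 1) * (real CARD('n) - 2) / 2)"
  interpret N: prob_space \<nu> by (rule frostman_measure_prob[OF \<nu>(1)])
  interpret R: prob_space \<rho> by (rule frostman_measure_prob[OF \<rho>(1)])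
  interpret A: prob_space \<alpha> by (rule frostman_measure_prob[OF \<alpha>])
  have sets_\<nu> [measurable_cong]: "sets \<nu> = sets borel" by (rule frostman_measureD[OF \<nu>(1)])
  have sets_\<rho> [measurable_cong]: "sets \<rho> = sets borel" by (rule frostman_measureD[OF \<rho>(1)])
  have sets_\<alpha> [measurable_cong]: "sets \<alpha> = sets borel" by (rule frostman_measureD[OF \<alpha>])
  let ?P = "\<rho> \<Otimes>\<^sub>M \<nu>"
  interpret P: prob_space ?P by (rule prob_space_pair_measure) unfold_locales
  interpret PA: prob_space "?P \<Otimes>\<^sub>M \<alpha>" by (rule prob_space_pair_measure) unfold_locales
  interpret PA2: pair_sigma_finite ?P \<alpha> ..
  interpret RN: pair_sigma_finite \<rho> \<nu> ..
  define Y where "Y \<xi> p = fst p *\<^sub>R (\<xi> v* snd p)" for \<xi> and p :: "real \<times> (real^'n^'n)"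
  have vm [measurable]: "(\<lambda>g :: real^'n^'n. \<xi> v* g) \<in> borel_measurable borel" for \<xi>
    by (intro borel_measurable_continuous_onI continuous_intros)
  have Y [measurable]: "Y \<xi> \<in> borel_measurable ?P" for \<xi>
    unfolding Y_def by measurable
  note [measurable] = borel_measurable_fourier_transform[OF A.finite_measure_axioms sets_\<alpha>]
  let ?L = "dilate_measure \<rho> \<nu> \<alpha>"
  have dil: "(\<lambda>p. fst (fst p) *\<^sub>R (snd (fst p) *v snd p)) \<in> borel_measurable (?P \<Otimes>\<^sub>M \<alpha>)"
    by (rule borel_measurable_dilation[OF sets_\<rho> sets_\<nu> sets_\<alpha>])
  have ft: "fourier_transform ?L \<xi> = (\<integral>p. fourier_transform \<alpha> (Y \<xi> p) \<partial>?P)" for \<xi>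
  proof -
    let ?f = "\<lambda>q. wave (\<xi> \<bullet> (fst (fst q) *\<^sub>R (snd (fst q) *v snd q)))"
    have f_eq: "?f (p, x) = wave (Y \<xi> p \<bullet> x)" for p x
      by (simp add: Y_def dot_lmul_matrix)
    have m: "?f \<in> borel_measurable (?P \<Otimes>\<^sub>M \<alpha>)"
      using dil by measurable
    have int: "integrable (?P \<Otimes>\<^sub>M \<alpha>) ?f"
      by (rule PA.integrable_const_bound[where B = 1, OF _ m]) simp
    have "fourier_transform ?L \<xi> = (\<integral>q. ?f q \<partial>(?P \<Otimes>\<^sub>M \<alpha>))"
      unfolding fourier_transform_wave dilate_measure_def
      by (rule integral_distr[OF dil]) measurable
    also have "\<dots> = (\<integral>p. (\<integral>x. ?f (p, x) \<partial>\<alpha>) \<partial>?P)"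
      by (rule PA2.integral_fst'[OF int, symmetric])
    finally show ?thesis unfolding f_eq fourier_transform_wave .
  qed
  have sq: "ennreal ((cmod (fourier_transform ?L \<xi>))\<^sup>2) \<le> (\<integral>\<^sup>+p. ennreal ((cmod (fourier_transform \<alpha> (Y \<xi> p)))\<^sup>2) \<partial>?P)" for \<xi>
    unfolding ft by (rule cmod_integral_sq_le) (unfold_locales, measurable)
  obtain C where C: "0 < C" "\<And>\<xi> z \<delta>. \<xi> \<noteq> 0 \<Longrightarrow> 0 < \<delta> \<Longrightarrow>
    emeasure ?P {p. norm (Y \<xi> p - z) \<le> \<delta>} \<le> ennreal (C * (\<delta> / norm \<xi>) powr b)"
    using scaled_orbit_ball_bound[OF \<nu> \<rho> t] unfolding b_def Y_def by blast
  obtain Ca where Ca: "0 < Ca" "\<And>x r. 0 < r \<Longrightarrow> emeasure \<alpha> (cball x r) \<le> ennreal (Ca * r powr a)"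
    using frostman_measure_ball[OF \<alpha>] by blast
  have "bounded KE" using frostman_measureD(1)[OF \<alpha>] by (rule compact_imp_bounded)
  then obtain M where M: "\<And>x. x \<in> KE \<Longrightarrow> norm x \<le> M" unfolding bounded_iff by blast
  have "emeasure \<alpha> (- cball 0 M) \<le> emeasure \<alpha> (- KE)"
    using M frostman_measureD(1)[OF \<alpha>] by (intro emeasure_mono) (auto simp: sets_\<alpha> compact_imp_closed)
  then have supp: "emeasure \<alpha> (- cball 0 M) = 0" using frostman_measureD(4)[OF \<alpha>] by simp
  have "bounded KT" using frostman_measureD(1)[OF \<rho>(1)] by (rule compact_imp_bounded)
  then obtain L where L: "\<And>x. x \<in> KT \<Longrightarrow> norm x \<le> L" unfolding bounded_iff by blast
  have YL: "AE p in ?P. norm (Y \<xi> p) \<le> L * norm \<xi>" for \<xi>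
  proof (rule RN.AE_pair_measure)
    show "{p \<in> space ?P. norm (Y \<xi> p) \<le> L * norm \<xi>} \<in> sets ?P" by measurable
    from frostman_measure_AE[OF \<rho>(1)] show "AE r in \<rho>. AE g in \<nu>. norm (Y \<xi> (r, g)) \<le> L * norm \<xi>"
    proof eventually_elim
      fix r assume r: "r \<in> KT"
      from frostman_measure_AE[OF \<nu>(1)] show "AE g in \<nu>. norm (Y \<xi> (r, g)) \<le> L * norm \<xi>"
      proof eventually_elim
        fix g assume "g \<in> KG"
        then have "norm (Y \<xi> (r, g)) = \<bar>r\<bar> * norm \<xi>"
          using \<nu>(2) by (auto simp: Y_def norm_vector_matrix_mult_orthogonal)
        then show "norm (Y \<xi> (r, g)) \<le> L * norm \<xi>" using L[OF r] by (simp add: mult_right_mono)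
      qed
    qed
  qed
  obtain D where D: "0 < D" "\<And>(P :: (real \<times> (real^'n^'n)) measure) Y R. sigma_finite_measure P \<Longrightarrow> Y \<in> borel_measurable P \<Longrightarrow> 1 \<le> R \<Longrightarrow>
    (AE \<omega> in P. norm (Y \<omega>) \<le> L * R) \<Longrightarrow>
    (\<forall>z \<delta>. 0 < \<delta> \<longrightarrow> emeasure P {\<omega>\<in>space P. norm (Y \<omega> - z) \<le> \<delta>} \<le> ennreal (C * (\<delta> / R) powr b)) \<Longrightarrow>
    (\<integral>\<^sup>+\<omega>. ennreal ((cmod (fourier_transform \<alpha> (Y \<omega>)))\<^sup>2) \<partial>P) \<le> ennreal (D * R powr (real DIM(real^'n) - a - b))"
    using bilinear_fourier_estimate[OF A.finite_measure_axioms sets_\<alpha> supp less_imp_le[OF Ca(1)] Ca(2) less_imp_le[OF C(1)],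
        where 'b = "real \<times> (real^'n^'n)" and L = L and b = b] by blast
  have \<gamma>: "real DIM(real^'n) - a - b = - \<gamma>" by (simp add: \<gamma>_def b_def)
  have large: "(cmod (fourier_transform ?L \<xi>))\<^sup>2 \<le> D * norm \<xi> powr (- \<gamma>)" if "1 \<le> norm \<xi>" for \<xi>
  proof -
    have "space ?P = UNIV"
      using frostman_measureD(5)[OF \<rho>(1)] frostman_measureD(5)[OF \<nu>(1)] by (simp add: space_pair_measure)
    moreover have "\<xi> \<noteq> 0" using that by auto
    ultimately have "ennreal ((cmod (fourier_transform ?L \<xi>))\<^sup>2) \<le> ennreal (D * norm \<xi> powr (- \<gamma>))"
      unfolding \<gamma>[symmetric] using C(2) that
      by (intro order_trans[OF sq] D(2) Y YL P.sigma_finite_measure_axioms allI impI) auto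
    then show ?thesis using D(1) by (subst (asm) ennreal_le_iff) auto
  qed
  have prob: "prob_space ?L" unfolding dilate_measure_def by (rule PA.prob_space_distr[OF dil])
  have sets_L: "sets ?L = sets borel" by (simp add: dilate_measure_def)
  \<comment> \<open>For |\<xi>| < 1 the trivial bound 1 is used. The factor
    \<open>2 powr \<bar>\<gamma>\<bar>\<close> pays for this and for replacing |\<xi>| by 1 +
    |\<xi>|, whatever the sign of \<open>\<gamma>\<close>.\<close>
  show ?thesis
  proof (intro exI[of _ "(D + 1) * 2 powr \<bar>\<gamma>\<bar>"] conjI allI)
    show "0 < (D + 1) * 2 powr \<bar>\<gamma>\<bar>" using D by simp
    fix \<xi> :: "real^'n"
    let ?u = "1 + norm \<xi>"
    have u: "1 \<le> ?u" "?u \<noteq> 0" using norm_ge_zero[of \<xi>] by linarith+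
    show "(cmod (fourier_transform ?L \<xi>))\<^sup>2 \<le> (D + 1) * 2 powr \<bar>\<gamma>\<bar> * ?u powr (- \<gamma>)"
    proof (cases "1 \<le> norm \<xi>")
      case True
      have "norm \<xi> powr (- \<gamma>) = ?u powr (- \<gamma>) * (?u / norm \<xi>) powr \<gamma>"
        using True by (simp add: powr_divide powr_minus field_simps)
      moreover have "(?u / norm \<xi>) powr \<gamma> \<le> 2 powr \<bar>\<gamma>\<bar>"
      proof -
        have n0: "0 < norm \<xi>" using True by linarith
        have "1 \<le> ?u / norm \<xi>" by (subst le_divide_eq_1_pos[OF n0]) simp
        moreover have "?u / norm \<xi> \<le> 2" by (subst pos_divide_le_eq[OF n0]) (use True in simp)
        ultimately have "(?u / norm \<xi>) powr \<gamma> \<le> (?u / norm \<xi>) powr \<bar>\<gamma>\<bar>" "(?u / norm \<xi>) powr \<bar>\<gamma>\<bar> \<le> 2 powr \<bar>\<gamma>\<bar>"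
          by (intro powr_mono powr_mono2; simp)+
        then show ?thesis by simp
      qed
      ultimately have "norm \<xi> powr (- \<gamma>) \<le> ?u powr (- \<gamma>) * 2 powr \<bar>\<gamma>\<bar>"
        by (simp only: mult_left_mono powr_ge_zero)
      then have "D * norm \<xi> powr (- \<gamma>) \<le> D * (?u powr (- \<gamma>) * 2 powr \<bar>\<gamma>\<bar>)"
        using D(1) by (intro mult_left_mono) auto
      also have "\<dots> \<le> (D + 1) * 2 powr \<bar>\<gamma>\<bar> * ?u powr (- \<gamma>)" by (simp add: algebra_simps)
      finally show ?thesis using large[OF True] by simp
    next
      case False
      interpret L: prob_space ?L by fact
      have "cmod (fourier_transform ?L \<xi>) \<le> measure ?L UNIV"
        by (rule norm_fourier_transform_le[OF L.finite_measure_axioms sets_L])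
      then have "cmod (fourier_transform ?L \<xi>) \<le> 1"
        using L.prob_space sets_eq_imp_space_eq[OF sets_L] by simp
      then have "(cmod (fourier_transform ?L \<xi>))\<^sup>2 \<le> 1" by (simp add: power_le_one)
      also have "1 = ?u powr \<gamma> * ?u powr (- \<gamma>)" using u by (simp add: powr_add[symmetric])
      also have "?u powr \<gamma> \<le> 2 powr \<bar>\<gamma>\<bar>"
      proof -
        have "?u powr \<gamma> \<le> ?u powr \<bar>\<gamma>\<bar>" "?u powr \<bar>\<gamma>\<bar> \<le> 2 powr \<bar>\<gamma>\<bar>"
          using False by (intro powr_mono powr_mono2; simp)+
        then show ?thesis by simp
      qed
      finally have "(cmod (fourier_transform ?L \<xi>))\<^sup>2 \<le> 2 powr \<bar>\<gamma>\<bar> * ?u powr (- \<gamma>)"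
        by (simp add: mult_right_mono)
      also have "\<dots> \<le> (D + 1) * 2 powr \<bar>\<gamma>\<bar> * ?u powr (- \<gamma>)"
        using D by (intro mult_right_mono) auto
      finally show ?thesis .
    qed
  qed
qed

section \<open>Sobolev energy and the measure of balls\<close>

definition sum_measure :: "'a::euclidean_space measure \<Rightarrow> 'a measure \<Rightarrow> 'a measure" where
  "sum_measure L Z = distr (L \<Otimes>\<^sub>M Z) borel (\<lambda>p. fst p + snd p)"

lemma fourier_transform_sum_measure:
  fixes L Z :: "'a::euclidean_space measure"
  assumes "prob_space L" "prob_space Z" and [measurable_cong]: "sets L = sets borel" "sets Z = sets borel"
  shows "fourier_transform (sum_measure L Z) \<xi> = fourier_transform L \<xi> * fourier_transform Z \<xi>"
proof -
  interpret L: prob_space L by fact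
  interpret Z: prob_space Z by fact
  interpret P: prob_space "L \<Otimes>\<^sub>M Z" by (rule prob_space_pair_measure) fact+
  interpret PP: pair_sigma_finite L Z ..
  let ?f = "\<lambda>p. wave (\<xi> \<bullet> (fst p + snd p))"
  have int: "integrable (L \<Otimes>\<^sub>M Z) ?f"
    by (rule P.integrable_const_bound[where B = 1]) auto
  have "fourier_transform (sum_measure L Z) \<xi> = (\<integral>p. ?f p \<partial>(L \<Otimes>\<^sub>M Z))"
    unfolding fourier_transform_wave sum_measure_def by (rule integral_distr) measurable
  also have "\<dots> = (\<integral>x. (\<integral>y. wave (\<xi> \<bullet> x) * wave (\<xi> \<bullet> y) \<partial>Z) \<partial>L)"
    using PP.integral_fst'[OF int] by (simp add: inner_add_right wave_add)
  finally show ?thesis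
    unfolding fourier_transform_wave
    by (simp only: Bochner_Integration.integral_mult_right_zero Bochner_Integration.integral_mult_left_zero)
qed

lemma sets_sum_measure [simp]: "sets (sum_measure L Z) = sets borel"
  by (simp add: sum_measure_def)

text \<open>Energies are known for Gaussian weights only. The term with \<open>2 ^ k\<close>
  comparable to 1 + |z| alone suffices: there |z| \<le> 2 * 2^k, so the Gaussian is at least exp(-4
  pi).\<close>

lemma power_le_dyadic_gauss_sum:
  fixes z :: "'a::euclidean_space"
  shows "ennreal ((1 + norm z) powr p)
    \<le> (\<Sum>k. ennreal (2 powr \<bar>p\<bar> * exp (4 * pi) * (2 ^ k) powr p) * ennreal (gauss (1 / 2 ^ k) z))"
proof -
  define u where "u = 1 + norm z"
  have u: "1 \<le> u" by (simp add: u_def)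
  obtain n where "u < 2 ^ n" using real_arch_pow[of 2 u] by auto
  moreover have "\<not> u < 2 ^ 0" using u by simp
  ultimately have "\<exists>k<n. (\<forall>i\<le>k. \<not> u < 2 ^ i) \<and> u < 2 ^ Suc k"
    by (intro ex_least_nat_less)
  then obtain k where k: "2 ^ k \<le> u" "u \<le> 2 * 2 ^ k" by (auto simp: not_less)
  define f where "f k = ennreal (2 powr \<bar>p\<bar> * exp (4 * pi) * (2 ^ k) powr p) * ennreal (gauss (1 / 2 ^ k) z)" for k
  have "u powr p \<le> 2 powr \<bar>p\<bar> * (2 ^ k) powr p"
  proof -
    have q: "1 \<le> u / 2 ^ k" "u / 2 ^ k \<le> 2" using k by (simp_all add: field_simps)
    have "u powr p = (u / 2 ^ k) powr p * (2 ^ k) powr p"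
      using u by (simp add: powr_mult[symmetric])
    moreover have "(u / 2 ^ k) powr p \<le> (u / 2 ^ k) powr \<bar>p\<bar>" using q(1) by (intro powr_mono) auto
    moreover have "(u / 2 ^ k) powr \<bar>p\<bar> \<le> 2 powr \<bar>p\<bar>"
      using q(2) order_trans[OF zero_le_one q(1)] by (intro powr_mono2) auto
    ultimately show ?thesis by (simp add: mult_right_mono)
  qed
  moreover have "1 \<le> exp (4 * pi) * gauss (1 / 2 ^ k) z"
  proof -
    have "(norm z / 2 ^ k)\<^sup>2 \<le> 2\<^sup>2"
      using k by (intro power_mono) (simp_all add: u_def field_simps)
    then have "pi * (norm z / 2 ^ k)\<^sup>2 \<le> pi * 4" by (intro mult_left_mono) auto
    then have "0 \<le> 4 * pi - pi * (1 / 2 ^ k)\<^sup>2 * (norm z)\<^sup>2"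
      by (simp add: power_divide)
    then have "1 \<le> exp (4 * pi + - pi * (1 / 2 ^ k)\<^sup>2 * (norm z)\<^sup>2)" by simp
    then show ?thesis by (simp only: exp_add gauss_def)
  qed
  ultimately have "u powr p * 1 \<le> (2 powr \<bar>p\<bar> * (2 ^ k) powr p) * (exp (4 * pi) * gauss (1 / 2 ^ k) z)"
    by (intro mult_mono) auto
  then have "ennreal (u powr p) \<le> f k"
    unfolding f_def by (simp add: ennreal_mult[symmetric] mult_ac ennreal_leI)
  also have "\<dots> \<le> (\<Sum>k. f k)" using sum_le_suminf[of f "{k}"] by simp
  finally show ?thesis by (simp only: f_def u_def)
qed

text \<open>The transform of the convolution is a product. The decay of one factor is absorbed in
  the weight, and the energy of the other at scale \<open>2 ^ k\<close> leaves a geometric series of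
  ratio \<open>2 powr (s - \<gamma> - \<sigma>)\<close>.\<close>

lemma sobolev_sum_measure:
  fixes L Z :: "'a::euclidean_space measure"
  assumes L: "prob_space L" and sets_L: "sets L = sets borel" and D: "0 < D"
    and decay: "\<And>\<xi>. (cmod (fourier_transform L \<xi>))\<^sup>2 \<le> D * (1 + norm \<xi>) powr (- \<gamma>)"
    and Z: "frostman_measure \<sigma> K Z" and s: "s < \<gamma> + \<sigma>"
  shows "(\<integral>\<^sup>+x. ennreal ((cmod (fourier_transform (sum_measure L Z) x))\<^sup>2 * (1 + norm x) powr (s - real DIM('a))) \<partial>lborel) < \<infinity>"
proof -
  interpret Z: prob_space Z by (rule frostman_measure_prob[OF Z])
  have sets_Z: "sets Z = sets borel" by (rule frostman_measureD[OF Z])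
  note [measurable] = borel_measurable_fourier_transform[OF Z.finite_measure_axioms sets_Z]
  let ?d = "real DIM('a)"
  define p where "p = s - ?d - \<gamma>"
  obtain C where C: "0 < C" "\<And>x r. 0 < r \<Longrightarrow> emeasure Z (cball x r) \<le> ennreal (C * r powr \<sigma>)"
    using frostman_measure_ball[OF Z] by blast
  define E where "E = C * layer_const \<sigma> * measure Z UNIV"
  have E: "0 \<le> E" using C layer_const_nonneg by (simp add: E_def)
  define c where "c = D * (2 powr \<bar>p\<bar> * exp (4 * pi))"
  have c: "0 \<le> c" using D by (simp add: c_def)
  have "(\<integral>\<^sup>+x. ennreal ((cmod (fourier_transform (sum_measure L Z) x))\<^sup>2 * (1 + norm x) powr (s - ?d)) \<partial>lborel)
      \<le> (\<integral>\<^sup>+x. (\<Sum>k. ennreal (c * (2 ^ k) powr p) * ennreal ((cmod (fourier_transform Z x))\<^sup>2 * gauss (1 / 2 ^ k) x)) \<partial>lborel)"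
  proof (rule nn_integral_mono)
    fix x :: 'a
    let ?F = "(cmod (fourier_transform Z x))\<^sup>2"
    have "(cmod (fourier_transform (sum_measure L Z) x))\<^sup>2 = (cmod (fourier_transform L x))\<^sup>2 * ?F"
      by (simp add: fourier_transform_sum_measure[OF L Z.prob_space_axioms sets_L sets_Z] norm_mult power_mult_distrib)
    also have "\<dots> \<le> (D * (1 + norm x) powr (- \<gamma>)) * ?F" by (intro mult_right_mono decay) simp
    finally have "(cmod (fourier_transform (sum_measure L Z) x))\<^sup>2 * (1 + norm x) powr (s - ?d)
        \<le> (D * (1 + norm x) powr (- \<gamma>)) * ?F * (1 + norm x) powr (s - ?d)"
      by (intro mult_right_mono) auto
    also have "\<dots> = (D * ?F) * (1 + norm x) powr p"
      by (simp add: p_def powr_add[symmetric] mult_ac)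
    finally have "ennreal ((cmod (fourier_transform (sum_measure L Z) x))\<^sup>2 * (1 + norm x) powr (s - ?d))
        \<le> ennreal (D * ?F) * ennreal ((1 + norm x) powr p)"
      using D by (simp add: ennreal_mult[symmetric] ennreal_leI)
    also have "\<dots> \<le> ennreal (D * ?F) * (\<Sum>k. ennreal (2 powr \<bar>p\<bar> * exp (4 * pi) * (2 ^ k) powr p) * ennreal (gauss (1 / 2 ^ k) x))"
      by (intro mult_left_mono power_le_dyadic_gauss_sum) simp
    also have "\<dots> = (\<Sum>k. ennreal (D * ?F) * (ennreal (2 powr \<bar>p\<bar> * exp (4 * pi) * (2 ^ k) powr p) * ennreal (gauss (1 / 2 ^ k) x)))"
      by (rule ennreal_suminf_cmult[symmetric])
    also have "\<dots> = (\<Sum>k. ennreal (c * (2 ^ k) powr p) * ennreal (?F * gauss (1 / 2 ^ k) x))"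
      using D by (intro suminf_cong) (simp add: c_def ennreal_mult[symmetric] mult_ac)
    finally show "ennreal ((cmod (fourier_transform (sum_measure L Z) x))\<^sup>2 * (1 + norm x) powr (s - ?d))
        \<le> (\<Sum>k. ennreal (c * (2 ^ k) powr p) * ennreal (?F * gauss (1 / 2 ^ k) x))" .
  qed
  also have "\<dots> = (\<Sum>k. \<integral>\<^sup>+x. ennreal (c * (2 ^ k) powr p) * ennreal ((cmod (fourier_transform Z x))\<^sup>2 * gauss (1 / 2 ^ k) x) \<partial>lborel)"
    by (rule nn_integral_suminf) measurable
  also have "\<dots> = (\<Sum>k. ennreal (c * (2 ^ k) powr p) * (\<integral>\<^sup>+x. ennreal ((cmod (fourier_transform Z x))\<^sup>2 * gauss (1 / 2 ^ k) x) \<partial>lborel))"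
    by (intro suminf_cong nn_integral_cmult) measurable
  also have "\<dots> \<le> (\<Sum>k. ennreal (c * E * (2 powr (s - \<gamma> - \<sigma>)) ^ k))"
  proof (intro suminf_le allI)
    fix k :: nat
    have "(\<integral>\<^sup>+x. ennreal ((cmod (fourier_transform Z x))\<^sup>2 * gauss (1 / 2 ^ k) x) \<partial>lborel)
        \<le> ennreal (E * (1 / 2 ^ k) powr (\<sigma> - ?d))"
      unfolding E_def using C by (intro fourier_energy_le Z.finite_measure_axioms sets_Z) auto
    then have "ennreal (c * (2 ^ k) powr p) * (\<integral>\<^sup>+x. ennreal ((cmod (fourier_transform Z x))\<^sup>2 * gauss (1 / 2 ^ k) x) \<partial>lborel)
        \<le> ennreal (c * (2 ^ k) powr p) * ennreal (E * (1 / 2 ^ k) powr (\<sigma> - ?d))"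
      by (rule mult_left_mono) simp
    also have "\<dots> = ennreal (c * E * ((2 ^ k) powr p * (1 / 2 ^ k) powr (\<sigma> - ?d)))"
      using c E by (simp add: ennreal_mult[symmetric] mult_ac)
    also have "(2 ^ k) powr p * (1 / 2 ^ k) powr (\<sigma> - ?d) = (2 powr (s - \<gamma> - \<sigma>)) ^ k"
    proof -
      have "(1 / 2 ^ k :: real) powr (\<sigma> - ?d) = (2 ^ k) powr (?d - \<sigma>)"
        by (simp add: powr_divide powr_minus_divide[of _ "?d - \<sigma>", simplified])
      moreover have "p + (?d - \<sigma>) = s - \<gamma> - \<sigma>" by (simp add: p_def)
      ultimately have "(2 ^ k) powr p * (1 / 2 ^ k) powr (\<sigma> - ?d) = (2 ^ k :: real) powr (s - \<gamma> - \<sigma>)"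
        by (simp only: powr_add[symmetric])
      also have "\<dots> = (2 powr (s - \<gamma> - \<sigma>)) ^ k"
        by (simp add: powr_realpow[symmetric] powr_powr mult.commute)
      finally show ?thesis .
    qed
    finally show "ennreal (c * (2 ^ k) powr p) * (\<integral>\<^sup>+x. ennreal ((cmod (fourier_transform Z x))\<^sup>2 * gauss (1 / 2 ^ k) x) \<partial>lborel)
        \<le> ennreal (c * E * (2 powr (s - \<gamma> - \<sigma>)) ^ k)" .
  qed auto
  also have "\<dots> < \<infinity>"
  proof -
    have "(2 :: real) powr (s - \<gamma> - \<sigma>) < 2 powr 0" using s by (intro powr_less_mono) auto
    then have "summable (\<lambda>k. c * E * (2 powr (s - \<gamma> - \<sigma>)) ^ k)"
      by (intro summable_mult summable_geometric) simp
    then have "(\<Sum>k. ennreal (c * E * (2 powr (s - \<gamma> - \<sigma>)) ^ k)) = ennreal (\<Sum>k. c * E * (2 powr (s - \<gamma> - \<sigma>)) ^ k)"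
      using c E by (intro suminf_ennreal2) auto
    then show ?thesis by simp
  qed
  finally show ?thesis .
qed

section \<open>From Sobolev energy to small balls\<close>

lemma powr_gauss_le:
  fixes z :: "'a::euclidean_space"
  assumes r: "0 < r" "r \<le> 1" and p: "0 \<le> p"
  shows "gauss r z \<le> exp (p\<^sup>2) * r powr (- p) * (1 + norm z) powr (- p)"
proof -
  define v where "v = r * norm z"
  have v: "0 \<le> v" using r by (simp add: v_def)
  have u: "0 < 1 + norm z" using norm_ge_zero[of z] by linarith
  have "r * (1 + norm z) \<le> 1 + v" using r by (simp add: v_def distrib_left)
  also have "\<dots> \<le> exp v" by (rule exp_ge_add_one_self)
  finally have "(r * (1 + norm z)) powr p \<le> (exp v) powr p"
    using r u p by (intro powr_mono2) auto
  also have "\<dots> = exp (p * v)" by (simp add: powr_def)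
  \<comment> \<open>Completing the square turns the exponential growth in \<open>v\<close> into the
    inverse of the Gaussian.\<close>
  also have "\<dots> \<le> exp (p\<^sup>2 + pi * v\<^sup>2)"
  proof -
    have "0 \<le> (v - p)\<^sup>2" by simp
    then have "2 * (p * v) \<le> v\<^sup>2 + p\<^sup>2" by (simp add: power2_diff mult_ac)
    moreover have "v\<^sup>2 \<le> pi * v\<^sup>2" using pi_gt3 by (simp add: mult_right_mono[of 1 pi "v\<^sup>2", simplified])
    moreover have "0 \<le> v\<^sup>2" "0 \<le> p\<^sup>2" by simp_all
    ultimately have "p * v \<le> p\<^sup>2 + pi * v\<^sup>2" by linarith
    then show ?thesis by simp
  qed
  finally have le: "(r * (1 + norm z)) powr p \<le> exp (p\<^sup>2) * exp (pi * v\<^sup>2)" by (simp add: exp_add)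
  have "gauss r z * (r * (1 + norm z)) powr p \<le> gauss r z * (exp (p\<^sup>2) * exp (pi * v\<^sup>2))"
    by (rule mult_left_mono[OF le]) simp
  also have "\<dots> = exp (p\<^sup>2)"
    by (simp add: gauss_def v_def power_mult_distrib exp_minus mult_ac)
  finally have "gauss r z * (r * (1 + norm z)) powr p * (r * (1 + norm z)) powr (- p)
      \<le> exp (p\<^sup>2) * (r * (1 + norm z)) powr (- p)"
    by (rule mult_right_mono) simp
  moreover have "(r * (1 + norm z)) powr p * (r * (1 + norm z)) powr (- p) = 1"
    using r u by (simp add: powr_add[symmetric])
  moreover have "(r * (1 + norm z)) powr (- p) = r powr (- p) * (1 + norm z) powr (- p)"
    using r u by (simp add: powr_mult)
  ultimately show ?thesis by (simp add: mult.assoc)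
qed

text \<open>The indicator of a ball of radius \<open>r\<close> is at most \<open>exp pi\<close>
  times a Gaussian of width \<open>r\<close>. The energy identity moves it to the Fourier side,
  where the Gaussian is dominated by the Sobolev weight because \<open>u\<close> is at most the
  dimension.\<close>

lemma sobolev_ball_energy:
  fixes \<mu> :: "'a::euclidean_space measure"
  assumes fin: "finite_measure \<mu>" and sets [measurable_cong]: "sets \<mu> = sets borel"
    and sob: "(\<integral>\<^sup>+x. ennreal ((cmod (fourier_transform \<mu> x))\<^sup>2 * (1 + norm x) powr (u - real DIM('a))) \<partial>lborel) < \<infinity>"
    and u: "u \<le> real DIM('a)"
  shows "\<exists>C\<ge>0. \<forall>r. 0 < r \<longrightarrow> r \<le> 1 \<longrightarrow> (\<integral>\<^sup>+x. emeasure \<mu> (cball x r) \<partial>\<mu>) \<le> ennreal (C * r powr u)"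
proof -
  interpret finite_measure \<mu> by fact
  note [measurable] = borel_measurable_fourier_transform[OF fin sets]
  let ?d = "real DIM('a)"
  let ?I = "\<integral>\<^sup>+x. ennreal ((cmod (fourier_transform \<mu> x))\<^sup>2 * (1 + norm x) powr (u - ?d)) \<partial>lborel"
  obtain I where I: "0 \<le> I" "?I = ennreal I" using sob by (cases ?I) auto
  define p where "p = ?d - u"
  have p: "0 \<le> p" using u by (simp add: p_def)
  show ?thesis
  proof (intro exI[of _ "exp pi * exp (p\<^sup>2) * I"] conjI allI impI)
    show "0 \<le> exp pi * exp (p\<^sup>2) * I" using I by simp
    fix r :: real assume r: "0 < r" "r \<le> 1"
    have "(\<integral>\<^sup>+x. emeasure \<mu> (cball x r) \<partial>\<mu>) \<le> (\<integral>\<^sup>+x. \<integral>\<^sup>+y. ennreal (exp pi * r powr ?d) * ennreal (gauss (1 / r) (x - y) / r ^ DIM('a)) \<partial>\<mu> \<partial>\<mu>)"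
    proof (rule nn_integral_mono)
      fix x
      have "emeasure \<mu> (cball x r) = (\<integral>\<^sup>+y. indicator (cball x r) y \<partial>\<mu>)"
        by (rule nn_integral_indicator[symmetric]) (simp add: sets)
      also have "\<dots> \<le> (\<integral>\<^sup>+y. ennreal (exp pi * r powr ?d) * ennreal (gauss (1 / r) (x - y) / r ^ DIM('a)) \<partial>\<mu>)"
      proof (rule nn_integral_mono)
        fix y
        show "indicator (cball x r) y \<le> ennreal (exp pi * r powr ?d) * ennreal (gauss (1 / r) (x - y) / r ^ DIM('a))"
        proof (cases "y \<in> cball x r")
          case True
          then have "(norm (x - y))\<^sup>2 \<le> r\<^sup>2" by (intro power_mono) (auto simp: dist_norm)
          then have "pi * ((norm (x - y))\<^sup>2 / r\<^sup>2) \<le> pi * 1" using r by (intro mult_left_mono) auto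
          then have "1 \<le> exp (pi + - pi * (1 / r)\<^sup>2 * (norm (x - y))\<^sup>2)" by (simp add: power_divide)
          then have "1 \<le> exp pi * gauss (1 / r) (x - y)" by (simp only: exp_add gauss_def)
          also have "\<dots> = exp pi * r powr ?d * (gauss (1 / r) (x - y) / r ^ DIM('a))"
            using r by (simp add: powr_realpow)
          finally have "ennreal 1 \<le> ennreal (exp pi * r powr ?d * (gauss (1 / r) (x - y) / r ^ DIM('a)))"
            by (rule ennreal_leI)
          also have "\<dots> = ennreal (exp pi * r powr ?d) * ennreal (gauss (1 / r) (x - y) / r ^ DIM('a))"
            by (rule ennreal_mult) (use r in auto)
          finally show ?thesis using True by (simp only: indicator_simps ennreal_1)
        qed simp
      qed
      finally show "emeasure \<mu> (cball x r) \<le> (\<integral>\<^sup>+y. ennreal (exp pi * r powr ?d) * ennreal (gauss (1 / r) (x - y) / r ^ DIM('a)) \<partial>\<mu>)" .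
    qed
    also have "\<dots> = ennreal (exp pi * r powr ?d) * (\<integral>\<^sup>+x. \<integral>\<^sup>+y. ennreal (gauss (1 / r) (x - y) / r ^ DIM('a)) \<partial>\<mu> \<partial>\<mu>)"
      by (simp add: nn_integral_cmult)
    also have "(\<integral>\<^sup>+x. \<integral>\<^sup>+y. ennreal (gauss (1 / r) (x - y) / r ^ DIM('a)) \<partial>\<mu> \<partial>\<mu>)
        = (\<integral>\<^sup>+z. ennreal ((cmod (fourier_transform \<mu> z))\<^sup>2 * gauss r z) \<partial>lborel)"
      by (rule gauss_energy_identity[OF fin sets r(1), symmetric])
    also have "\<dots> \<le> (\<integral>\<^sup>+z. ennreal (exp (p\<^sup>2) * r powr (- p)) * ennreal ((cmod (fourier_transform \<mu> z))\<^sup>2 * (1 + norm z) powr (u - ?d)) \<partial>lborel)"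
    proof (rule nn_integral_mono)
      fix z :: 'a
      have "(cmod (fourier_transform \<mu> z))\<^sup>2 * gauss r z
          \<le> (cmod (fourier_transform \<mu> z))\<^sup>2 * (exp (p\<^sup>2) * r powr (- p) * (1 + norm z) powr (- p))"
        by (intro mult_left_mono powr_gauss_le r p) simp
      then show "ennreal ((cmod (fourier_transform \<mu> z))\<^sup>2 * gauss r z)
          \<le> ennreal (exp (p\<^sup>2) * r powr (- p)) * ennreal ((cmod (fourier_transform \<mu> z))\<^sup>2 * (1 + norm z) powr (u - ?d))"
        by (subst ennreal_mult[symmetric]) (auto intro!: ennreal_leI simp: p_def mult_ac)
    qed
    also have "\<dots> = ennreal (exp (p\<^sup>2) * r powr (- p)) * ?I"
      by (rule nn_integral_cmult) measurable
    also have "ennreal (exp pi * r powr ?d) * (ennreal (exp (p\<^sup>2) * r powr (- p)) * ?I)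
        = ennreal (exp pi * exp (p\<^sup>2) * I * (r powr ?d * r powr (- p)))"
      using I by (simp add: ennreal_mult[symmetric] mult_ac)
    also have "r powr ?d * r powr (- p) = r powr u" by (simp add: powr_add[symmetric] p_def)
    finally show "(\<integral>\<^sup>+x. emeasure \<mu> (cball x r) \<partial>\<mu>) \<le> ennreal (exp pi * exp (p\<^sup>2) * I * r powr u)"
      by (simp add: mult_left_mono)
  qed
qed

lemma borel_measurable_emeasure_cball [measurable]:
  fixes \<mu> :: "'a::euclidean_space measure"
  assumes "finite_measure \<mu>" and [measurable_cong]: "sets \<mu> = sets borel"
  shows "(\<lambda>x. emeasure \<mu> (cball x r)) \<in> borel_measurable borel"
proof -
  interpret finite_measure \<mu> by fact
  have "(\<lambda>x. \<integral>\<^sup>+y. indicator {p. norm (fst p - snd p) \<le> r} (x, y) \<partial>\<mu>) \<in> borel_measurable (borel :: 'a measure)"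
    by measurable
  moreover have "(\<integral>\<^sup>+y. indicator {p. norm (fst p - snd p) \<le> r} (x, y) \<partial>\<mu>) = emeasure \<mu> (cball x r)" for x
  proof -
    have "(\<integral>\<^sup>+y. indicator {p. norm (fst p - snd p) \<le> r} (x, y) \<partial>\<mu>) = (\<integral>\<^sup>+y. indicator (cball x r) y \<partial>\<mu>)"
      by (intro nn_integral_cong) (auto simp: indicator_def dist_norm)
    then show ?thesis using assms(2) by simp
  qed
  ultimately show ?thesis by simp
qed

text \<open>
  An average bound on the measure of small balls gives a pointwise bound, with a slightly smaller
  exponent, on a set of positive measure, to which the mass distribution principle applies.
\<close>

lemma ball_energy_pointwise:
  fixes \<mu> :: "'a::euclidean_space measure"
  assumes prob: "prob_space \<mu>" and sets: "sets \<mu> = sets borel" and C: "0 \<le> C"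
    and energy: "\<And>r. 0 < r \<Longrightarrow> r \<le> 1 \<Longrightarrow> (\<integral>\<^sup>+x. emeasure \<mu> (cball x r) \<partial>\<mu>) \<le> ennreal (C * r powr u)"
    and v: "0 < v" "v < u"
  shows "\<exists>B M. B \<in> sets borel \<and> 0 < emeasure \<mu> B \<and> 0 < M \<and>
    (\<forall>x\<in>B. \<forall>\<rho>. 0 \<le> \<rho> \<longrightarrow> \<rho> \<le> 1 \<longrightarrow> emeasure \<mu> (cball x \<rho>) \<le> ennreal (M * \<rho> powr v))"
proof -
  interpret prob_space \<mu> by fact
  note sets' [measurable_cong] = sets
  have mb [measurable]: "(\<lambda>x. emeasure \<mu> (cball x r)) \<in> borel_measurable borel" for r
    by (rule borel_measurable_emeasure_cball[OF finite_measure_axioms sets])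
  \<comment> \<open>Summing the normalised ball measures over all dyadic scales bounds every scale
    at once. The sum has finite integral since \<open>v < u\<close>.\<close>
  define F where "F x = (\<Sum>k. ennreal ((2 ^ k) powr v) * emeasure \<mu> (cball x (1 / 2 ^ k)))" for x
  have [measurable]: "F \<in> borel_measurable borel" unfolding F_def by measurable
  have "(\<integral>\<^sup>+x. F x \<partial>\<mu>) = (\<Sum>k. \<integral>\<^sup>+x. ennreal ((2 ^ k) powr v) * emeasure \<mu> (cball x (1 / 2 ^ k)) \<partial>\<mu>)"
    unfolding F_def by (rule nn_integral_suminf) measurable
  also have "\<dots> = (\<Sum>k. ennreal ((2 ^ k) powr v) * (\<integral>\<^sup>+x. emeasure \<mu> (cball x (1 / 2 ^ k)) \<partial>\<mu>))"
    by (intro suminf_cong nn_integral_cmult) measurable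
  also have "\<dots> \<le> (\<Sum>k. ennreal (C * (2 powr (v - u)) ^ k))"
  proof (intro suminf_le allI)
    fix k :: nat
    have "(\<integral>\<^sup>+x. emeasure \<mu> (cball x (1 / 2 ^ k)) \<partial>\<mu>) \<le> ennreal (C * (1 / 2 ^ k) powr u)"
      by (rule energy) auto
    then have "ennreal ((2 ^ k) powr v) * (\<integral>\<^sup>+x. emeasure \<mu> (cball x (1 / 2 ^ k)) \<partial>\<mu>)
        \<le> ennreal ((2 ^ k) powr v) * ennreal (C * (1 / 2 ^ k) powr u)"
      by (rule mult_left_mono) simp
    also have "\<dots> = ennreal (C * ((2 ^ k) powr v * (1 / 2 ^ k) powr u))"
      using C by (simp add: ennreal_mult[symmetric] mult_ac)
    also have "(2 ^ k) powr v * (1 / 2 ^ k) powr u = (2 powr (v - u)) ^ k"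
    proof -
      have "(2 ^ k) powr v * (1 / 2 ^ k) powr u = (2 ^ k :: real) powr (v - u)"
        by (simp add: powr_divide powr_diff)
      also have "\<dots> = (2 powr (v - u)) ^ k"
        by (simp add: powr_realpow[symmetric] powr_powr mult.commute)
      finally show ?thesis .
    qed
    finally show "ennreal ((2 ^ k) powr v) * (\<integral>\<^sup>+x. emeasure \<mu> (cball x (1 / 2 ^ k)) \<partial>\<mu>) \<le> ennreal (C * (2 powr (v - u)) ^ k)" .
  qed auto
  also have "\<dots> < \<infinity>"
  proof -
    have "(2 :: real) powr (v - u) < 2 powr 0" using v by (intro powr_less_mono) auto
    then have "summable (\<lambda>k. C * (2 powr (v - u)) ^ k)"
      by (intro summable_mult summable_geometric) simp
    then have "(\<Sum>k. ennreal (C * (2 powr (v - u)) ^ k)) = ennreal (\<Sum>k. C * (2 powr (v - u)) ^ k)"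
      using C by (intro suminf_ennreal2) auto
    then show ?thesis by simp
  qed
  finally have "AE x in \<mu>. F x \<noteq> \<infinity>" by (intro nn_integral_noteq_infinite) auto
  define B where "B m = {x. F x \<le> of_nat m}" for m :: nat
  have mB: "B m \<in> sets borel" for m unfolding B_def by measurable
  have "\<exists>m. 0 < emeasure \<mu> (B m)"
  proof (rule ccontr)
    assume "\<nexists>m. 0 < emeasure \<mu> (B m)"
    then have "B m \<in> null_sets \<mu>" for m using mB sets by (auto simp: null_sets_def)
    then have "(\<Union>m. B m) \<in> null_sets \<mu>" by (rule null_sets_UN)
    then have "AE x in \<mu>. x \<notin> (\<Union>m. B m)" by (rule AE_not_in)
    with \<open>AE x in \<mu>. F x \<noteq> \<infinity>\<close> have "AE x in \<mu>. False"
    proof eventually_elim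
      fix x assume "F x \<noteq> \<infinity>" "x \<notin> (\<Union>m. B m)"
      moreover obtain m :: nat where "F x \<le> of_nat m"
        using ennreal_Ex_less_of_nat[of "F x"] \<open>F x \<noteq> \<infinity>\<close> by (auto simp: less_top[symmetric] intro: less_imp_le)
      ultimately show False by (auto simp: B_def)
    qed
    then show False by simp
  qed
  then obtain m where m: "0 < emeasure \<mu> (B m)" ..
  \<comment> \<open>The factor \<open>2 powr v\<close> comes from enlarging a radius to the next
    dyadic one.\<close>
  define M where "M = (real m + 1) * 2 powr v"
  have M: "0 < M" by (simp add: M_def)
  have pos: "emeasure \<mu> (cball x \<rho>) \<le> ennreal (M * \<rho> powr v)" if x: "x \<in> B m" and \<rho>: "0 < \<rho>" "\<rho> \<le> 1" for x \<rho>
  proof -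
    obtain n where "(1/2 :: real) ^ n < \<rho>" using real_arch_pow_inv[of \<rho> "1/2"] \<rho> by auto
    moreover have "\<not> (1/2 :: real) ^ 0 < \<rho>" using \<rho> by simp
    ultimately have "\<exists>k<n. (\<forall>i\<le>k. \<not> (1/2) ^ i < \<rho>) \<and> (1/2 :: real) ^ Suc k < \<rho>"
      by (rule ex_least_nat_less)
    then obtain k where k0: "\<not> (1/2) ^ k < \<rho>" "(1/2 :: real) ^ Suc k < \<rho>" by blast
    have k: "\<rho> \<le> 1 / 2 ^ k" "1 / 2 ^ k \<le> 2 * \<rho>"
      using k0 by (simp_all add: power_one_over)
    define f where "f k = ennreal ((2 ^ k) powr v) * emeasure \<mu> (cball x (1 / 2 ^ k))" for k
    have "f k \<le> (\<Sum>k. f k)" using sum_le_suminf[of f "{k}"] by simp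
    also have "\<dots> = F x" by (simp add: F_def f_def)
    also have "\<dots> \<le> of_nat m" using x by (simp add: B_def)
    finally have fk: "f k \<le> ennreal (real m)" by (simp add: ennreal_of_nat_eq_real_of_nat)
    have "emeasure \<mu> (cball x \<rho>) \<le> emeasure \<mu> (cball x (1 / 2 ^ k))"
      using k by (intro emeasure_mono subset_cball) (auto simp: sets)
    also have "\<dots> = ennreal ((1 / 2 ^ k) powr v) * f k"
    proof -
      have "(1 / 2 ^ k :: real) powr v * (2 ^ k) powr v = 1" by (simp add: powr_divide)
      then show ?thesis by (simp add: f_def mult.assoc[symmetric] ennreal_mult[symmetric])
    qed
    also have "\<dots> \<le> ennreal ((2 * \<rho>) powr v) * ennreal (real m)"
      using k v by (intro mult_mono fk ennreal_leI powr_mono2) auto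
    also have "\<dots> = ennreal (real m * 2 powr v * \<rho> powr v)"
      using \<rho> by (simp add: powr_mult ennreal_mult[symmetric] mult_ac)
    also have "\<dots> \<le> ennreal (M * \<rho> powr v)"
      by (intro ennreal_leI mult_right_mono) (auto simp: M_def)
    finally show ?thesis .
  qed
  have "emeasure \<mu> (cball x \<rho>) \<le> ennreal (M * \<rho> powr v)" if x: "x \<in> B m" and \<rho>: "0 \<le> \<rho>" "\<rho> \<le> 1" for x \<rho>
  proof (cases "\<rho> = 0")
    case False
    then show ?thesis using pos x \<rho> by simp
  next
    \<comment> \<open>Radius 0 has to be covered as well, since \<open>0 powr v = 0\<close>:
      covering sets of diameter 0 must carry no mass.\<close>
    case True
    have "emeasure \<mu> (cball x 0) \<le> 0"
    proof (rule ennreal_le_epsilon)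
      fix e :: real assume e: "0 < e"
      define r where "r = min 1 ((e / M) powr (1 / v))"
      have r: "0 < r" "r \<le> 1" using e M by (auto simp: r_def)
      have "r powr v \<le> ((e / M) powr (1 / v)) powr v" using r v by (intro powr_mono2) (auto simp: r_def)
      also have "\<dots> = e / M" using v e M by (simp add: powr_powr)
      finally have "M * r powr v \<le> e" using M by (simp add: field_simps)
      have "emeasure \<mu> (cball x 0) \<le> emeasure \<mu> (cball x r)"
        using r by (intro emeasure_mono subset_cball) (auto simp: sets)
      also have "\<dots> \<le> ennreal (M * r powr v)" by (rule pos[OF x r])
      also have "\<dots> \<le> ennreal e" using \<open>M * r powr v \<le> e\<close> by (rule ennreal_leI)
      finally show "emeasure \<mu> (cball x 0) \<le> 0 + ennreal e" by simp
    qed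
    then show ?thesis using True by simp
  qed
  with mB m M show ?thesis by blast
qed

text \<open>A cover of \<open>A\<close> whose total \<open>s\<close>-th power is tiny would cover
  the part of positive measure on which balls are small, and force that measure to vanish.\<close>

lemma hausdorff_dim_ge_of_ball_energy:
  fixes \<mu> :: "'a::euclidean_space measure"
  assumes prob: "prob_space \<mu>" and sets: "sets \<mu> = sets borel" and K: "K \<subseteq> A" "AE x in \<mu>. x \<in> K"
    and C: "0 \<le> C"
    and energy: "\<And>r. 0 < r \<Longrightarrow> r \<le> 1 \<Longrightarrow> (\<integral>\<^sup>+x. emeasure \<mu> (cball x r) \<partial>\<mu>) \<le> ennreal (C * r powr u)"
  shows "ereal u \<le> hausdorff_dim A"
  unfolding hausdorff_dim_def
proof (rule Inf_greatest)
  interpret prob_space \<mu> by fact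
  fix y assume "y \<in> ereal ` {s. 0 \<le> s \<and> hausdorff_measure s A = 0}"
  then obtain s where s: "y = ereal s" "0 \<le> s" "hausdorff_measure s A = 0" by auto
  show "ereal u \<le> y"
  proof (rule ccontr)
    assume "\<not> ereal u \<le> y"
    then have "s < u" using s by simp
    then obtain v where v: "s < v" "v < u" using dense by blast
    then have "0 < v" using s by simp
    from ball_energy_pointwise[OF prob sets C energy this v(2)]
    obtain B M where B: "B \<in> sets borel" "0 < emeasure \<mu> B" "0 < M"
      "\<And>x \<rho>. x \<in> B \<Longrightarrow> 0 \<le> \<rho> \<Longrightarrow> \<rho> \<le> 1 \<Longrightarrow> emeasure \<mu> (cball x \<rho>) \<le> ennreal (M * \<rho> powr v)"
      by blast
    have "hausdorff_premeasure 1 s A \<le> hausdorff_measure s A"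
      unfolding hausdorff_measure_def by (intro SUP_upper) simp
    then have zero: "hausdorff_premeasure 1 s A = 0" using s by simp
    have "emeasure \<mu> B \<le> 0"
    proof (rule ennreal_le_epsilon)
      fix e :: real assume e: "0 < e"
      have "hausdorff_premeasure 1 s A < ennreal (e / M)" using zero e B(3) by simp
      then obtain U :: "nat \<Rightarrow> 'a set" where U: "A \<subseteq> (\<Union>i. U i)" "\<And>i. bounded (U i)" "\<And>i. diameter (U i) \<le> 1"
          "(\<Sum>i. diam_pow s (U i)) < ennreal (e / M)"
        unfolding hausdorff_premeasure_def Inf_less_iff by auto
      \<comment> \<open>Covering sets need not be measurable and the ball bound holds only around
        points of \<open>B\<close>. So each set meeting \<open>B\<close> is replaced by a ball
        around such a point with the diameter as radius.\<close>
      define V where "V i = (if U i \<inter> B = {} then {} else cball (SOME x. x \<in> U i \<inter> B) (diameter (U i)))" for i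
      have UV: "U i \<inter> B \<subseteq> V i" for i
      proof
        fix x assume x: "x \<in> U i \<inter> B"
        then have "(SOME x. x \<in> U i \<inter> B) \<in> U i \<inter> B" by (rule someI)
        then have "dist (SOME x. x \<in> U i \<inter> B) x \<le> diameter (U i)"
          using x by (intro diameter_bounded_bound U(2)) auto
        then show "x \<in> V i" using x by (auto simp: V_def)
      qed
      have V_closed: "closed (V i)" for i by (simp add: V_def)
      have V_le: "emeasure \<mu> (V i) \<le> ennreal M * diam_pow s (U i)" for i
      proof (cases "U i \<inter> B = {}")
        case False
        define x where "x = (SOME x. x \<in> U i \<inter> B)"
        have x: "x \<in> U i \<inter> B" unfolding x_def using False by (metis ex_in_conv someI_ex)
        define \<rho> where "\<rho> = diameter (U i)"
        have \<rho>: "0 \<le> \<rho>" "\<rho> \<le> 1" unfolding \<rho>_def using U by (auto intro: diameter_ge_0)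
        have "emeasure \<mu> (V i) \<le> ennreal (M * \<rho> powr v)"
          using B(4)[of x \<rho>] x \<rho> False by (simp add: V_def x_def \<rho>_def)
        also have "\<dots> = ennreal M * ennreal (\<rho> powr v)" using B(3) by (simp add: ennreal_mult)
        also have "ennreal (\<rho> powr v) \<le> diam_pow s (U i)"
        proof (cases "s = 0")
          \<comment> \<open>Here \<open>diam_pow\<close> is 1 by convention, also for sets of
            diameter 0.\<close>
          case True
          have "\<rho> powr v \<le> 1" using \<rho> \<open>0 < v\<close> by (intro powr_le1) auto
          then show ?thesis using True False by (auto simp: diam_pow_def)
        next
          case s0: False
          have "\<rho> powr v \<le> \<rho> powr s" using \<rho> v by (intro powr_mono') auto
          then show ?thesis using s0 False by (auto simp: diam_pow_def \<rho>_def ennreal_leI)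
        qed
        finally show ?thesis by (simp add: mult_left_mono)
      qed (simp add: V_def)
      have "emeasure \<mu> B \<le> emeasure \<mu> (\<Union>i. V i)"
      proof (rule emeasure_mono_AE)
        from K(2) show "AE x in \<mu>. x \<in> B \<longrightarrow> x \<in> (\<Union>i. V i)"
        proof eventually_elim
          fix x assume "x \<in> K"
          then have "x \<in> (\<Union>i. U i)" using K(1) U(1) by blast
          then show "x \<in> B \<longrightarrow> x \<in> (\<Union>i. V i)" using UV by blast
        qed
        show "(\<Union>i. V i) \<in> sets \<mu>" unfolding sets by (intro sets.countable_UN) (auto intro: borel_closed V_closed)
      qed
      also have "\<dots> \<le> (\<Sum>i. emeasure \<mu> (V i))"
        by (rule emeasure_subadditive_countably) (auto simp: sets intro: borel_closed V_closed)
      also have "\<dots> \<le> (\<Sum>i. ennreal M * diam_pow s (U i))" by (intro suminf_le V_le) auto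
      also have "\<dots> = ennreal M * (\<Sum>i. diam_pow s (U i))" by (rule ennreal_suminf_cmult)
      also have "\<dots> \<le> ennreal M * ennreal (e / M)" by (rule mult_left_mono[OF less_imp_le[OF U(4)]]) simp
      also have "\<dots> = ennreal (M * (e / M))" using B(3) e by (intro ennreal_mult[symmetric]) auto
      also have "M * (e / M) = e" using B(3) by simp
      finally show "emeasure \<mu> B \<le> 0 + ennreal e" by simp
    qed
    with B(2) show False by simp
  qed
qed

section \<open>Averages of ball measures against Lebesgue measure\<close>

lemma ball_average_fubini:
  fixes \<mu> :: "'a::euclidean_space measure"
  assumes fin: "finite_measure \<mu>" and sets [measurable_cong]: "sets \<mu> = sets borel"
    and f [measurable]: "f \<in> borel_measurable borel"
  shows "(\<integral>\<^sup>+x. emeasure \<mu> (cball x r) * f x \<partial>lborel)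
    = (\<integral>\<^sup>+y. (\<integral>\<^sup>+x. indicator (cball y r) x * f x \<partial>lborel) \<partial>\<mu>)"
proof -
  interpret finite_measure \<mu> by fact
  interpret P: pair_sigma_finite "lborel :: 'a measure" \<mu> ..
  let ?S = "{p :: 'a \<times> 'a. norm (fst p - snd p) \<le> r}"
  have ind: "indicator ?S (x, y) = (indicator (cball x r) y :: ennreal)"
    "indicator ?S (x, y) = (indicator (cball y r) x :: ennreal)" for x y
    by (auto simp: indicator_def dist_norm norm_minus_commute)
  have "(\<integral>\<^sup>+x. emeasure \<mu> (cball x r) * f x \<partial>lborel) = (\<integral>\<^sup>+x. (\<integral>\<^sup>+y. indicator ?S (x, y) * f x \<partial>\<mu>) \<partial>lborel)"
  proof (intro nn_integral_cong)
    fix x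
    have "cball x r \<in> sets \<mu>" by (simp add: sets)
    then show "emeasure \<mu> (cball x r) * f x = (\<integral>\<^sup>+y. indicator ?S (x, y) * f x \<partial>\<mu>)"
      unfolding ind(1) by (subst nn_integral_multc) (auto intro: borel_measurable_indicator)
  qed
  also have "\<dots> = (\<integral>\<^sup>+y. (\<integral>\<^sup>+x. indicator ?S (x, y) * f x \<partial>lborel) \<partial>\<mu>)"
    by (rule P.Fubini'[symmetric]) measurable
  finally show ?thesis unfolding ind(2) .
qed

lemma ball_average:
  fixes \<mu> :: "'a::euclidean_space measure"
  assumes prob: "prob_space \<mu>" and sets: "sets \<mu> = sets borel" and r: "0 \<le> r"
  shows "(\<integral>\<^sup>+x. emeasure \<mu> (cball x r) \<partial>lborel) = ennreal (unit_ball_vol (real DIM('a)) * r ^ DIM('a))"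
proof -
  interpret prob_space \<mu> by fact
  have "(\<integral>\<^sup>+x. emeasure \<mu> (cball x r) * 1 \<partial>lborel)
      = (\<integral>\<^sup>+y. (\<integral>\<^sup>+x. indicator (cball y r) x * 1 \<partial>lborel) \<partial>\<mu>)"
    by (rule ball_average_fubini[OF finite_measure_axioms sets]) simp
  also have "\<dots> = (\<integral>\<^sup>+y. ennreal (unit_ball_vol (real DIM('a)) * r ^ DIM('a)) \<partial>\<mu>)"
    using r by (simp add: emeasure_cball)
  finally show ?thesis by (simp add: emeasure_space_1)
qed

lemma emeasure_cball_disjoint_support:
  assumes "emeasure \<mu> (- K) = 0" "- K \<in> sets \<mu>" "cball x r \<inter> K = {}"
  shows "emeasure \<mu> (cball x r) = 0"
proof -
  have "emeasure \<mu> (cball x r) \<le> emeasure \<mu> (- K)"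
    using assms by (intro emeasure_mono) auto
  then show ?thesis using assms by simp
qed

text \<open>The Lebesgue integral of the measure of \<open>r\<close>-balls is the volume of such a
  ball, while the Frostman bound makes it at most a constant times \<open>r powr s\<close>; for
  larger \<open>s\<close> this fails as \<open>r\<close> tends to 0.\<close>

lemma frostman_exponent_le_DIM:
  fixes \<mu> :: "'a::euclidean_space measure"
  assumes \<mu>: "frostman_measure s K \<mu>"
  shows "s \<le> real DIM('a)"
proof (rule ccontr)
  assume "\<not> s \<le> real DIM('a)"
  then have s: "0 < s - real DIM('a)" by simp
  note D = frostman_measureD[OF \<mu>]
  obtain C where C: "0 < C" "\<And>x r. 0 < r \<Longrightarrow> emeasure \<mu> (cball x r) \<le> ennreal (C * r powr s)"
    using frostman_measure_ball[OF \<mu>] by blast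
  obtain M where M: "\<And>x. x \<in> K \<Longrightarrow> norm x \<le> M"
    using compact_imp_bounded[OF D(1)] unfolding bounded_iff by blast
  have mK: "- K \<in> sets \<mu>" using D by (simp add: compact_imp_closed borel_open open_Compl)
  define v where "v = unit_ball_vol (real DIM('a))"
  have v: "0 < v" by (simp add: v_def)
  define V where "V = measure lborel (cball (0 :: 'a) (M + 1)) + 1"
  have V: "0 < V" by (simp add: V_def add_nonneg_pos)
  have le: "v \<le> C * V * r powr (s - real DIM('a))" if r: "0 < r" "r \<le> 1" for r
  proof -
    have "ennreal (v * r ^ DIM('a)) = (\<integral>\<^sup>+x. emeasure \<mu> (cball x r) \<partial>lborel)"
      unfolding v_def by (rule ball_average[symmetric]) (use r D frostman_measure_prob[OF \<mu>] in auto)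
    also have "\<dots> \<le> (\<integral>\<^sup>+x. ennreal (C * r powr s) * indicator (cball (0 :: 'a) (M + 1)) x \<partial>lborel)"
    proof (rule nn_integral_mono)
      fix x
      show "emeasure \<mu> (cball x r) \<le> ennreal (C * r powr s) * indicator (cball 0 (M + 1)) x"
      proof (cases "x \<in> cball 0 (M + 1)")
        case True
        then show ?thesis using C(2)[OF r(1)] by simp
      next
        case False
        have "y \<notin> K" if "y \<in> cball x r" for y
        proof
          assume "y \<in> K"
          then have "norm x \<le> M + norm (x - y)"
            using M[of y] norm_triangle_ineq[of y "x - y"] by simp
          with that r False show False by (simp add: dist_norm)
        qed
        then have "emeasure \<mu> (cball x r) = 0"
          by (intro emeasure_cball_disjoint_support[OF D(4) mK]) auto
        then show ?thesis by simp
      qed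
    qed
    also have "\<dots> = ennreal (C * r powr s) * emeasure lborel (cball (0 :: 'a) (M + 1))"
      by (rule nn_integral_cmult_indicator) simp
    also have "emeasure lborel (cball (0 :: 'a) (M + 1)) \<le> ennreal V"
      using emeasure_lborel_cball_finite[of "0 :: 'a" "M + 1"]
      by (subst emeasure_eq_ennreal_measure) (auto simp: V_def intro!: ennreal_leI)
    finally have "ennreal (v * r ^ DIM('a)) \<le> ennreal (C * r powr s) * ennreal V"
      by (simp add: mult_left_mono)
    then have "v * r ^ DIM('a) \<le> C * r powr s * V"
      using C V r by (simp add: ennreal_mult[symmetric])
    then have "v * r powr real DIM('a) \<le> (C * V * r powr (s - real DIM('a))) * r powr real DIM('a)"
      using r by (simp add: powr_realpow powr_diff mult_ac)
    then show ?thesis using r by simp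
  qed
  define p where "p = s - real DIM('a)"
  define r where "r = min 1 ((v / (2 * (C * V))) powr (1 / p))"
  have r: "0 < r" "r \<le> 1" using v C V by (auto simp: r_def)
  have "r powr p \<le> ((v / (2 * (C * V))) powr (1 / p)) powr p"
    using r s by (intro powr_mono2) (auto simp: r_def p_def)
  also have "\<dots> = v / (2 * (C * V))" using s v C V by (simp add: powr_powr p_def)
  finally have "C * V * r powr p \<le> C * V * (v / (2 * (C * V)))"
    using C V by (intro mult_left_mono) auto
  also have "\<dots> = v / 2" using C V by simp
  finally show False using le[OF r] v by (simp add: p_def)
qed

text \<open>
  If the measure of balls is on average comparable to their volume, then by the Cauchy--Schwarz
  inequality every neighbourhood of the support has volume bounded below.
\<close>

lemma lborel_pos_of_ball_energy:
  fixes \<mu> :: "'a::euclidean_space measure"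
  assumes prob: "prob_space \<mu>" and sets: "sets \<mu> = sets borel" and K: "compact K" "emeasure \<mu> (- K) = 0"
    and C: "0 \<le> C"
    and energy: "\<And>r. 0 < r \<Longrightarrow> r \<le> 1 \<Longrightarrow> (\<integral>\<^sup>+x. emeasure \<mu> (cball x r) \<partial>\<mu>) \<le> ennreal (C * r powr real DIM('a))"
  shows "0 < emeasure lborel K"
proof (rule ccontr)
  assume "\<not> 0 < emeasure lborel K"
  then have null: "emeasure lborel K = 0" by simp
  interpret prob_space \<mu> by fact
  have [measurable]: "(\<lambda>x. emeasure \<mu> (cball x r)) \<in> borel_measurable borel" for r
    by (rule borel_measurable_emeasure_cball[OF finite_measure_axioms sets])
  have mK: "- K \<in> sets \<mu>" using K sets by (simp add: compact_imp_closed borel_open open_Compl)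
  let ?d = "DIM('a)"
  define v where "v = unit_ball_vol (real ?d)"
  have v: "0 < v" by (simp add: v_def)
  define c where "c = C * 2 ^ ?d + 1"
  have c1: "0 < c" using C by (simp add: c_def add_nonneg_pos)
  \<comment> \<open>If the support were null, a neighbourhood would have volume at most
    \<open>e\<close>; the estimates then give v \<le> c e = v/2.\<close>
  define e where "e = v / (2 * c)"
  have e: "0 < e" using v c1 by (simp add: e_def)
  have "K \<in> sets borel" using K(1) by (simp add: compact_imp_closed borel_closed)
  from outer_regular_lborel[OF this e]
  obtain U where U: "open U" "K \<subseteq> U" "emeasure lborel (U - K) < ennreal e"
    by blast
  have mU [measurable]: "U \<in> sets borel" using U(1) by (rule borel_open)
  have "emeasure lborel U \<le> emeasure lborel K + emeasure lborel (U - K)"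
    using U(2) emeasure_subadditive[of K lborel "U - K"] \<open>K \<in> sets borel\<close> mU
    by (simp add: Un_absorb1 Un_Diff_cancel)
  then have LU: "emeasure lborel U \<le> ennreal e" using U(3) null by simp
  obtain \<rho> where \<rho>: "0 < \<rho>" "(\<Union>x\<in>K. cball x \<rho>) \<subseteq> U"
    using compact_subset_open_imp_cball_epsilon_subset[OF K(1) U(1,2)] by blast
  \<comment> \<open>Balls of radius \<open>r\<close> around points outside \<open>U\<close> must
    miss \<open>K\<close>, and the energy bound is applied at radius \<open>2 * r\<close>.\<close>
  define r where "r = min \<rho> (1 / 2)"
  have r: "0 < r" "2 * r \<le> 1" "r \<le> \<rho>" using \<rho>(1) by (auto simp: r_def)
  have zero: "emeasure \<mu> (cball x r) = 0" if "x \<notin> U" for x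
  proof (rule emeasure_cball_disjoint_support[OF K(2) mK])
    show "cball x r \<inter> K = {}"
    proof (rule ccontr)
      assume "cball x r \<inter> K \<noteq> {}"
      then obtain y where "y \<in> K" "dist x y \<le> r" by auto
      then have "x \<in> (\<Union>x\<in>K. cball x \<rho>)" using r(3) by (auto simp: dist_commute intro!: bexI[of _ y])
      then show False using \<rho>(2) that by blast
    qed
  qed
  let ?V = "ennreal (v * r ^ ?d)"
  \<comment> \<open>Writing one factor as an integral and exchanging, \<open>x\<close> is within
    \<open>r\<close> of \<open>y\<close>; the other ball is then contained in the ball of radius
    \<open>2 * r\<close> around \<open>y\<close>.\<close>
  have sq: "(\<integral>\<^sup>+x. emeasure \<mu> (cball x r) * emeasure \<mu> (cball x r) \<partial>lborel) \<le> ?V * ennreal (C * (2 * r) powr real ?d)"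
  proof -
    have "(\<integral>\<^sup>+x. emeasure \<mu> (cball x r) * emeasure \<mu> (cball x r) \<partial>lborel)
        = (\<integral>\<^sup>+y. (\<integral>\<^sup>+x. indicator (cball y r) x * emeasure \<mu> (cball x r) \<partial>lborel) \<partial>\<mu>)"
      by (rule ball_average_fubini[OF finite_measure_axioms sets]) measurable
    also have "\<dots> \<le> (\<integral>\<^sup>+y. ?V * emeasure \<mu> (cball y (2 * r)) \<partial>\<mu>)"
    proof (rule nn_integral_mono)
      fix y
      have "(\<integral>\<^sup>+x. indicator (cball y r) x * emeasure \<mu> (cball x r) \<partial>lborel)
          \<le> (\<integral>\<^sup>+x. emeasure \<mu> (cball y (2 * r)) * indicator (cball y r) x \<partial>lborel)"
      proof (rule nn_integral_mono)
        fix x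
        show "indicator (cball y r) x * emeasure \<mu> (cball x r) \<le> emeasure \<mu> (cball y (2 * r)) * indicator (cball y r) x"
        proof (cases "x \<in> cball y r")
          case True
          have "cball x r \<subseteq> cball y (2 * r)"
          proof
            fix z assume "z \<in> cball x r"
            with True have "z \<in> cball y (r + r)" by (rule cball_trans)
            then show "z \<in> cball y (2 * r)" by (simp only: mult_2)
          qed
          then have "emeasure \<mu> (cball x r) \<le> emeasure \<mu> (cball y (2 * r))"
            by (rule emeasure_mono) (simp add: sets)
          then show ?thesis using True by simp
        qed simp
      qed
      also have "\<dots> = emeasure \<mu> (cball y (2 * r)) * ?V"
        using r by (subst nn_integral_cmult_indicator) (auto simp: emeasure_cball v_def)
      finally show "(\<integral>\<^sup>+x. indicator (cball y r) x * emeasure \<mu> (cball x r) \<partial>lborel) \<le> ?V * emeasure \<mu> (cball y (2 * r))"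
        by (simp only: mult.commute)
    qed
    also have "\<dots> = ?V * (\<integral>\<^sup>+y. emeasure \<mu> (cball y (2 * r)) \<partial>\<mu>)"
      by (rule nn_integral_cmult) (simp add: measurable_cong_sets[OF sets refl])
    also have "\<dots> \<le> ?V * ennreal (C * (2 * r) powr real ?d)"
      using r by (intro mult_left_mono energy) auto
    finally show ?thesis .
  qed
  have "?V\<^sup>2 = (\<integral>\<^sup>+x. emeasure \<mu> (cball x r) \<partial>lborel)\<^sup>2"
    unfolding v_def using r by (subst ball_average[OF prob sets]) auto
  also have "(\<integral>\<^sup>+x. emeasure \<mu> (cball x r) \<partial>lborel) = (\<integral>\<^sup>+x. emeasure \<mu> (cball x r) * indicator U x \<partial>lborel)"
    by (intro nn_integral_cong) (auto simp: indicator_def zero)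
  also have "(\<dots>)\<^sup>2 \<le> (\<integral>\<^sup>+x. (emeasure \<mu> (cball x r))\<^sup>2 \<partial>lborel) * (\<integral>\<^sup>+x. (indicator U x)\<^sup>2 \<partial>lborel)"
    by (rule Cauchy_Schwarz_nn_integral) measurable
  also have "(\<integral>\<^sup>+x. (indicator U x)\<^sup>2 \<partial>lborel) = emeasure lborel U"
  proof -
    have "(\<integral>\<^sup>+x. (indicator U x)\<^sup>2 \<partial>lborel) = (\<integral>\<^sup>+x. indicator U x \<partial>lborel)"
      by (intro nn_integral_cong) (simp add: indicator_def)
    then show ?thesis using mU by simp
  qed
  finally have "?V\<^sup>2 \<le> (\<integral>\<^sup>+x. (emeasure \<mu> (cball x r))\<^sup>2 \<partial>lborel) * emeasure lborel U" .
  also have "\<dots> \<le> ?V * ennreal (C * (2 * r) powr real ?d) * ennreal e"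
    by (rule mult_mono[OF _ LU]) (use sq in \<open>simp_all add: power2_eq_square\<close>)
  finally have "?V\<^sup>2 \<le> ?V * ennreal (C * (2 * r) powr real ?d) * ennreal e" .
  then have "(v * r ^ ?d)\<^sup>2 \<le> v * r ^ ?d * (C * (2 * r) powr real ?d) * e"
    using v r C e by (simp add: ennreal_mult[symmetric] ennreal_power)
  also have "(2 * r) powr real ?d = 2 ^ ?d * r ^ ?d"
    using r by (simp add: powr_realpow power_mult_distrib)
  finally have "(v * (r ^ ?d)\<^sup>2) * v \<le> (v * (r ^ ?d)\<^sup>2) * (C * 2 ^ ?d * e)"
    by (simp add: power2_eq_square mult_ac)
  then have "v \<le> C * 2 ^ ?d * e" using v r by simp
  also have "\<dots> \<le> c * e" using e by (intro mult_right_mono) (auto simp: c_def)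
  also have "\<dots> = v / 2" using c1 by (simp add: e_def)
  finally show False using v by simp
qed

section \<open>Images of sets\<close>

text \<open>The outer measure of the image is thus continuous from below on arbitrary sets, as
  capacitability requires.\<close>

lemma outer_measure_continuous_image_incseq:
  fixes f :: "'a \<Rightarrow> 'b::euclidean_space"
  assumes "incseq A"
  shows "outer_measure_of lborel (f ` (\<Union>n. A n)) \<le> (SUP n. outer_measure_of lborel (f ` A n))"
proof -
  have "incseq (\<lambda>n. f ` A n)" using assms by (auto simp: incseq_def)
  then have "(SUP n. outer_measure_of lborel (f ` A n)) = outer_measure_of lborel (\<Union>n. f ` A n)"
    by (intro SUP_outer_measure_of_incseq) auto
  then show ?thesis by (simp add: image_UN)
qed

lemma compact_image_outer_approx:
  fixes f :: "'a::euclidean_space \<Rightarrow> 'b::euclidean_space"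
  assumes f: "continuous_on UNIV f" and B: "B \<in> sets borel" "bounded B"
    and c: "c < outer_measure_of lborel (f ` B)"
  shows "\<exists>K. compact K \<and> K \<subseteq> B \<and> c \<le> emeasure lborel (f ` K)"
proof -
  obtain m where "\<forall>x\<in>B. norm x \<le> m" using B(2) unfolding bounded_iff by blast
  then have m: "B \<subseteq> cball 0 m" by auto
  obtain K where K: "compact K" "K \<subseteq> B"
      "\<And>U. open U \<Longrightarrow> K \<subseteq> U \<Longrightarrow> c \<le> outer_measure_of lborel (f ` U)"
  proof (atomize_elim, rule capacitability[of "\<lambda>A. outer_measure_of lborel (f ` A)" "cball 0 m" B c])
    show "analytic_set B" by (rule analytic_set_borel[OF B(1)])
    show "B \<subseteq> cball 0 m" by (rule m)
    show "c < outer_measure_of lborel (f ` B)" by (rule c)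
    show "outer_measure_of lborel (f ` S) \<le> outer_measure_of lborel (f ` S')" if "S \<subseteq> S'" for S S'
      using that by (intro outer_measure_of_mono image_mono)
    show "outer_measure_of lborel (f ` (\<Union>n. A n)) \<le> (SUP n. outer_measure_of lborel (f ` A n))"
      if "incseq A" for A
      using that by (rule outer_measure_continuous_image_incseq)
  next
    fix K assume "compact K" "K \<subseteq> B" "\<And>U. open U \<Longrightarrow> K \<subseteq> U \<Longrightarrow> c \<le> outer_measure_of lborel (f ` U)"
    then show "\<exists>K. compact K \<and> K \<subseteq> B \<and> (\<forall>U. open U \<longrightarrow> K \<subseteq> U \<longrightarrow> c \<le> outer_measure_of lborel (f ` U))"
      by blast
  qed simp
  have cfK: "compact (f ` K)"
    by (rule compact_continuous_image[OF continuous_on_subset[OF f] K(1)]) simp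
  then have mfK: "f ` K \<in> sets borel" by (simp add: compact_imp_closed borel_closed)
  have "c \<le> emeasure lborel (f ` K)"
  proof (rule ennreal_le_epsilon)
    fix e :: real assume "0 < e"
    from outer_regular_lborel[OF mfK this]
    obtain V where V: "open V" "f ` K \<subseteq> V" "emeasure lborel (V - f ` K) < ennreal e" by blast
    \<comment> \<open>Neighbourhoods of the image pull back to neighbourhoods of \<open>K\<close>,
      so outer regularity passes the bound from open sets to \<open>K\<close> itself.\<close>
    have "c \<le> outer_measure_of lborel (f ` (f -` V))"
      by (rule K(3)) (use V f in \<open>auto intro: open_vimage\<close>)
    also have "\<dots> \<le> outer_measure_of lborel V" by (intro outer_measure_of_mono) auto
    also have "\<dots> = emeasure lborel V" using V(1) by simp
    also have "\<dots> = emeasure lborel (f ` K \<union> (V - f ` K))" using V(2) by (simp add: Un_absorb1)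
    also have "\<dots> \<le> emeasure lborel (f ` K) + emeasure lborel (V - f ` K)"
      using mfK V(1) by (intro emeasure_subadditive) auto
    also have "\<dots> \<le> emeasure lborel (f ` K) + ennreal e" using V(3) by (intro add_left_mono) simp
    finally show "c \<le> emeasure lborel (f ` K) + ennreal e" .
  qed
  with K show ?thesis by blast
qed

text \<open>Compact subsets of \<open>B\<close> exhaust the outer measure of the image, which is
  finite as \<open>B\<close> is bounded. The image therefore lies between two Borel sets of equal
  finite measure.\<close>

lemma lebesgue_measurable_bounded_image:
  fixes f :: "'a::euclidean_space \<Rightarrow> 'b::euclidean_space"
  assumes f: "continuous_on UNIV f" and B: "B \<in> sets borel" "bounded B"
  shows "f ` B \<in> sets lebesgue"
proof -
  obtain E where E: "E \<in> sets lborel" "f ` B \<subseteq> E" "outer_measure_of lborel (f ` B) = emeasure lborel E"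
    using outer_measure_of_attain[of "f ` B" lborel] by auto
  obtain m where "\<forall>x\<in>B. norm x \<le> m" using B(2) unfolding bounded_iff by blast
  then have m: "B \<subseteq> cball 0 m" by auto
  have "compact (f ` cball 0 m)"
    by (rule compact_continuous_image[OF continuous_on_subset[OF f]]) auto
  then have "emeasure lborel (f ` cball 0 m) < \<infinity>"
    using emeasure_bounded_finite compact_imp_bounded by blast
  moreover have "outer_measure_of lborel (f ` B) \<le> emeasure lborel (f ` cball 0 m)"
    using outer_measure_of_mono[OF image_mono[OF m], of lborel f] \<open>compact (f ` cball 0 m)\<close>
    by (simp add: compact_imp_closed borel_closed)
  ultimately have "emeasure lborel E < \<infinity>" unfolding E(3) by (meson le_less_trans)
  then obtain a where a: "0 \<le> a" "emeasure lborel E = ennreal a"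
    by (cases "emeasure lborel E") auto
  have "\<exists>F. F \<in> sets borel \<and> F \<subseteq> f ` B \<and> ennreal a \<le> emeasure lborel F"
  proof (cases "a = 0")
    case True
    then show ?thesis by (intro exI[of _ "{}"]) simp
  next
    case False
    have "\<exists>K. compact K \<and> K \<subseteq> B \<and> ennreal (a - 1 / real (Suc n)) \<le> emeasure lborel (f ` K)" for n
      by (rule compact_image_outer_approx[OF f B]) (use a False E in \<open>simp add: ennreal_less_iff ennreal_lessI\<close>)
    then obtain K where K: "\<And>n. compact (K n)" "\<And>n. K n \<subseteq> B"
        "\<And>n. ennreal (a - 1 / real (Suc n)) \<le> emeasure lborel (f ` K n)" by metis
    have mK: "f ` K n \<in> sets borel" for n
      using compact_continuous_image[OF continuous_on_subset[OF f] K(1)[of n]]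
      by (simp add: compact_imp_closed borel_closed)
    let ?F = "\<Union>n. f ` K n"
    have "ennreal a \<le> emeasure lborel ?F"
    proof (rule ennreal_le_epsilon)
      fix e :: real assume "0 < e"
      then obtain n where n: "1 / real (Suc n) < e" using nat_approx_posE by blast
      have "ennreal a \<le> ennreal (a - 1 / real (Suc n)) + ennreal (1 / real (Suc n))"
      proof (cases "1 / real (Suc n) \<le> a")
        case True
        then show ?thesis by (simp add: ennreal_plus[symmetric] del: ennreal_plus)
      next
        case False
        then have "ennreal a \<le> ennreal (1 / real (Suc n))" by (intro ennreal_leI) simp
        then show ?thesis by (simp add: add_increasing)
      qed
      also have "\<dots> \<le> emeasure lborel (f ` K n) + ennreal e"
        using n by (intro add_mono K ennreal_leI) simp
      also have "emeasure lborel (f ` K n) \<le> emeasure lborel ?F"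
        using mK by (intro emeasure_mono) auto
      finally show "ennreal a \<le> emeasure lborel ?F + ennreal e" by (simp add: add_right_mono)
    qed
    moreover have "?F \<in> sets borel" using mK by auto
    moreover have "?F \<subseteq> f ` B" using K(2) by blast
    ultimately show ?thesis by blast
  qed
  then obtain F where F: "F \<in> sets borel" "F \<subseteq> f ` B" "ennreal a \<le> emeasure lborel F" by blast
  have FE: "F \<subseteq> E" using F E by blast
  then have "emeasure lborel F \<le> ennreal a" unfolding a(2)[symmetric] by (rule emeasure_mono) (rule E)
  then have "emeasure lborel F = ennreal a" using F(3) by simp
  then have "emeasure lborel (E - F) = 0"
    using emeasure_Diff[of lborel F E] F E FE a by simp
  then have "E - F \<in> null_sets lborel" using E F by auto
  then have "f ` B - F \<in> sets lebesgue"
    by (rule sets_completionI_sub) (use E in auto)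
  moreover have "F \<in> sets lebesgue" using F by simp
  ultimately have "F \<union> (f ` B - F) \<in> sets lebesgue" by blast
  then show ?thesis using F by (simp add: Un_absorb1)
qed

lemma lebesgue_measurable_image:
  fixes f :: "'a::euclidean_space \<Rightarrow> 'b::euclidean_space"
  assumes f: "continuous_on UNIV f" and B: "B \<in> sets borel"
  shows "f ` B \<in> sets lebesgue"
proof -
  have "f ` (B \<inter> cball 0 (real m)) \<in> sets lebesgue" for m
    using B by (intro lebesgue_measurable_bounded_image f) (auto intro: bounded_Int)
  then have "(\<Union>m. f ` (B \<inter> cball 0 (real m))) \<in> sets lebesgue" by blast
  moreover have "(\<Union>m. f ` (B \<inter> cball 0 (real m))) = f ` B"
    using real_arch_simple by (fastforce simp: image_iff)
  ultimately show ?thesis by simp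
qed

section \<open>Hausdorff dimension of Lipschitz images\<close>

lemma diam_pow_lipschitz_image:
  assumes C: "0 < C" and lip: "\<And>x y. x \<in> U \<Longrightarrow> y \<in> U \<Longrightarrow> dist (f x) (f y) \<le> C * dist x y"
    and U: "bounded U" and s: "0 \<le> s"
  shows "bounded (f ` U)" "diameter (f ` U) \<le> C * diameter U"
    "diam_pow s (f ` U) \<le> ennreal (C powr s) * diam_pow s U"
proof -
  have dist_le: "dist (f x) (f y) \<le> C * diameter U" if "x \<in> U" "y \<in> U" for x y
    using lip[OF that] diameter_bounded_bound[OF U that] C by (meson mult_left_mono order_trans less_imp_le)
  then show bd: "bounded (f ` U)" unfolding bounded_two_points by blast
  have d0: "0 \<le> diameter U" using U by (rule diameter_ge_0)
  show dle: "diameter (f ` U) \<le> C * diameter U"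
  proof (cases "U = {}")
    case False
    then show ?thesis
      unfolding diameter_def[of "f ` U"] using dist_le by (auto intro!: cSUP_least)
  qed (simp add: diameter_def)
  show "diam_pow s (f ` U) \<le> ennreal (C powr s) * diam_pow s U"
  proof (cases "U = {} \<or> s = 0")
    case True
    then show ?thesis using C by (auto simp: diam_pow_def)
  next
    case False
    have "diameter (f ` U) powr s \<le> (C * diameter U) powr s"
      using dle s bd by (intro powr_mono2) (auto intro: diameter_ge_0)
    also have "\<dots> = C powr s * diameter U powr s" using C d0 by (simp add: powr_mult)
    finally show ?thesis using False by (simp add: diam_pow_def ennreal_mult[symmetric] ennreal_leI)
  qed
qed

lemma hausdorff_dim_lipschitz_image:
  fixes f :: "'a::metric_space \<Rightarrow> 'b::metric_space"
  assumes C: "0 < C" and lip: "\<And>x y. x \<in> A \<Longrightarrow> y \<in> A \<Longrightarrow> dist (f x) (f y) \<le> C * dist x y"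
  shows "hausdorff_dim (f ` A) \<le> hausdorff_dim A"
  unfolding hausdorff_dim_def
proof (rule Inf_superset_mono, rule image_mono, rule subsetI)
  fix s assume "s \<in> {s. 0 \<le> s \<and> hausdorff_measure s A = 0}"
  then have s: "0 \<le> s" "hausdorff_measure s A = 0" by auto
  have zero: "hausdorff_premeasure \<delta> s A = 0" if "0 < \<delta>" for \<delta>
  proof -
    have "hausdorff_premeasure \<delta> s A \<le> hausdorff_measure s A"
      unfolding hausdorff_measure_def using that by (intro SUP_upper) simp
    then show ?thesis using s by simp
  qed
  have "hausdorff_premeasure \<delta> s (f ` A) \<le> 0" if \<delta>: "0 < \<delta>" for \<delta>
  proof (rule ennreal_le_epsilon)
    fix e :: real assume e: "0 < e"
    define c where "c = C powr s"
    have c: "0 < c" using C by (simp add: c_def)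
    have "hausdorff_premeasure (\<delta> / C) s A < ennreal (e / c)"
      using zero[of "\<delta> / C"] \<delta> C e c by simp
    then obtain U :: "nat \<Rightarrow> 'a set" where U: "A \<subseteq> (\<Union>i. U i)" "\<And>i. bounded (U i)"
        "\<And>i. diameter (U i) \<le> \<delta> / C" "(\<Sum>i. diam_pow s (U i)) < ennreal (e / c)"
      unfolding hausdorff_premeasure_def Inf_less_iff by auto
    \<comment> \<open>The map is Lipschitz on \<open>A\<close> only, so the covering sets are cut
      down before taking images.\<close>
    define V where "V i = U i \<inter> A" for i
    have bV: "bounded (V i)" for i unfolding V_def by (rule bounded_subset[OF U(2)]) auto
    have lipV: "dist (f x) (f y) \<le> C * dist x y" if "x \<in> V i" "y \<in> V i" for x y i
      using that lip by (auto simp: V_def)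
    note im = diam_pow_lipschitz_image[OF C lipV bV s(1)]
    have dV: "diameter (V i) \<le> diameter (U i)" for i
      unfolding V_def by (intro diameter_subset U(2)) auto
    have dpV: "diam_pow s (V i) \<le> diam_pow s (U i)" for i
    proof (cases "V i = {} \<or> s = 0")
      case True
      then show ?thesis by (auto simp: diam_pow_def V_def)
    next
      case False
      moreover have "diameter (V i) powr s \<le> diameter (U i) powr s"
        using dV s bV by (intro powr_mono2) (auto intro: diameter_ge_0)
      ultimately show ?thesis by (auto simp: diam_pow_def V_def intro!: ennreal_leI)
    qed
    have "hausdorff_premeasure \<delta> s (f ` A) \<le> (\<Sum>i. diam_pow s (f ` V i))"
      unfolding hausdorff_premeasure_def
    proof (rule Inf_lower, rule CollectI, intro exI conjI allI)
      show "f ` A \<subseteq> (\<Union>i. f ` V i)" 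
      proof
        fix y assume "y \<in> f ` A"
        then obtain x where x: "x \<in> A" "y = f x" by blast
        then obtain i where "x \<in> U i" using U(1) by blast
        then show "y \<in> (\<Union>i. f ` V i)" using x by (auto simp: V_def)
      qed
      show "bounded (f ` V i)" for i by (rule im)
      show "diameter (f ` V i) \<le> \<delta>" for i
      proof -
        have "diameter (f ` V i) \<le> C * diameter (V i)" by (rule im)
        also have "\<dots> \<le> C * (\<delta> / C)"
          using C order_trans[OF dV U(3)] by (intro mult_left_mono) auto
        finally show ?thesis using C by simp
      qed
    qed simp
    also have "\<dots> \<le> (\<Sum>i. ennreal c * diam_pow s (U i))"
    proof (intro suminf_le allI)
      fix i
      have "diam_pow s (f ` V i) \<le> ennreal c * diam_pow s (V i)" unfolding c_def by (rule im)
      also have "\<dots> \<le> ennreal c * diam_pow s (U i)" by (intro mult_left_mono dpV) simp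
      finally show "diam_pow s (f ` V i) \<le> ennreal c * diam_pow s (U i)" .
    qed auto
    also have "\<dots> = ennreal c * (\<Sum>i. diam_pow s (U i))" by (rule ennreal_suminf_cmult)
    also have "\<dots> \<le> ennreal c * ennreal (e / c)" by (rule mult_left_mono[OF less_imp_le[OF U(4)]]) simp
    also have "\<dots> = ennreal (c * (e / c))" using c e by (intro ennreal_mult[symmetric]) auto
    also have "c * (e / c) = e" using c by simp
    finally show "hausdorff_premeasure \<delta> s (f ` A) \<le> 0 + ennreal e" by simp
  qed
  then have "hausdorff_measure s (f ` A) \<le> 0"
    unfolding hausdorff_measure_def by (intro SUP_least) simp
  then show "s \<in> {s. 0 \<le> s \<and> hausdorff_measure s (f ` A) = 0}" using s by simp
qed

section \<open>Rotated dilates and their sums\<close>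

lemma hausdorff_dim_nonneg: "0 \<le> hausdorff_dim A"
  unfolding hausdorff_dim_def by (rule Inf_greatest) auto

text \<open>Frostman's lemma read backwards: a bound on the exponents of all Frostman measures on
  the set bounds its dimension.\<close>

lemma hausdorff_dim_le_of_frostman:
  fixes A :: "'a::euclidean_space set"
  assumes A: "A \<in> sets borel" "A \<noteq> {}" and b: "0 \<le> b"
    and le: "\<And>s K \<mu>. K \<subseteq> A \<Longrightarrow> frostman_measure s K \<mu> \<Longrightarrow> s \<le> b"
  shows "hausdorff_dim A \<le> ereal b"
proof (rule ccontr)
  assume "\<not> ?thesis"
  then have "ereal b < hausdorff_dim A" by simp
  then obtain s where s: "ereal b < ereal s" "ereal s < hausdorff_dim A" using ereal_dense2 by blast
  then have "\<exists>K \<mu>. K \<subseteq> A \<and> frostman_measure s K \<mu>"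
    using A b by (intro frostman_lemma) auto
  then have "s \<le> b" using le by blast
  with s show False by simp
qed

lemma hausdorff_dim_real:
  fixes A :: "'a::euclidean_space set"
  assumes A: "A \<in> sets borel" "A \<noteq> {}"
  obtains e where "hausdorff_dim A = ereal e" "0 \<le> e" "e \<le> real DIM('a)"
proof -
  have "hausdorff_dim A \<le> ereal (real DIM('a))"
    by (rule hausdorff_dim_le_of_frostman[OF A]) (auto intro: frostman_exponent_le_DIM)
  with hausdorff_dim_nonneg[of A] show ?thesis
    using that by (cases "hausdorff_dim A") auto
qed

lemma frostman_measure_near_dim:
  fixes A :: "'a::euclidean_space set"
  assumes A: "A \<in> sets borel" "A \<noteq> {}" and e: "ereal e \<le> hausdorff_dim A" and \<epsilon>: "0 < \<epsilon>"
  obtains s K \<mu> where "0 \<le> s" "e - \<epsilon> < s" "K \<subseteq> A" "frostman_measure s K \<mu>"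
proof -
  \<comment> \<open>When the dimension is too small to be approached from below by a positive
    number, the exponent 0 is used.\<close>
  define s where "s = max 0 (e - \<epsilon> / 2)"
  have "0 < s \<longrightarrow> ereal s < hausdorff_dim A"
  proof
    assume "0 < s"
    then have "ereal s < ereal e" using \<epsilon> by (auto simp: s_def)
    then show "ereal s < hausdorff_dim A" using e by (rule less_le_trans)
  qed
  then have "\<exists>K \<mu>. K \<subseteq> A \<and> frostman_measure s K \<mu>"
    using A by (intro frostman_lemma) (auto simp: s_def)
  moreover have "0 \<le> s" "e - \<epsilon> < s" using \<epsilon> by (auto simp: s_def)
  ultimately show ?thesis using that by blast
qed

section \<open>Orthogonal operators as matrices\<close>

definition blinfun_of_mat :: "real^'n^'n \<Rightarrow> (real^'n) \<Rightarrow>\<^sub>L (real^'n)" where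
  "blinfun_of_mat A = Blinfun ((*v) A)"

lemma blinfun_apply_blinfun_of_mat: "blinfun_apply (blinfun_of_mat A) x = A *v x"
  unfolding blinfun_of_mat_def
  by (subst bounded_linear_Blinfun_apply) (simp_all add: matrix_vector_mul_bounded_linear)

lemma blinfun_of_mat_matrix: "blinfun_of_mat (matrix (blinfun_apply g)) = g"
  by (rule blinfun_eqI)
    (simp add: blinfun_apply_blinfun_of_mat matrix_works bounded_linear.linear[OF blinfun.bounded_linear_right])

lemma bounded_linear_blinfun_of_mat: "bounded_linear blinfun_of_mat"
proof -
  have "linear blinfun_of_mat"
    by (rule linearI; rule blinfun_eqI)
      (simp_all add: blinfun_apply_blinfun_of_mat matrix_vector_mult_add_rdistrib
        blinfun.add_left blinfun.scaleR_left scaleR_matrix_vector_assoc)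
  then show ?thesis by (simp add: linear_conv_bounded_linear)
qed

text \<open>
  The entries of a matrix are more convenient than the operator norm: matrices form a Euclidean
  space, to which Frostman's lemma applies.
\<close>

definition matrix_set :: "((real^'n) \<Rightarrow>\<^sub>L (real^'n)) set \<Rightarrow> (real^'n^'n) set" where
  "matrix_set G = {A. blinfun_of_mat A \<in> G}"

lemma matrix_set_borel: "G \<in> sets borel \<Longrightarrow> matrix_set G \<in> sets borel"
proof -
  assume G: "G \<in> sets borel"
  have "continuous_on UNIV (blinfun_of_mat :: real^'n^'n \<Rightarrow> _)"
    by (rule linear_continuous_on[OF bounded_linear_blinfun_of_mat])
  then have "(blinfun_of_mat :: real^'n^'n \<Rightarrow> _) \<in> borel_measurable borel"
    by (rule borel_measurable_continuous_onI)
  from measurable_sets[OF this G] show "matrix_set G \<in> sets borel"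
    by (simp add: matrix_set_def vimage_def)
qed

lemma blinfun_of_mat_image_matrix_set: "blinfun_of_mat ` matrix_set G = G"
proof (intro equalityI subsetI)
  fix g assume "g \<in> G"
  then show "g \<in> blinfun_of_mat ` matrix_set G"
    by (intro image_eqI[of _ _ "matrix (blinfun_apply g)"]) (simp_all add: matrix_set_def blinfun_of_mat_matrix)
qed (auto simp: matrix_set_def)

text \<open>Passing from matrices to operators is Lipschitz. The inequality carries lower bounds on
  the dimension of \<open>G\<close> over to matrices, and upper bounds for matrices back to
  \<open>G\<close>.\<close>

lemma hausdorff_dim_le_matrix_set:
  fixes G :: "((real^'n) \<Rightarrow>\<^sub>L (real^'n)) set"
  shows "hausdorff_dim G \<le> hausdorff_dim (matrix_set G)"
proof -
  obtain C where C: "0 < C" "\<And>A :: real^'n^'n. norm (blinfun_of_mat A) \<le> norm A * C"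
    using bounded_linear.pos_bounded[OF bounded_linear_blinfun_of_mat] by blast
  have "hausdorff_dim (blinfun_of_mat ` matrix_set G) \<le> hausdorff_dim (matrix_set G)"
  proof (rule hausdorff_dim_lipschitz_image[OF C(1)])
    fix A B :: "real^'n^'n"
    have "dist (blinfun_of_mat A) (blinfun_of_mat B) = norm (blinfun_of_mat (A - B))"
      by (simp add: dist_norm linear_diff[OF bounded_linear.linear[OF bounded_linear_blinfun_of_mat]])
    also have "\<dots> \<le> C * dist A B" using C(2)[of "A - B"] by (simp add: dist_norm mult.commute)
    finally show "dist (blinfun_of_mat A) (blinfun_of_mat B) \<le> C * dist A B" .
  qed
  then show ?thesis by (simp add: blinfun_of_mat_image_matrix_set)
qed

lemma matrix_set_orthogonal:
  assumes "G \<subseteq> orthogonal_group"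
  shows "matrix_set G \<subseteq> {A. orthogonal_matrix A}"
proof
  fix A assume "A \<in> matrix_set G"
  then have "orthogonal_transformation (blinfun_apply (blinfun_of_mat A))"
    using assms by (auto simp: matrix_set_def orthogonal_group_def)
  moreover have "blinfun_apply (blinfun_of_mat A) = (*v) A"
    by (rule ext) (rule blinfun_apply_blinfun_of_mat)
  ultimately show "A \<in> {A. orthogonal_matrix A}"
    by (simp add: orthogonal_transformation_matrix)
qed

text \<open>As a continuous image of a product in Euclidean space, the set comes within reach of
  push-forward measures and of the measurability of images.\<close>

lemma rotated_dilates_matrix_set:
  "rotated_dilates G T E = (\<lambda>p. fst (fst p) *\<^sub>R (snd (fst p) *v snd p)) ` ((T \<times> matrix_set G) \<times> E)"
proof (intro equalityI subsetI)
  fix y assume "y \<in> rotated_dilates G T E"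
  then obtain g r x where *: "g \<in> G" "r \<in> T" "x \<in> E" "y = r *\<^sub>R blinfun_apply g x"
    unfolding rotated_dilates_def by blast
  let ?A = "matrix (blinfun_apply g)"
  have "?A \<in> matrix_set G" using * by (simp add: matrix_set_def blinfun_of_mat_matrix)
  moreover have "y = r *\<^sub>R (?A *v x)"
    using * blinfun_apply_blinfun_of_mat[of ?A x] by (simp add: blinfun_of_mat_matrix)
  ultimately show "y \<in> (\<lambda>p. fst (fst p) *\<^sub>R (snd (fst p) *v snd p)) ` ((T \<times> matrix_set G) \<times> E)"
    using * by (intro image_eqI[of _ _ "((r, ?A), x)"]) auto
next
  fix y assume "y \<in> (\<lambda>p. fst (fst p) *\<^sub>R (snd (fst p) *v snd p)) ` ((T \<times> matrix_set G) \<times> E)"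
  then obtain r A x where "r \<in> T" "A \<in> matrix_set G" "x \<in> E" "y = r *\<^sub>R (A *v x)" by auto
  then show "y \<in> rotated_dilates G T E"
    unfolding rotated_dilates_def matrix_set_def
    by (intro CollectI exI[of _ "blinfun_of_mat A"] exI[of _ r] exI[of _ x])
      (auto simp: blinfun_apply_blinfun_of_mat)
qed

section \<open>Measures carried by GTE and by GTE + Z\<close>

lemma AE_distr_pair_image:
  fixes M :: "'a::euclidean_space measure" and N :: "'b::euclidean_space measure" and f :: "'a \<times> 'b \<Rightarrow> 'c::euclidean_space"
  assumes M: "prob_space M" "sets M = sets borel" and N: "prob_space N" "sets N = sets borel"
    and A: "compact A" "AE x in M. x \<in> A" and B: "compact B" "AE y in N. y \<in> B"
    and f: "continuous_on UNIV f"
  shows "prob_space (distr (M \<Otimes>\<^sub>M N) borel f)" "AE x in distr (M \<Otimes>\<^sub>M N) borel f. x \<in> f ` (A \<times> B)"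
    "compact (f ` (A \<times> B))"
proof -
  interpret M: prob_space M by fact
  interpret N: prob_space N by fact
  interpret P: prob_space "M \<Otimes>\<^sub>M N" by (rule prob_space_pair_measure) fact+
  interpret PP: pair_sigma_finite M N ..
  have sets_P: "sets (M \<Otimes>\<^sub>M N) = sets (borel :: ('a \<times> 'b) measure)"
    unfolding borel_prod[symmetric] by (intro sets_pair_measure_cong M N)
  have f_meas: "f \<in> borel_measurable (M \<Otimes>\<^sub>M N)"
    using borel_measurable_continuous_onI[OF f] measurable_cong_sets[OF sets_P refl, of borel] by blast
  show "prob_space (distr (M \<Otimes>\<^sub>M N) borel f)" by (rule P.prob_space_distr[OF f_meas])
  show c: "compact (f ` (A \<times> B))"
    by (rule compact_continuous_image[OF continuous_on_subset[OF f] compact_Times[OF A(1) B(1)]]) simp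
  have "A \<times> B \<in> sets (M \<Otimes>\<^sub>M N)"
    unfolding sets_P by (intro borel_closed compact_imp_closed compact_Times A B)
  then have "{p \<in> space (M \<Otimes>\<^sub>M N). p \<in> A \<times> B} \<in> sets (M \<Otimes>\<^sub>M N)" by simp
  then have "AE p in M \<Otimes>\<^sub>M N. p \<in> A \<times> B"
  proof (rule PP.AE_pair_measure)
    from A(2) show "AE x in M. AE y in N. (x, y) \<in> A \<times> B"
    proof eventually_elim
      fix x assume "x \<in> A"
      from B(2) show "AE y in N. (x, y) \<in> A \<times> B" by eventually_elim (simp add: \<open>x \<in> A\<close>)
    qed
  qed
  then have "AE p in M \<Otimes>\<^sub>M N. f p \<in> f ` (A \<times> B)" by eventually_elim blast
  moreover have "{x \<in> space borel. x \<in> f ` (A \<times> B)} \<in> sets borel"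
    using compact_imp_closed[OF c] by simp
  ultimately show "AE x in distr (M \<Otimes>\<^sub>M N) borel f. x \<in> f ` (A \<times> B)"
    by (subst AE_distr_iff[OF f_meas])
qed

lemma AE_imp_null_complement:
  assumes "AE x in \<mu>. x \<in> K" "space \<mu> = UNIV"
  shows "emeasure \<mu> (- K) = 0"
  using emeasure_eq_0_AE[of "\<lambda>x. x \<notin> K" \<mu>] assms by (simp add: Compl_eq)

lemma dilate_measure_concentrated:
  fixes \<nu> :: "(real^'n^'n) measure" and \<rho> :: "real measure" and \<alpha> :: "(real^'n) measure"
  assumes \<nu>: "frostman_measure t KG \<nu>" and \<rho>: "frostman_measure \<tau> KT \<rho>" and \<alpha>: "frostman_measure a KE \<alpha>"
  defines "K \<equiv> (\<lambda>p. fst (fst p) *\<^sub>R (snd (fst p) *v snd p)) ` ((KT \<times> KG) \<times> KE)"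
  shows "prob_space (dilate_measure \<rho> \<nu> \<alpha>)" "AE x in dilate_measure \<rho> \<nu> \<alpha>. x \<in> K" "compact K"
proof -
  let ?P = "\<rho> \<Otimes>\<^sub>M \<nu>"
  \<comment> \<open>Viewing the product measure as its own image under the identity lets the lemma
    on images of pairs be applied to it first.\<close>
  have P: "distr ?P borel (\<lambda>x. x) = ?P"
  proof (rule distr_id2)
    show "sets borel = sets ?P"
      unfolding borel_prod[symmetric]
      by (intro sets_pair_measure_cong[symmetric] frostman_measureD(2)[OF \<rho>] frostman_measureD(2)[OF \<nu>])
  qed
  have *: "prob_space ?P" "AE x in ?P. x \<in> KT \<times> KG" "compact (KT \<times> KG)"
    using AE_distr_pair_image[OF frostman_measure_prob[OF \<rho>] frostman_measureD(2)[OF \<rho>]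
        frostman_measure_prob[OF \<nu>] frostman_measureD(2)[OF \<nu>] frostman_measureD(1)[OF \<rho>] frostman_measure_AE[OF \<rho>]
        frostman_measureD(1)[OF \<nu>] frostman_measure_AE[OF \<nu>] continuous_on_id]
    unfolding P image_ident by blast+
  have sets_P: "sets ?P = sets borel" using arg_cong[OF P, of sets] by simp
  show "prob_space (dilate_measure \<rho> \<nu> \<alpha>)" "AE x in dilate_measure \<rho> \<nu> \<alpha>. x \<in> K" "compact K"
    unfolding dilate_measure_def K_def
    using AE_distr_pair_image[OF *(1) sets_P frostman_measure_prob[OF \<alpha>] frostman_measureD(2)[OF \<alpha>] *(3,2)
        frostman_measureD(1)[OF \<alpha>] frostman_measure_AE[OF \<alpha>] continuous_on_dilation]
    by blast+
qed

lemma rotated_dilates_decaying_measure: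
  fixes E :: "(real^'n) set" and T :: "real set" and G :: "((real^'n) \<Rightarrow>\<^sub>L (real^'n)) set"
  assumes E: "E \<in> sets borel" "E \<noteq> {}" and T: "T \<in> sets borel" "T \<noteq> {}" "T \<subseteq> {0<..}"
    and G: "G \<in> sets borel" "G \<noteq> {}" "G \<subseteq> orthogonal_group"
    and dims: "hausdorff_dim E = ereal e" "hausdorff_dim T = ereal \<tau>" "hausdorff_dim G = ereal g"
    and g: "(real CARD('n) - 1) * (real CARD('n) - 2) / 2 < g" and \<epsilon>: "0 < \<epsilon>"
  obtains L K \<gamma> D where "prob_space L" "sets L = sets borel" "compact K" "K \<subseteq> rotated_dilates G T E"
    "AE x in L. x \<in> K" "0 < D" "\<And>\<xi>. (cmod (fourier_transform L \<xi>))\<^sup>2 \<le> D * (1 + norm \<xi>) powr (- \<gamma>)"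
    "e + g + \<tau> - ((real CARD('n))\<^sup>2 - real CARD('n) + 2) / 2 - \<epsilon> < \<gamma>"
proof -
  let ?d = "real CARD('n)"
  \<comment> \<open>Three exponents may each lose \<epsilon>/3; the second entry keeps the exponent
    on \<open>G\<close> at or above the dimension of O(d - 1).\<close>
  define \<delta> where "\<delta> = min (\<epsilon> / 3) (g - (?d - 1) * (?d - 2) / 2)"
  have "\<delta> \<le> \<epsilon> / 3" "\<delta> \<le> g - (?d - 1) * (?d - 2) / 2"
    unfolding \<delta>_def by (rule min.cobounded1, rule min.cobounded2)
  moreover have "0 < \<delta>" using g \<epsilon> by (simp add: \<delta>_def)
  ultimately have \<delta>: "0 < \<delta>" "\<delta> \<le> \<epsilon> / 3" "(?d - 1) * (?d - 2) / 2 \<le> g - \<delta>" by linarith+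
  have mG: "matrix_set G \<in> sets borel" by (rule matrix_set_borel[OF G(1)])
  have mG_ne: "matrix_set G \<noteq> {}" using blinfun_of_mat_image_matrix_set[of G] G(2) by auto
  obtain a KE \<alpha> where \<alpha>: "0 \<le> a" "e - \<delta> < a" "KE \<subseteq> E" "frostman_measure a KE \<alpha>"
    using frostman_measure_near_dim[OF E _ \<delta>(1), of e] dims by auto
  obtain b KT \<rho> where \<rho>: "0 \<le> b" "\<tau> - \<delta> < b" "KT \<subseteq> T" "frostman_measure b KT \<rho>"
    using frostman_measure_near_dim[OF T(1,2) _ \<delta>(1), of \<tau>] dims by auto
  obtain t KG \<nu> where \<nu>: "0 \<le> t" "g - \<delta> < t" "KG \<subseteq> matrix_set G" "frostman_measure t KG \<nu>"
    using frostman_measure_near_dim[OF mG mG_ne _ \<delta>(1), of g] dims(3) hausdorff_dim_le_matrix_set[of G] by auto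
  define \<gamma> where "\<gamma> = a + b + (t - (?d - 1) * (?d - 2) / 2) - ?d"
  define K where "K = (\<lambda>p. fst (fst p) *\<^sub>R (snd (fst p) *v snd p)) ` ((KT \<times> KG) \<times> KE)"
  have conc: "prob_space (dilate_measure \<rho> \<nu> \<alpha>)" "AE x in dilate_measure \<rho> \<nu> \<alpha>. x \<in> K" "compact K"
    unfolding K_def by (rule dilate_measure_concentrated[OF \<nu>(4) \<rho>(4) \<alpha>(4)])+
  have KG: "KG \<subseteq> {g. orthogonal_matrix g}" using \<nu>(3) matrix_set_orthogonal[OF G(3)] by blast
  have KT: "KT \<subseteq> {0<..}" using \<rho>(3) T(3) by blast
  have t: "(?d - 1) * (?d - 2) / 2 \<le> t" using \<delta>(3) \<nu>(2) by linarith
  obtain D where D: "0 < D" "\<And>\<xi>. (cmod (fourier_transform (dilate_measure \<rho> \<nu> \<alpha>) \<xi>))\<^sup>2 \<le> D * (1 + norm \<xi>) powr (- \<gamma>)"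
    using dilate_measure_decay[OF \<nu>(4) KG \<rho>(4) KT \<alpha>(4) t] unfolding \<gamma>_def by blast
  have "K \<subseteq> rotated_dilates G T E"
    unfolding K_def rotated_dilates_matrix_set using \<alpha>(3) \<rho>(3) \<nu>(3) by (intro image_mono) auto
  moreover have "e + g + \<tau> - (?d\<^sup>2 - ?d + 2) / 2 - \<epsilon> < \<gamma>"
  proof -
    have "(?d - 1) * (?d - 2) / 2 + ?d = (?d\<^sup>2 - ?d + 2) / 2"
      by (simp add: field_simps power2_eq_square)
    then show ?thesis using \<alpha>(2) \<rho>(2) \<nu>(2) \<delta>(2) unfolding \<gamma>_def by linarith
  qed
  moreover have "sets (dilate_measure \<rho> \<nu> \<alpha>) = sets borel" by (simp add: dilate_measure_def)
  ultimately show ?thesis using that[of "dilate_measure \<rho> \<nu> \<alpha>" K D \<gamma>] conc D by blast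
qed

lemma sumset_sobolev_measure:
  fixes E Z :: "(real^'n) set" and T :: "real set" and G :: "((real^'n) \<Rightarrow>\<^sub>L (real^'n)) set"
  assumes E: "E \<in> sets borel" "E \<noteq> {}" and T: "T \<in> sets borel" "T \<noteq> {}" "T \<subseteq> {0<..}"
    and G: "G \<in> sets borel" "G \<noteq> {}" "G \<subseteq> orthogonal_group" and Z: "Z \<in> sets borel" "Z \<noteq> {}"
    and dims: "hausdorff_dim E = ereal e" "hausdorff_dim T = ereal \<tau>" "hausdorff_dim G = ereal g" "hausdorff_dim Z = ereal z"
    and g: "(real CARD('n) - 1) * (real CARD('n) - 2) / 2 < g"
    and s: "s < e + g + z + \<tau> - ((real CARD('n))\<^sup>2 - real CARD('n) + 2) / 2"
  obtains \<mu> K where "prob_space \<mu>" "sets \<mu> = sets borel" "compact K" "K \<subseteq> sumset (rotated_dilates G T E) Z"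
    "AE x in \<mu>. x \<in> K"
    "(\<integral>\<^sup>+x. ennreal ((cmod (fourier_transform \<mu> x))\<^sup>2 * (1 + norm x) powr (s - real DIM(real^'n))) \<partial>lborel) < \<infinity>"
proof -
  let ?\<Gamma> = "e + g + \<tau> - ((real CARD('n))\<^sup>2 - real CARD('n) + 2) / 2"
  \<comment> \<open>Half of the available room is spent on the measure on GTE and half on the one on
    \<open>Z\<close>.\<close>
  define \<epsilon> where "\<epsilon> = (?\<Gamma> + z - s) / 2"
  have \<epsilon>: "0 < \<epsilon>" using s by (simp add: \<epsilon>_def)
  obtain L KL \<gamma> D where L: "prob_space L" "sets L = sets borel" "compact KL" "KL \<subseteq> rotated_dilates G T E"
    "AE x in L. x \<in> KL" "0 < D" "\<And>\<xi>. (cmod (fourier_transform L \<xi>))\<^sup>2 \<le> D * (1 + norm \<xi>) powr (- \<gamma>)"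
    "?\<Gamma> - \<epsilon> < \<gamma>"
    by (rule rotated_dilates_decaying_measure[OF E T G dims(1-3) g \<epsilon>]) (rule that, assumption+)
  obtain \<sigma> KZ \<zeta> where \<zeta>: "0 \<le> \<sigma>" "z - \<epsilon> < \<sigma>" "KZ \<subseteq> Z" "frostman_measure \<sigma> KZ \<zeta>"
    using frostman_measure_near_dim[OF Z _ \<epsilon>, of z] dims by auto
  have "2 * \<epsilon> = ?\<Gamma> + z - s" by (simp add: \<epsilon>_def)
  with L(8) \<zeta>(2) have s': "s < \<gamma> + \<sigma>" by linarith
  have cont: "continuous_on UNIV (\<lambda>p :: (real^'n) \<times> (real^'n). fst p + snd p)"
    by (intro continuous_intros)
  let ?K = "(\<lambda>p. fst p + snd p) ` (KL \<times> KZ)"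
  have conc: "prob_space (sum_measure L \<zeta>)" "AE x in sum_measure L \<zeta>. x \<in> ?K" "compact ?K"
    unfolding sum_measure_def
    using AE_distr_pair_image[OF L(1,2) frostman_measure_prob[OF \<zeta>(4)] frostman_measureD(2)[OF \<zeta>(4)] L(3,5)
        frostman_measureD(1)[OF \<zeta>(4)] frostman_measure_AE[OF \<zeta>(4)] cont] by blast+
  have "?K \<subseteq> sumset (rotated_dilates G T E) Z"
    unfolding sumset_def using L(4) \<zeta>(3) by force
  then show ?thesis
    using that[of "sum_measure L \<zeta>" ?K] conc sobolev_sum_measure[OF L(1,2,6,7) \<zeta>(4) s'] by simp
qed

lemma fourier_dim_rotated_dilates:
  fixes E :: "(real^'n) set" and T :: "real set" and G :: "((real^'n) \<Rightarrow>\<^sub>L (real^'n)) set"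
  assumes E: "E \<in> sets borel" "E \<noteq> {}" and T: "T \<in> sets borel" "T \<noteq> {}" "T \<subseteq> {0<..}"
    and G: "G \<in> sets borel" "G \<noteq> {}" "G \<subseteq> orthogonal_group"
    and dims: "hausdorff_dim E = ereal e" "hausdorff_dim T = ereal \<tau>" "hausdorff_dim G = ereal g"
    and g: "(real CARD('n) - 1) * (real CARD('n) - 2) / 2 < g"
    and \<Gamma>: "e + g + \<tau> - ((real CARD('n))\<^sup>2 - real CARD('n) + 2) / 2 \<le> real CARD('n)"
  shows "ereal (e + g + \<tau> - ((real CARD('n))\<^sup>2 - real CARD('n) + 2) / 2) \<le> fourier_dim (rotated_dilates G T E)"
proof (rule ereal_le_epsilon2)
  fix \<epsilon> :: real assume \<epsilon>: "0 < \<epsilon>"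
  let ?\<Gamma> = "e + g + \<tau> - ((real CARD('n))\<^sup>2 - real CARD('n) + 2) / 2"
  obtain L K \<gamma> D where L: "prob_space L" "sets L = sets borel" "compact K" "K \<subseteq> rotated_dilates G T E"
    "AE x in L. x \<in> K" "0 < D" "\<And>\<xi>. (cmod (fourier_transform L \<xi>))\<^sup>2 \<le> D * (1 + norm \<xi>) powr (- \<gamma>)"
    "?\<Gamma> - \<epsilon> < \<gamma>"
    by (rule rotated_dilates_decaying_measure[OF E T G dims g \<epsilon>]) (rule that, assumption+)
  have "emeasure L (- K) = 0"
    by (rule AE_imp_null_complement[OF L(5)]) (use sets_eq_imp_space_eq[OF L(2)] in simp)
  then have "L \<in> radon_measures_on (rotated_dilates G T E)"
    by (intro radon_measures_onI[OF L(1,2,3,4)])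
  moreover have "\<forall>x. cmod (fourier_transform L x) \<le> sqrt D * (1 + norm x) powr (- (?\<Gamma> - \<epsilon>) / 2)"
  proof
    fix x :: "real^'n"
    have u: "1 \<le> 1 + norm x" by simp
    have "(cmod (fourier_transform L x))\<^sup>2 \<le> D * (1 + norm x) powr (- \<gamma>)" by (rule L(7))
    also have "\<dots> \<le> D * (1 + norm x) powr (- (?\<Gamma> - \<epsilon>))"
      using L(6,8) u by (intro mult_left_mono powr_mono) auto
    finally have "cmod (fourier_transform L x) \<le> sqrt (D * (1 + norm x) powr (- (?\<Gamma> - \<epsilon>)))"
      by (rule real_le_rsqrt)
    also have "\<dots> = sqrt D * (1 + norm x) powr (- (?\<Gamma> - \<epsilon>) / 2)"
      using u by (simp add: real_sqrt_mult powr_half_sqrt_powr)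
    finally show "cmod (fourier_transform L x) \<le> sqrt D * (1 + norm x) powr (- (?\<Gamma> - \<epsilon>) / 2)" .
  qed
  moreover have "0 < sqrt D" using L(6) by simp
  \<comment> \<open>The cap in the definition of \<open>fourier_dim\<close>; this is the purpose of
    the last hypothesis.\<close>
  moreover have "?\<Gamma> - \<epsilon> \<le> real DIM(real^'n)" using \<Gamma> \<epsilon> by simp
  ultimately have "ereal (?\<Gamma> - \<epsilon>) \<le> fourier_dim (rotated_dilates G T E)"
    unfolding fourier_dim_def by (intro Sup_upper imageI CollectI conjI) blast+
  then show "ereal ?\<Gamma> \<le> fourier_dim (rotated_dilates G T E) + ereal \<epsilon>"
    by (cases "fourier_dim (rotated_dilates G T E)") auto
qed

theorem theorem1p5:
  fixes d :: nat
    and E Z :: "(real ^ 'n) set"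
    and T :: "real set"
    and G :: "((real ^ 'n) \<Rightarrow>\<^sub>L (real ^ 'n)) set"
  assumes "CARD('n) = d" and "d \<ge> 2"
    and "E \<in> sets borel" and "E \<noteq> {}"
    and "Z \<in> sets borel" and "Z \<noteq> {}"
    and "T \<in> sets borel" and "T \<noteq> {}" and "T \<subseteq> {0<..}"
    and "G \<in> sets borel" and "G \<noteq> {}" and "G \<subseteq> orthogonal_group"
    and "hausdorff_dim G > ereal ((real d - 1) * (real d - 2) / 2)"
  shows
    "(fourier_dim (rotated_dilates G T E)
        \<ge> hausdorff_dim E + hausdorff_dim G + hausdorff_dim T
          - ereal (((real d)\<^sup>2 - real d + 2) / 2)
      \<and> sobolev_dim (sumset (rotated_dilates G T E) Z)
        \<ge> hausdorff_dim E + hausdorff_dim G + hausdorff_dim Z + hausdorff_dim T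
          - ereal (((real d)\<^sup>2 - real d + 2) / 2))
     \<and> (hausdorff_dim E + hausdorff_dim G + hausdorff_dim Z + hausdorff_dim T
          > ereal (((real d)\<^sup>2 + real d + 2) / 2)
        \<longrightarrow> emeasure lebesgue (sumset (rotated_dilates G T E) Z) > 0)
     \<and> (\<forall>u::real. 0 < u \<and> u < real d \<and>
          hausdorff_dim E + hausdorff_dim G + hausdorff_dim Z + hausdorff_dim T
            > ereal (((real d)\<^sup>2 - real d + 2) / 2 + u)
        \<longrightarrow> hausdorff_dim (sumset (rotated_dilates G T E) Z) \<ge> ereal u)"
proof -
  have d: "real CARD('n) = real d" using assms(1) by simp
  have DIM: "real DIM(real^'n) = real d" using assms(1) by simp
  obtain e where e: "hausdorff_dim E = ereal e" "0 \<le> e" "e \<le> real DIM(real^'n)"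
    using hausdorff_dim_real[OF assms(3,4)] .
  obtain z where z: "hausdorff_dim Z = ereal z" "0 \<le> z" "z \<le> real DIM(real^'n)"
    using hausdorff_dim_real[OF assms(5,6)] .
  obtain \<tau> where \<tau>: "hausdorff_dim T = ereal \<tau>" "0 \<le> \<tau>" "\<tau> \<le> real DIM(real)"
    using hausdorff_dim_real[OF assms(7,8)] .
  have mG_ne: "matrix_set G \<noteq> {}" using blinfun_of_mat_image_matrix_set[of G] assms(11) by auto
  \<comment> \<open>Makes the dimension of \<open>G\<close> finite and, more precisely, at most that
    of O(d), as needed for the cap in \<open>fourier_dim\<close>.\<close>
  have "hausdorff_dim (matrix_set G) \<le> ereal (real d * (real d - 1) / 2)"
  proof (rule hausdorff_dim_le_of_frostman[OF matrix_set_borel[OF assms(10)] mG_ne])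
    show "0 \<le> real d * (real d - 1) / 2" using assms(2) by simp
    fix s K \<mu> assume "K \<subseteq> matrix_set G" "frostman_measure s K \<mu>"
    then show "s \<le> real d * (real d - 1) / 2"
      using orthogonal_frostman_exponent_le[of s K \<mu>] matrix_set_orthogonal[OF assms(12)] d by auto
  qed
  then have G_le: "hausdorff_dim G \<le> ereal (real d * (real d - 1) / 2)"
    using hausdorff_dim_le_matrix_set order_trans by blast
  obtain g where g: "hausdorff_dim G = ereal g" "g \<le> real d * (real d - 1) / 2"
    using G_le assms(13) by (cases "hausdorff_dim G") auto
  have g': "(real CARD('n) - 1) * (real CARD('n) - 2) / 2 < g"
    using assms(13) unfolding d g(1) by simp
  let ?c = "((real d)\<^sup>2 - real d + 2) / 2"
  let ?S = "sumset (rotated_dilates G T E) Z"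
  \<comment> \<open>The dimension of O(d) is \<open>?c - 1\<close>, and the missing 1 is supplied by
    the dimension of \<open>T\<close>.\<close>
  have \<Gamma>: "e + g + \<tau> - ?c \<le> real d"
  proof -
    have "real d * (real d - 1) / 2 = ?c - 1" by (simp add: field_simps power2_eq_square)
    moreover have "e \<le> real d" "\<tau> \<le> 1" using e(3) \<tau>(3) DIM by simp_all
    ultimately show ?thesis using g(2) by linarith
  qed
  have sob: "\<exists>\<mu> K. prob_space \<mu> \<and> sets \<mu> = sets borel \<and> compact K \<and> K \<subseteq> ?S \<and> (AE x in \<mu>. x \<in> K) \<and>
      (\<integral>\<^sup>+x. ennreal ((cmod (fourier_transform \<mu> x))\<^sup>2 * (1 + norm x) powr (s - real DIM(real^'n))) \<partial>lborel) < \<infinity>"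
    if "s < e + g + z + \<tau> - ?c" for s
  proof (rule sumset_sobolev_measure[OF assms(3,4,7,8,9,10,11,12,5,6) e(1) \<tau>(1) g(1) z(1) g'])
    show "s < e + g + z + \<tau> - ((real CARD('n))\<^sup>2 - real CARD('n) + 2) / 2" unfolding d by (rule that)
    fix \<mu> K assume "prob_space \<mu>" "sets \<mu> = sets borel" "compact K" "K \<subseteq> ?S" "AE x in \<mu>. x \<in> K"
      "(\<integral>\<^sup>+x. ennreal ((cmod (fourier_transform \<mu> x))\<^sup>2 * (1 + norm x) powr (s - real DIM(real^'n))) \<partial>lborel) < \<infinity>"
    then show ?thesis by (intro exI[of _ \<mu>] exI[of _ K] conjI)
  qed
  \<comment> \<open>Unlike the Sobolev dimension, which has no upper limit in its definition, ball
    averages require \<open>s \<le> real d\<close>.\<close>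
  have energy: "\<exists>\<mu> K C. prob_space \<mu> \<and> sets \<mu> = sets borel \<and> compact K \<and> K \<subseteq> ?S \<and> (AE x in \<mu>. x \<in> K) \<and> 0 \<le> C \<and>
      (\<forall>r. 0 < r \<longrightarrow> r \<le> 1 \<longrightarrow> (\<integral>\<^sup>+x. emeasure \<mu> (cball x r) \<partial>\<mu>) \<le> ennreal (C * r powr s))"
    if s: "s < e + g + z + \<tau> - ?c" "s \<le> real d" for s
  proof -
    obtain \<mu> K where \<mu>: "prob_space \<mu>" "sets \<mu> = sets borel" "compact K" "K \<subseteq> ?S" "AE x in \<mu>. x \<in> K"
      "(\<integral>\<^sup>+x. ennreal ((cmod (fourier_transform \<mu> x))\<^sup>2 * (1 + norm x) powr (s - real DIM(real^'n))) \<partial>lborel) < \<infinity>"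
      using sob[OF s(1)] by blast
    then interpret prob_space \<mu> by simp
    obtain C where C: "0 \<le> C" "\<forall>r. 0 < r \<longrightarrow> r \<le> 1 \<longrightarrow> (\<integral>\<^sup>+x. emeasure \<mu> (cball x r) \<partial>\<mu>) \<le> ennreal (C * r powr s)"
      using sobolev_ball_energy[OF finite_measure_axioms \<mu>(2,6)] s(2) unfolding DIM by blast
    show ?thesis by (intro exI[of _ \<mu>] exI[of _ K] exI[of _ C] conjI \<mu>(1-5) C)
  qed
  have part1: "hausdorff_dim E + hausdorff_dim G + hausdorff_dim T - ereal ?c \<le> fourier_dim (rotated_dilates G T E)"
    using fourier_dim_rotated_dilates[OF assms(3,4,7,8,9,10,11,12) e(1) \<tau>(1) g(1) g'] \<Gamma>
    unfolding d e(1) \<tau>(1) g(1) by simp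
  have part2: "hausdorff_dim E + hausdorff_dim G + hausdorff_dim Z + hausdorff_dim T - ereal ?c \<le> sobolev_dim ?S"
  proof -
    have "ereal (e + g + z + \<tau> - ?c) \<le> sobolev_dim ?S"
    proof (rule ereal_le_epsilon2)
      fix \<epsilon> :: real assume "0 < \<epsilon>"
      then obtain \<mu> K where \<mu>: "prob_space \<mu>" "sets \<mu> = sets borel" "compact K" "K \<subseteq> ?S" "AE x in \<mu>. x \<in> K"
        "(\<integral>\<^sup>+x. ennreal ((cmod (fourier_transform \<mu> x))\<^sup>2 * (1 + norm x) powr (e + g + z + \<tau> - ?c - \<epsilon> - real DIM(real^'n))) \<partial>lborel) < \<infinity>"
        using sob[of "e + g + z + \<tau> - ?c - \<epsilon>"] by auto
      have sp: "space \<mu> = UNIV" using sets_eq_imp_space_eq[OF \<mu>(2)] by simp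
      have "\<mu> \<in> radon_measures_on ?S"
        using AE_imp_null_complement[OF \<mu>(5) sp] by (intro radon_measures_onI[OF \<mu>(1-4)])
      moreover have "emeasure \<mu> UNIV = 1" using prob_space.emeasure_space_1[OF \<mu>(1)] sp by simp
      ultimately have "sobolev_dim_measure \<mu> \<le> sobolev_dim ?S"
        unfolding sobolev_dim_def by (intro Sup_upper imageI) simp
      moreover have "ereal (e + g + z + \<tau> - ?c - \<epsilon>) \<le> sobolev_dim_measure \<mu>"
        unfolding sobolev_dim_measure_def by (intro Sup_upper imageI CollectI \<mu>(6))
      ultimately have "ereal (e + g + z + \<tau> - ?c - \<epsilon>) \<le> sobolev_dim ?S" by (rule order_trans[rotated])
      then show "ereal (e + g + z + \<tau> - ?c) \<le> sobolev_dim ?S + ereal \<epsilon>"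
        by (cases "sobolev_dim ?S") auto
    qed
    then show ?thesis unfolding e(1) \<tau>(1) g(1) z(1) by simp
  qed
  have part3: "0 < emeasure lebesgue ?S"
    if "ereal (((real d)\<^sup>2 + real d + 2) / 2) < hausdorff_dim E + hausdorff_dim G + hausdorff_dim Z + hausdorff_dim T"
  proof -
    have "((real d)\<^sup>2 + real d + 2) / 2 < e + g + z + \<tau>"
      using that unfolding e(1) \<tau>(1) g(1) z(1) by simp
    \<comment> \<open>The threshold is exactly where \<open>s = real d\<close> becomes
      admissible.\<close>
    moreover have "((real d)\<^sup>2 + real d + 2) / 2 = ?c + real d" by (simp add: field_simps)
    ultimately have "real d < e + g + z + \<tau> - ?c" by linarith
    from energy[OF this order_refl]
    obtain \<mu> K C where \<mu>: "prob_space \<mu>" "sets \<mu> = sets borel" "compact K" "K \<subseteq> ?S" "AE x in \<mu>. x \<in> K" "0 \<le> C"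
      "\<And>r. 0 < r \<Longrightarrow> r \<le> 1 \<Longrightarrow> (\<integral>\<^sup>+x. emeasure \<mu> (cball x r) \<partial>\<mu>) \<le> ennreal (C * r powr real d)"
      by blast
    have sp: "space \<mu> = UNIV" using sets_eq_imp_space_eq[OF \<mu>(2)] by simp
    have "0 < emeasure lborel K"
      using lborel_pos_of_ball_energy[OF \<mu>(1-3) AE_imp_null_complement[OF \<mu>(5) sp] \<mu>(6)] \<mu>(7) unfolding DIM by blast
    also have "emeasure lborel K = emeasure lebesgue K"
      using \<mu>(3) by (simp add: compact_imp_closed borel_closed)
    \<comment> \<open>Monotonicity requires the larger set to be measurable; \<open>emeasure\<close>
      would be 0 otherwise.\<close>
    also have "\<dots> \<le> emeasure lebesgue ?S"
    proof (rule emeasure_mono[OF \<mu>(4)])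
      let ?f = "\<lambda>p :: ((real \<times> (real^'n^'n)) \<times> (real^'n)) \<times> (real^'n).
        fst (fst (fst p)) *\<^sub>R (snd (fst (fst p)) *v snd (fst p)) + snd p"
      have S_eq: "?S = ?f ` (((T \<times> matrix_set G) \<times> E) \<times> Z)"
        unfolding sumset_def rotated_dilates_matrix_set by force
      have cont: "continuous_on UNIV ?f"
        by (intro continuous_on_add continuous_on_snd continuous_on_id
            continuous_on_compose2[OF continuous_on_dilation[of UNIV] continuous_on_fst[OF continuous_on_id]]) simp
      have mB: "((T \<times> matrix_set G) \<times> E) \<times> Z \<in> sets borel"
        by (intro borel_Times matrix_set_borel assms)
      show "?S \<in> sets lebesgue"
        unfolding S_eq by (rule lebesgue_measurable_image[OF cont mB])
    qed
    finally show ?thesis .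
  qed
  have part4: "ereal u \<le> hausdorff_dim ?S"
    if u: "u < real d" "ereal (?c + u) < hausdorff_dim E + hausdorff_dim G + hausdorff_dim Z + hausdorff_dim T" for u
  proof -
    have "u < e + g + z + \<tau> - ?c" using u(2) unfolding e(1) \<tau>(1) g(1) z(1) by simp
    from energy[OF this less_imp_le[OF u(1)]]
    obtain \<mu> K C where \<mu>: "prob_space \<mu>" "sets \<mu> = sets borel" "K \<subseteq> ?S" "AE x in \<mu>. x \<in> K" "0 \<le> C"
      "\<And>r. 0 < r \<Longrightarrow> r \<le> 1 \<Longrightarrow> (\<integral>\<^sup>+x. emeasure \<mu> (cball x r) \<partial>\<mu>) \<le> ennreal (C * r powr u)"
      by blast
    then show ?thesis by (rule hausdorff_dim_ge_of_ball_energy)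
  qed
  show ?thesis using part1 part2 part3 part4 by blast
qed

end
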